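(* Let $l\ge1$. Let $\mathcal{C}_{n,l}^*$ be the set of words of length $l$ on $\mathcal{C}_n$, and let $\mathcal{O}_l$ be the set of pairs $(P,Q)$ where $P$ is a symplectic tableau and $Q=(Q_1,\dots,Q_l)$ is an $n$-oscillating tableau of length $l$ such that $P$ has shape $Q_l$. Then the map $\Psi:\mathcal{C}_{n,l}^*\to\mathcal{O}_l$, $w\mapsto(P(w),Q(w))$, is a bijection.
   Context: Alphabet $\mathcal{C}_n=\{1<\dots<n<\bar n<\dots<\bar 1\}$, words $\mathcal{C}_n^*$, crystal graph $G_n$ on $\mathcal{C}_n^*$ with arrows $w\xrightarrow{i}\tilde f_i(w)$ for Kashiwara's operators $\tilde e_i,\tilde f_i$ ($1\le i\le n$) of $U_q(\mathfrak{sp}_{2n})$: on letters $\tilde f_i(i)=i+1$, $\tilde f_i(\overline{i+1})=\bar i$ for $i<n$, $\tilde f_n(n)=\bar n$, $\tilde e_i$ inverse, other values $0$; on words via the signature rule (mark letters with $\tilde f_i\neq0$ by $+$, with $\tilde e_i\ne0$ by $-$, cancel adjacent $+-$ pairs repeatedly, $\tilde f_i$ acts on leftmost remaining $+$, $\tilde e_i$ on rightmost remaining $-$, result $0$ if none). $w_1\sim w_2$ means the connected components of $w_1,w_2$ are isomorphic (equivalently their highest weight vertices, those killed by all $\tilde e_i$, have equal $d$-vectors, $d(w)_i$ = number of $i$ minus number of $\bar i$) and $w_1,w_2$ correspond under the unique isomorphism. Admissible columns: strictly increasing one-column fillings such that for every $m\le n$ at most $m$ letters $x$ satisfy $x\le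 m$ or $x\ge\bar m$. Split $(lC,rC)$: with $z_1>\dots>z_r$ the unbarred $z$ with $z,\bar z\in C$, $t_1$ the greatest unbarred letter $<z_1$ with $t_1,\bar t_1\notin C$, $t_i$ the greatest unbarred letter $<\min(t_{i-1},z_i)$ with $t_i,\bar t_i\notin C$; $rC$ replaces $\bar z_i$ by $\bar t_i$, $lC$ replaces $z_i$ by $t_i$ (reorder). A symplectic tableau is $T=C_1\cdots C_r$ of admissible columns (left to right, top aligned, heights weakly decreasing) with the rows of each array $rC_i\,lC_{i+1}$ weakly increasing; $\mathrm{w}(T)=\mathrm{w}(C_r)\cdots\mathrm{w}(C_1)$; its shape is the Young diagram formed by its columns. $P(w)$ is the unique symplectic tableau with $w\sim\mathrm{w}(P(w))$. For $w=x_1\cdots x_l$, $Q(w)=(Q_1,\dots,Q_l)$ where $Q_i$ is the shape of $P(x_1\cdots x_i)$. An $n$-oscillating tableau of length $l$ is a sequence of Young diagrams $(Q_1,\dots,Q_l)$ with $Q_1$ a single box, any two consecutive diagrams differing by exactly one box (one obtained from the other by adding a box), and no $Q_i$ having a column of height greater than $n$. *)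

theory Defs
  imports Main
begin

section \<open>Letters and words\<close>

text \<open>\<open>Unb i\<close> is the letter \<open>i\<close> and \<open>Bar i\<close> the barred letter \<open>i\<close>;
  the order \<open>1 < \<dots> < n < Bar n < \<dots> < Bar 1\<close> does not depend on \<open>n\<close>.\<close>

datatype letter = Unb nat | Bar nat

instantiation letter :: linorder
begin

fun less_eq_letter :: "letter \<Rightarrow> letter \<Rightarrow> bool" where
  "Unb i \<le> Unb j \<longleftrightarrow> i \<le> j"
| "Unb i \<le> Bar j \<longleftrightarrow> True"
| "Bar i \<le> Unb j \<longleftrightarrow> False"
| "Bar i \<le> Bar j \<longleftrightarrow> j \<le> i"

definition less_letter :: "letter \<Rightarrow> letter \<Rightarrow> bool" where
  "less_letter x y \<longleftrightarrow> x \<le> y \<and> \<not> y \<le> x"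

instance
proof
  fix x y z :: letter
  show "x < y \<longleftrightarrow> x \<le> y \<and> \<not> y \<le> x" by (rule less_letter_def)
  show "x \<le> x" by (cases x) auto
  show "x \<le> y \<Longrightarrow> y \<le> z \<Longrightarrow> x \<le> z" by (cases x; cases y; cases z) auto
  show "x \<le> y \<Longrightarrow> y \<le> x \<Longrightarrow> x = y" by (cases x; cases y) auto
  show "x \<le> y \<or> y \<le> x" by (cases x; cases y) auto
qed

end

definition alphabet :: "nat \<Rightarrow> letter set" where
  "alphabet n = Unb ` {1..n} \<union> Bar ` {1..n}"

type_synonym word = "letter list"

definition words_of_length :: "nat \<Rightarrow> nat \<Rightarrow> word set" where
  "words_of_length n l = {w. set w \<subseteq> alphabet n \<and> length w = l}"

section \<open>The crystal graph on words\<close>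

text \<open>Kashiwara's operators; the value \<open>0\<close> is \<open>None\<close>, and only the colours
  \<open>i \<in> {1..n}\<close> are meaningful.\<close>

definition f_letter :: "nat \<Rightarrow> nat \<Rightarrow> letter \<Rightarrow> letter option" where
  "f_letter n i x =
     (if i < n \<and> x = Unb i then Some (Unb (i + 1))
      else if i < n \<and> x = Bar (i + 1) then Some (Bar i)
      else if i = n \<and> x = Unb n then Some (Bar n)
      else None)"

definition e_letter :: "nat \<Rightarrow> nat \<Rightarrow> letter \<Rightarrow> letter option" where
  "e_letter n i x =
     (if i < n \<and> x = Unb (i + 1) then Some (Unb i)
      else if i < n \<and> x = Bar i then Some (Bar (i + 1))
      else if i = n \<and> x = Bar n then Some (Unb n)
      else None)"

datatype sign = Plus | Minus

text \<open>The marked letters of a word, each as its position together with its sign.\<close>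

definition signature :: "nat \<Rightarrow> nat \<Rightarrow> word \<Rightarrow> (nat \<times> sign) list" where
  "signature n i w =
     concat (map (\<lambda>k. if f_letter n i (w ! k) \<noteq> None then [(k, Plus)]
                      else if e_letter n i (w ! k) \<noteq> None then [(k, Minus)]
                      else []) [0..<length w])"

text \<open>The normal form under cancellation of adjacent pairs \<open>Plus, Minus\<close>. Working from the
  right, the reduced tail has the form \<open>Minus \<dots> Minus Plus \<dots> Plus\<close>, so the only pair that a new
  sign can create consists of itself and the head of that tail.\<close>

fun cancel_signs :: "(nat \<times> sign) list \<Rightarrow> (nat \<times> sign) list" where
  "cancel_signs [] = []"
| "cancel_signs ((k, Minus) # s) = (k, Minus) # cancel_signs s"
| "cancel_signs ((k, Plus) # s) =
     (case cancel_signs s of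
        (j, Minus) # s' \<Rightarrow> s'
      | s' \<Rightarrow> (k, Plus) # s')"

definition f_word :: "nat \<Rightarrow> nat \<Rightarrow> word \<Rightarrow> word option" where
  "f_word n i w =
     (case filter (\<lambda>p. snd p = Plus) (cancel_signs (signature n i w)) of
        [] \<Rightarrow> None
      | (k, _) # _ \<Rightarrow> Some (w[k := the (f_letter n i (w ! k))]))"

definition e_word :: "nat \<Rightarrow> nat \<Rightarrow> word \<Rightarrow> word option" where
  "e_word n i w =
     (case rev (filter (\<lambda>p. snd p = Minus) (cancel_signs (signature n i w))) of
        [] \<Rightarrow> None
      | (k, _) # _ \<Rightarrow> Some (w[k := the (e_letter n i (w ! k))]))"

definition crystal_arrow :: "nat \<Rightarrow> nat \<Rightarrow> word \<Rightarrow> word \<Rightarrow> bool" where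
  "crystal_arrow n i u v \<longleftrightarrow> i \<in> {1..n} \<and> f_word n i u = Some v"

definition crystal_component :: "nat \<Rightarrow> word \<Rightarrow> word set" where
  "crystal_component n w =
     {v. (\<lambda>x y. \<exists>i. crystal_arrow n i x y \<or> crystal_arrow n i y x)\<^sup>*\<^sup>* w v}"

definition crystal_isomorphism :: "nat \<Rightarrow> word set \<Rightarrow> word set \<Rightarrow> (word \<Rightarrow> word) \<Rightarrow> bool" where
  "crystal_isomorphism n A B \<phi> \<longleftrightarrow>
     bij_betw \<phi> A B \<and>
     (\<forall>u\<in>A. \<forall>v\<in>A. \<forall>i. crystal_arrow n i u v \<longleftrightarrow> crystal_arrow n i (\<phi> u) (\<phi> v))"

definition crystal_equiv :: "nat \<Rightarrow> word \<Rightarrow> word \<Rightarrow> bool" where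
  "crystal_equiv n w1 w2 \<longleftrightarrow>
     (\<exists>\<phi>. crystal_isomorphism n (crystal_component n w1) (crystal_component n w2) \<phi> \<and> \<phi> w1 = w2)"

section \<open>Symplectic tableaux\<close>

text \<open>A column is the list of its letters from top to bottom; this list is also its reading
  word. A tableau is the list of its columns from left to right.\<close>

type_synonym tableau = "letter list list"

definition admissible :: "nat \<Rightarrow> letter list \<Rightarrow> bool" where
  "admissible n C \<longleftrightarrow>
     set C \<subseteq> alphabet n \<and> sorted_wrt (<) C \<and>
     (\<forall>m\<in>{1..n}. card {x \<in> set C. x \<le> Unb m \<or> x \<ge> Bar m} \<le> m)"

text \<open>The letters \<open>z\<^sub>1 > \<dots> > z\<^sub>r\<close>.\<close>

definition split_zs :: "letter list \<Rightarrow> nat list" where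
  "split_zs C = rev (sorted_list_of_set {z. Unb z \<in> set C \<and> Bar z \<in> set C})"

text \<open>The letters \<open>t\<^sub>1, \<dots>, t\<^sub>r\<close>; the argument \<open>b\<close> carries the previous \<open>t\<close>. The greatest
  \<open>t\<close> below exists at every step when the column is admissible.\<close>

fun split_ts_below :: "letter list \<Rightarrow> nat \<Rightarrow> nat list \<Rightarrow> nat list" where
  "split_ts_below C b [] = []"
| "split_ts_below C b (z # zs) =
     (let t = (GREATEST t. 1 \<le> t \<and> t < min b z \<and> Unb t \<notin> set C \<and> Bar t \<notin> set C)
      in t # split_ts_below C t zs)"

text \<open>As \<open>z\<^sub>1 \<le> n\<close>, the initial bound \<open>n + 1\<close> imposes nothing on \<open>t\<^sub>1\<close> beyond \<open>t\<^sub>1 < z\<^sub>1\<close>.\<close>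

definition split_ts :: "nat \<Rightarrow> letter list \<Rightarrow> nat list" where
  "split_ts n C = split_ts_below C (n + 1) (split_zs C)"

definition left_column :: "nat \<Rightarrow> letter list \<Rightarrow> letter list" where
  "left_column n C =
     sorted_list_of_set (set C - Unb ` set (split_zs C) \<union> Unb ` set (split_ts n C))"

definition right_column :: "nat \<Rightarrow> letter list \<Rightarrow> letter list" where
  "right_column n C =
     sorted_list_of_set (set C - Bar ` set (split_zs C) \<union> Bar ` set (split_ts n C))"

text \<open>Columns are nonempty, so that a tableau determines its list of columns; the empty list
  is the empty tableau.\<close>

definition symplectic_tableau :: "nat \<Rightarrow> tableau \<Rightarrow> bool" where
  "symplectic_tableau n T \<longleftrightarrow>
     (\<forall>C\<in>set T. C \<noteq> [] \<and> admissible n C) \<and>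
     (\<forall>j. Suc j < length T \<longrightarrow>
        length (T ! Suc j) \<le> length (T ! j) \<and>
        (\<forall>k < length (T ! Suc j). right_column n (T ! j) ! k \<le> left_column n (T ! Suc j) ! k))"

definition reading :: "tableau \<Rightarrow> word" where
  "reading T = concat (rev T)"

section \<open>Young diagrams and the correspondence\<close>

text \<open>Boxes are pairs (row, column), both counted from \<open>0\<close>; the empty diagram is allowed.\<close>

definition young_diagram :: "(nat \<times> nat) set \<Rightarrow> bool" where
  "young_diagram D \<longleftrightarrow>
     finite D \<and> (\<forall>i j i' j'. (i, j) \<in> D \<and> i' \<le> i \<and> j' \<le> j \<longrightarrow> (i', j') \<in> D)"

definition adds_box :: "(nat \<times> nat) set \<Rightarrow> (nat \<times> nat) set \<Rightarrow> bool" where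
  "adds_box D E \<longleftrightarrow> (\<exists>b. b \<notin> D \<and> E = insert b D)"

definition column_height :: "(nat \<times> nat) set \<Rightarrow> nat \<Rightarrow> nat" where
  "column_height D j = card {i. (i, j) \<in> D}"

definition shape :: "tableau \<Rightarrow> (nat \<times> nat) set" where
  "shape T = {(i, j). j < length T \<and> i < length (T ! j)}"

definition oscillating_tableau :: "nat \<Rightarrow> nat \<Rightarrow> (nat \<times> nat) set list \<Rightarrow> bool" where
  "oscillating_tableau n l Q \<longleftrightarrow>
     length Q = l \<and> l \<ge> 1 \<and>
     (\<forall>D\<in>set Q. young_diagram D \<and> (\<forall>j. column_height D j \<le> n)) \<and>
     Q ! 0 = {(0, 0)} \<and>
     (\<forall>k. Suc k < l \<longrightarrow> adds_box (Q ! k) (Q ! Suc k) \<or> adds_box (Q ! Suc k) (Q ! k))"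

definition P_tableau :: "nat \<Rightarrow> word \<Rightarrow> tableau" where
  "P_tableau n w = (THE T. symplectic_tableau n T \<and> crystal_equiv n w (reading T))"

definition Q_tableau :: "nat \<Rightarrow> word \<Rightarrow> (nat \<times> nat) set list" where
  "Q_tableau n w = map (\<lambda>i. shape (P_tableau n (take i w))) [1..<Suc (length w)]"

definition tableau_pairs :: "nat \<Rightarrow> nat \<Rightarrow> (tableau \<times> (nat \<times> nat) set list) set" where
  "tableau_pairs n l =
     {(P, Q). symplectic_tableau n P \<and> oscillating_tableau n l Q \<and> shape P = last Q}"

definition Psi :: "nat \<Rightarrow> word \<Rightarrow> tableau \<times> (nat \<times> nat) set list" where
  "Psi n w = (P_tableau n w, Q_tableau n w)"

end

theory Submission
  imports Defs
begin

text \<open>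
  Call two words equivalent if they correspond under an isomorphism of their components. The
  proof rests on two facts. First, highest weight words of the same weight are equivalent. In
  type \<open>A\<close> such words of the same length are linked by elementary Knuth moves, by Haiman's
  dual equivalence argument: if they end in the rows \<open>x < z\<close>, some word of the same weight ends
  in \<open>y x z\<close> with \<open>x \<le> y < z\<close>, and one move turns it into a word ending in \<open>y z x\<close>. Type \<open>C\<close>
  is reduced to this by virtualization, which replaces a letter by a letter of type \<open>A\<close> followed by
  a column of height \<open>2n - 1\<close>. Second, symplectic tableaux of a fixed shape are closed under
  all operators and contain exactly one highest weight element. After elimination of the
  letters \<open>t\<^sub>i\<close>, the row conditions become linear inequalities between the numbers of
  barred and unbarred letters with index at most \<open>j\<close>, so that closure is a local check at
  the indices \<open>i - 1, i, i + 1\<close> for two adjacent columns.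

  Hence every word is equivalent to the reading of exactly one symplectic tableau. The recording
  sequence is constant on components, and on highest weight words it is the sequence of weights
  of the prefixes, which runs through all oscillating tableaux and determines the word.
\<close>

section \<open>Words over crystals of letters\<close>

text \<open>No insertion algorithm and no plactic relations of type C occur: \<open>P(w)\<close> is
  obtained purely from the existence and uniqueness of a tableau equivalent to \<open>w\<close>. An
  induction on the last letter cannot be run directly in type C, because there the weight does not
  fix the length: \<open>1\<close> and \<open>1 1 Bar 1\<close> are highest weight words of the same
  weight. Virtualization removes this obstacle. A letter of type C is realised inside the tensor
  product of the vector representation on \<open>1..2n\<close> with its dual, so the image of
  \<open>w\<close> contains a letter \<open>length w\<close> plus or minus the corresponding weight
  coordinate many times. Images of words of equal weight but different lengths thus have contents
  that differ by a constant, and prefixing full columns of height \<open>2n\<close>, on which every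
  operator is zero, evens this out. Both basic facts are needed at highest weight only. The passage
  to arbitrary words uses that a raising operator lowers the sum of the ranks of the letters, so
  that every word reaches a highest weight word.\<close>

locale letter_crystal =
  fixes F E :: "nat \<Rightarrow> 'a \<Rightarrow> 'a option"
  assumes F_E: "F i x = Some y \<longleftrightarrow> E i y = Some x"
    and F_F: "F i x = Some y \<Longrightarrow> F i y = None"
begin

lemma E_F: "F i x = Some y \<Longrightarrow> E i x = None"
  using F_E F_F by (metis not_None_eq option.distinct(1))

lemma F_E_None: "E i x = Some y \<Longrightarrow> F i x = None"
  using F_E F_F by metis

text \<open>By \<open>F_F\<close> no colour string of letters is longer than one arrow, so a letter
  carries at most one sign of each colour and these numbers are 0 or 1.\<close>

definition ph :: "nat \<Rightarrow> 'a \<Rightarrow> nat" where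
  "ph i x = (if F i x = None then 0 else 1)"

definition ep :: "nat \<Rightarrow> 'a \<Rightarrow> nat" where
  "ep i x = (if E i x = None then 0 else 1)"

text \<open>The number of signs \<open>-\<close> left after cancellation; \<open>phi\<close> counts
  the signs \<open>+\<close>. A \<open>+\<close> of the new first letter cancels one
  \<open>-\<close> of the tail, which the truncated subtraction expresses; a \<open>-\<close> in
  front meets no \<open>+\<close> to its left and survives.\<close>

fun eps :: "nat \<Rightarrow> 'a list \<Rightarrow> nat" where
  "eps i [] = 0"
| "eps i (x # w) = ep i x + (eps i w - ph i x)"

fun phi :: "nat \<Rightarrow> 'a list \<Rightarrow> nat" where
  "phi i [] = 0"
| "phi i (x # w) = phi i w + (ph i x - eps i w)"

fun fw :: "nat \<Rightarrow> 'a list \<Rightarrow> 'a list option" where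
  "fw i [] = None"
| "fw i (x # w) =
     (if ph i x > eps i w then Some (the (F i x) # w) else map_option (Cons x) (fw i w))"

fun ew :: "nat \<Rightarrow> 'a list \<Rightarrow> 'a list option" where
  "ew i [] = None"
| "ew i (x # w) =
     (if eps i w > ph i x then map_option (Cons x) (ew i w) else map_option (\<lambda>y. y # w) (E i x))"

lemma eps_append: "eps i (u @ v) = eps i u + (eps i v - phi i u)" (is ?A)
  and phi_append: "phi i (u @ v) = phi i v + (phi i u - eps i v)" (is ?B)
proof -
  have "?A \<and> ?B"
    by (induction u) auto
  then show ?A ?B by auto
qed

lemma fw_None_iff: "fw i w = None \<longleftrightarrow> phi i w = 0"
  by (induction w) (auto simp: not_less)

lemma ew_None_iff: "ew i w = None \<longleftrightarrow> eps i w = 0"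
  by (induction w) (auto simp: ep_def ph_def not_less split: if_splits)

text \<open>The tensor product rule: the surviving \<open>+\<close> of \<open>u\<close> face the
  surviving \<open>-\<close> of \<open>v\<close>, and the leftmost \<open>+\<close> lies in
  \<open>u\<close> exactly if one of them is left over.\<close>

lemma fw_append:
  "fw i (u @ v) =
     (if phi i u > eps i v then map_option (\<lambda>u'. u' @ v) (fw i u) else map_option ((@) u) (fw i v))"
proof (induction u)
  case Nil
  then show ?case by (cases "fw i v") auto
next
  case (Cons x u)
  show ?case
    using Cons fw_None_iff[of i u]
    by (auto simp: eps_append option.map_comp comp_def not_less ph_def split: if_splits)
qed

lemma ew_append:
  "ew i (u @ v) =
     (if eps i v > phi i u then map_option ((@) u) (ew i v) else map_option (\<lambda>u'. u' @ v) (ew i u))"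
proof (induction u)
  case Nil
  then show ?case using ew_None_iff[of i v] by (cases "ew i v") auto
next
  case (Cons x u)
  show ?case
    using Cons
    by (auto simp: eps_append option.map_comp comp_def not_less ph_def split: if_splits)
qed

lemma fw_Some:
  assumes "fw i w = Some w'"
  shows "phi i w = Suc (phi i w')" and "eps i w' = Suc (eps i w)" and "ew i w' = Some w"
proof -
  have "phi i w = Suc (phi i w') \<and> eps i w' = Suc (eps i w) \<and> ew i w' = Some w"
    using assms
  proof (induction w arbitrary: w')
    case (Cons x w)
    show ?case
    proof (cases "ph i x > eps i w")
      case True
      then obtain y where y: "F i x = Some y" and e: "eps i w = 0" by (auto simp: ph_def split: if_splits)
      then have "w' = y # w" using Cons.prems True by simp
      moreover have "E i x = None" "F i y = None" "E i y = Some x"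
        using y E_F F_F F_E by blast+
      ultimately show ?thesis using e y by (auto simp: ph_def ep_def)
    next
      case False
      then obtain v where v: "fw i w = Some v" "w' = x # v" using Cons.prems by auto
      then show ?thesis using Cons.IH[OF v(1)] False by auto
    qed
  qed simp
  then show "phi i w = Suc (phi i w')" and "eps i w' = Suc (eps i w)" and "ew i w' = Some w" by auto
qed

lemma fw_ew: "fw i w = Some w' \<longleftrightarrow> ew i w' = Some w"
proof
  assume "ew i w' = Some w"
  then show "fw i w = Some w'"
  proof (induction w' arbitrary: w)
    case (Cons x v)
    show ?case
    proof (cases "eps i v > ph i x")
      case True
      then obtain v' where v': "ew i v = Some v'" "w = x # v'" using Cons.prems by auto
      have "fw i v' = Some v" by (rule Cons.IH[OF v'(1)])
      moreover have "eps i v = Suc (eps i v')" using fw_Some(2)[OF calculation] .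
      ultimately show ?thesis using True v' by auto
    next
      case False
      then obtain y where y: "E i x = Some y" "w = y # v" using Cons.prems by auto
      then have *: "F i y = Some x" "F i x = None" using F_E F_E_None by auto
      then have "eps i v = 0" using False by (simp add: ph_def)
      then show ?thesis using y * by (auto simp: ph_def)
    qed
  qed simp
qed (rule fw_Some(3))

lemma fw_neq: "fw i w = Some w' \<Longrightarrow> w' \<noteq> w"
  using fw_Some(1) by fastforce

lemma length_fw: "fw i w = Some w' \<Longrightarrow> length w' = length w"
  by (induction w arbitrary: w') (auto split: if_splits)

text \<open>A nonzero operator changes the word, so the branches of the tensor product rule that act
  on an outer factor would alter that factor. This transfers an action on the reading of a tableau
  to two adjacent columns.\<close>

lemma fw_factor:
  assumes "fw i (a @ u @ b) = Some (a @ u' @ b)" "length u' = length u"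
  shows "fw i u = Some u'"
proof -
  have ne: "u' \<noteq> u" using assms fw_neq by blast
  have 1: "fw i (u @ b) = Some (u' @ b)"
    using assms(1) ne assms(2)
    by (auto simp: fw_append[of i a] append_eq_append_conv split: if_splits dest: length_fw)
  show ?thesis
    using 1 ne assms(2)
    by (auto simp: fw_append[of i u] append_eq_append_conv split: if_splits dest: length_fw)
qed

lemma ew_factor:
  assumes "ew i (a @ u @ b) = Some (a @ u' @ b)" "length u' = length u"
  shows "ew i u = Some u'"
  using assms fw_factor[of i a u' b u] fw_ew by auto

section \<open>Equivalence of words through bisimulations\<close>

definition bisim :: "('a list \<Rightarrow> 'a list \<Rightarrow> bool) \<Rightarrow> bool" where
  "bisim R \<longleftrightarrow>
     (\<forall>u v i. R u v \<longrightarrow> rel_option R (fw i u) (fw i v) \<and> rel_option R (ew i u) (ew i v))"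

text \<open>Up to restriction to components, a bi-unique bisimulation is an isomorphism; unlike an
  isomorphism it composes and localises without mention of the components.\<close>

definition crystal_eq :: "'a list \<Rightarrow> 'a list \<Rightarrow> bool" where
  "crystal_eq u v \<longleftrightarrow> (\<exists>R. R u v \<and> bisim R \<and> bi_unique R)"

lemma bisim_fw: "bisim R \<Longrightarrow> R u v \<Longrightarrow> rel_option R (fw i u) (fw i v)"
  and bisim_ew: "bisim R \<Longrightarrow> R u v \<Longrightarrow> rel_option R (ew i u) (ew i v)"
  by (auto simp: bisim_def)

text \<open>\<open>phi\<close> is the number of times \<open>fw\<close> can be iterated before the
  value becomes zero, and a bisimulation preserves zero values.\<close>

lemma bisim_phi:
  assumes "bisim R" "R u v"
  shows "phi i u = phi i v"
  using assms(2)
proof (induction "phi i u" arbitrary: u v)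
  case 0
  then have "fw i u = None" by (simp add: fw_None_iff)
  then have "fw i v = None" using bisim_fw[OF assms(1) 0(2), of i] by (auto elim: option.rel_cases)
  then show ?case using 0 by (simp add: fw_None_iff)
next
  case (Suc k)
  then obtain u' where u': "fw i u = Some u'" using fw_None_iff[of i u] by (cases "fw i u") auto
  then obtain v' where v': "fw i v = Some v'" "R u' v'"
    using bisim_fw[OF assms(1) Suc(3), of i] by (auto elim: option.rel_cases)
  show ?case using Suc(1)[of u' v'] Suc(2) fw_Some(1)[OF u'] fw_Some(1)[OF v'(1)] v'(2) by auto
qed

lemma bisim_eps:
  assumes "bisim R" "R u v"
  shows "eps i u = eps i v"
  using assms(2)
proof (induction "eps i u" arbitrary: u v)
  case 0
  then have "ew i u = None" by (simp add: ew_None_iff)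
  then have "ew i v = None" using bisim_ew[OF assms(1) 0(2), of i] by (auto elim: option.rel_cases)
  then show ?case using 0 by (simp add: ew_None_iff)
next
  case (Suc k)
  then obtain u' where u': "ew i u = Some u'" using ew_None_iff[of i u] by (cases "ew i u") auto
  then obtain v' where v': "ew i v = Some v'" "R u' v'"
    using bisim_ew[OF assms(1) Suc(3), of i] by (auto elim: option.rel_cases)
  show ?case
    using Suc(1)[of u' v'] Suc(2) fw_Some(2)[of i u' u] fw_Some(2)[of i v' v] u' v' fw_ew by auto
qed

lemma crystal_eq_refl: "crystal_eq u u"
  unfolding crystal_eq_def bisim_def
  by (intro exI[of _ "(=)"]) (auto simp: option.rel_eq bi_unique_def)

lemma crystal_eq_sym: assumes "crystal_eq u v" shows "crystal_eq v u"
proof -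
  obtain R where R: "R u v" "bisim R" "bi_unique R" using assms by (auto simp: crystal_eq_def)
  then have "bisim R\<inverse>\<inverse>" "bi_unique R\<inverse>\<inverse>"
    by (auto simp: bisim_def option.rel_conversep bi_unique_def)
  then show ?thesis using R(1) unfolding crystal_eq_def by blast
qed

lemma crystal_eq_trans:
  assumes "crystal_eq u v" "crystal_eq v w"
  shows "crystal_eq u w"
proof -
  obtain R where R: "R u v" "bisim R" "bi_unique R" using assms by (auto simp: crystal_eq_def)
  obtain S where S: "S v w" "bisim S" "bi_unique S" using assms by (auto simp: crystal_eq_def)
  have "bisim (R OO S)"
    using R(2) S(2) unfolding bisim_def option.rel_compp by blast
  moreover have "bi_unique (R OO S)"
    using R(3) S(3) unfolding bi_unique_def by blast
  ultimately show ?thesis using R(1) S(1) unfolding crystal_eq_def by blast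
qed

lemma crystal_eq_eps: "crystal_eq u v \<Longrightarrow> eps i u = eps i v"
  and crystal_eq_phi: "crystal_eq u v \<Longrightarrow> phi i u = phi i v"
  using bisim_eps bisim_phi by (auto simp: crystal_eq_def)

lemma crystal_eq_fw:
  assumes "crystal_eq u v" "fw i u = Some u'"
  obtains v' where "fw i v = Some v'" "crystal_eq u' v'"
proof -
  obtain R where R: "R u v" "bisim R" "bi_unique R" using assms by (auto simp: crystal_eq_def)
  with assms(2) obtain v' where "fw i v = Some v'" "R u' v'"
    using bisim_fw[OF R(2,1), of i] by (auto elim: option.rel_cases)
  then show ?thesis using that R unfolding crystal_eq_def by blast
qed

lemma crystal_eq_ew:
  assumes "crystal_eq u v" "ew i u = Some u'"
  obtains v' where "ew i v = Some v'" "crystal_eq u' v'"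
proof -
  obtain R where R: "R u v" "bisim R" "bi_unique R" using assms by (auto simp: crystal_eq_def)
  with assms(2) obtain v' where "ew i v = Some v'" "R u' v'"
    using bisim_ew[OF R(2,1), of i] by (auto elim: option.rel_cases)
  then show ?thesis using that R unfolding crystal_eq_def by blast
qed

text \<open>Equivalence is a congruence: the tensor product rule consults only \<open>eps\<close>
  and \<open>phi\<close> of the middle factor, and these agree on related words.\<close>

lemma crystal_eq_append:
  assumes "crystal_eq u v"
  shows "crystal_eq (a @ u @ b) (a @ v @ b)"
proof -
  obtain R where R: "R u v" "bisim R" "bi_unique R" using assms by (auto simp: crystal_eq_def)
  \<comment> \<open>The outer factors vary, since operators act on them too, but keep their lengths.
    Fixed lengths make the decomposition of a word unique, which gives bi-uniqueness.\<close>
  define S where "S x y \<longleftrightarrow> (\<exists>a' u' v' b'. x = a' @ u' @ b' \<and> y = a' @ v' @ b' \<and> R u' v' \<and>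
    length a' = length a \<and> length b' = length b)" for x y
  have SI: "S (a' @ u' @ b') (a' @ v' @ b')"
    if "R u' v'" "length a' = length a" "length b' = length b" for a' u' v' b'
    using that unfolding S_def by blast
  have "S (a @ u @ b) (a @ v @ b)" using R(1) by (intro SI) auto
  moreover have "bisim S"
    unfolding bisim_def
  proof (intro allI impI)
    fix x y i
    assume "S x y"
    then obtain a' u' v' b' where s: "x = a' @ u' @ b'" "y = a' @ v' @ b'" "R u' v'"
      "length a' = length a" "length b' = length b" unfolding S_def by blast
    have e: "eps i u' = eps i v'" "phi i u' = phi i v'"
      using bisim_eps[OF R(2) s(3)] bisim_phi[OF R(2) s(3)] by auto
    have f: "rel_option R (fw i u') (fw i v')" and g: "rel_option R (ew i u') (ew i v')"
      using bisim_fw[OF R(2) s(3)] bisim_ew[OF R(2) s(3)] by auto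
    have lf: "length c' = length c" if "fw i c = Some c'" for c c' using that by (rule length_fw)
    have le: "length c' = length c" if "ew i c = Some c'" for c c'
      using that length_fw fw_ew by metis
    have f': "rel_option S (fw i x) (fw i y)"
      unfolding s(1,2) fw_append eps_append e
      using f s by (cases "fw i u'"; cases "fw i v'"; cases "fw i a'"; cases "fw i b'")
        (auto intro!: SI dest: lf)
    have g': "rel_option S (ew i x) (ew i y)"
      unfolding s(1,2) ew_append eps_append e
      using g s by (cases "ew i u'"; cases "ew i v'"; cases "ew i a'"; cases "ew i b'")
        (auto intro!: SI dest: le)
    show "rel_option S (fw i x) (fw i y) \<and> rel_option S (ew i x) (ew i y)" using f' g' by blast
  qed
  moreover have "bi_unique S"
    using R(3) unfolding bi_unique_def S_def by (auto simp: append_eq_append_conv)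
  ultimately show ?thesis unfolding crystal_eq_def by blast
qed

definition hw :: "'a list \<Rightarrow> bool" where
  "hw w \<longleftrightarrow> (\<forall>i. eps i w = 0)"

text \<open>In this convention highest weight passes to prefixes, which is why all inductions remove
  the last letter and why prefixes of words can be recorded.\<close>

lemma hw_append: "hw (u @ v) \<Longrightarrow> hw u"
  by (auto simp: hw_def eps_append)

lemma hw_snoc: "hw (w @ [x]) \<longleftrightarrow> hw w \<and> (\<forall>i. ep i x \<le> phi i w)"
  by (auto simp: hw_def eps_append)

lemma set_fw:
  assumes "fw i w = Some w'" "set w \<subseteq> A" "\<And>x y. x \<in> A \<Longrightarrow> F i x = Some y \<Longrightarrow> y \<in> A"
  shows "set w' \<subseteq> A"
  using assms(1,2)
  by (induction w arbitrary: w') (auto simp: ph_def split: if_splits intro: assms(3))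

lemma set_ew:
  assumes "ew i w = Some w'" "set w \<subseteq> A" "\<And>x y. x \<in> A \<Longrightarrow> E i x = Some y \<Longrightarrow> y \<in> A"
  shows "set w' \<subseteq> A"
  using assms(1,2)
  by (induction w arbitrary: w') (auto simp: ph_def split: if_splits intro: assms(3))

end

section \<open>Highest weight words in type A\<close>

lemma distinct_count_one: "distinct xs \<Longrightarrow> count_list xs x = (if x \<in> set xs then 1 else 0)"
  by (induction xs) auto

text \<open>Letters range over all naturals; those outside \<open>1..N\<close> carry no sign of any
  colour.\<close>

definition gl_f :: "nat \<Rightarrow> nat \<Rightarrow> nat \<Rightarrow> nat option" where
  "gl_f N i x = (if x = i \<and> 1 \<le> i \<and> i < N then Some (Suc i) else None)"

definition gl_e :: "nat \<Rightarrow> nat \<Rightarrow> nat \<Rightarrow> nat option" where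
  "gl_e N i x = (if x = Suc i \<and> 1 \<le> i \<and> i < N then Some i else None)"

locale gl_words =
  fixes N :: nat
begin

sublocale letter_crystal "gl_f N" "gl_e N"
  by unfold_locales (auto simp: gl_f_def gl_e_def split: if_splits)

lemma ph_gl: "ph i x = (if x = i \<and> 1 \<le> i \<and> i < N then 1 else 0)"
  and ep_gl: "ep i x = (if x = Suc i \<and> 1 \<le> i \<and> i < N then 1 else 0)"
  by (auto simp: ph_def ep_def gl_f_def gl_e_def)

lemma phi_minus_eps:
  "1 \<le> i \<Longrightarrow> i < N \<Longrightarrow> phi i w + count_list w (Suc i) = eps i w + count_list w i"
  by (induction w) (auto simp: ph_gl ep_gl)

lemma eps_outside: "\<not> (1 \<le> i \<and> i < N) \<Longrightarrow> eps i w = 0"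
  and phi_outside: "\<not> (1 \<le> i \<and> i < N) \<Longrightarrow> phi i w = 0"
  by (induction w) (auto simp: ph_gl ep_gl)

lemma neutral:
  assumes "\<And>x. x \<in> set a \<Longrightarrow> x \<noteq> i \<and> x \<noteq> Suc i"
  shows "eps i a = 0 \<and> phi i a = 0"
  using assms by (induction a) (auto simp: ph_gl ep_gl)

text \<open>The elementary plactic relations in the reading convention in which highest weight words
  are those whose prefixes have dominant weight.\<close>

inductive knuth :: "nat list \<Rightarrow> nat list \<Rightarrow> bool" where
  "x \<le> y \<Longrightarrow> y < z \<Longrightarrow> knuth [y, x, z] [y, z, x]"
| "x < y \<Longrightarrow> y \<le> z \<Longrightarrow> knuth [z, x, y] [x, z, y]"

lemma knuth_iff:
  "knuth [a, b, c] [a', b', c'] \<longleftrightarrow>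
     a = a' \<and> b = c' \<and> c = b' \<and> b \<le> a \<and> a < c \<or> a = b' \<and> b = a' \<and> c = c' \<and> b < c \<and> c \<le> a"
  by (auto simp: knuth.simps)

lemma knuth_bi_unique: "bi_unique knuth"
  unfolding bi_unique_def by (auto elim!: knuth.cases)

text \<open>Only the comparison of the three letters with \<open>i\<close> and \<open>Suc i\<close>
  matters, so the check is finite. The kind of the relation may change: colour 1 takes
  \<open>1 1 2\<close>, \<open>1 2 1\<close> to \<open>2 1 2\<close>, \<open>1 2 2\<close>.\<close>

lemma knuth_bisim: "bisim knuth"
  unfolding bisim_def
proof (intro allI impI)
  fix u v i
  assume "knuth u v"
  then show "rel_option knuth (fw i u) (fw i v) \<and> rel_option knuth (ew i u) (ew i v)"
  proof cases
    case (1 x y z)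
    then show ?thesis
      by (cases "x = i"; cases "x = Suc i"; cases "y = i"; cases "y = Suc i"; cases "z = i"; cases "z = Suc i")
        (auto simp: knuth_iff ph_gl ep_gl gl_f_def gl_e_def le_less_Suc_eq)
  next
    case (2 x y z)
    then show ?thesis
      by (cases "x = i"; cases "x = Suc i"; cases "y = i"; cases "y = Suc i"; cases "z = i"; cases "z = Suc i")
        (auto simp: knuth_iff ph_gl ep_gl gl_f_def gl_e_def le_less_Suc_eq)
  qed
qed

lemma hw_dominant:
  assumes "hw w" "1 \<le> i" "i < N"
  shows "count_list w (Suc i) \<le> count_list w i"
  using phi_minus_eps[OF assms(2,3), of w] assms(1) by (simp add: hw_def)

text \<open>On a highest weight word \<open>phi i\<close> is the difference of the numbers of
  \<open>i\<close> and \<open>Suc i\<close>. A new letter \<open>Suc i\<close> needs this to be at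
  least 1, which is dominance of the extended weight.\<close>

lemma hw_snocI:
  assumes "hw w" "\<And>i. 1 \<le> i \<Longrightarrow> i < N \<Longrightarrow> count_list (w @ [x]) (Suc i) \<le> count_list (w @ [x]) i"
  shows "hw (w @ [x])"
  unfolding hw_snoc
proof (intro conjI allI assms(1))
  fix i
  show "ep i x \<le> phi i w"
  proof (cases "x = Suc i \<and> 1 \<le> i \<and> i < N")
    case True
    then show ?thesis
      using assms(2)[of i] phi_minus_eps[of i w] assms(1) by (simp add: hw_def ep_gl)
  qed (auto simp: ep_gl)
qed

lemma ex_hw_of_weight:
  assumes "\<And>i. 1 \<le> i \<Longrightarrow> i < N \<Longrightarrow> \<mu> (Suc i) \<le> \<mu> i"
  obtains w where "hw w" "set w \<subseteq> {1..N}" "\<And>i. i \<in> {1..N} \<Longrightarrow> count_list w i = \<mu> i"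
  using assms
proof (induction "sum \<mu> {1..N}" arbitrary: \<mu> thesis)
  case 0
  then have "\<And>i. i \<in> {1..N} \<Longrightarrow> \<mu> i = 0" by simp
  then show ?case using 0(2)[of "[]"] by (auto simp: hw_def)
next
  case (Suc k)
  define S where "S = {i \<in> {1..N}. \<mu> i > 0}"
  \<comment> \<open>A box removed from the lowest nonempty row always leaves a partition.\<close>
  define i where "i = Max S"
  have "S \<noteq> {}"
  proof
    assume "S = {}"
    then have "sum \<mu> {1..N} = 0" by (intro sum.neutral) (auto simp: S_def)
    then show False using Suc(2) by simp
  qed
  then have i: "i \<in> S" unfolding i_def by (intro Max_in) (auto simp: S_def)
  have mx: "\<mu> j = 0" if "j \<in> {1..N}" "i < j" for j
    
  proof (rule ccontr)
    assume "\<mu> j \<noteq> 0"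
    then have "j \<le> Max S" using that by (intro Max_ge) (auto simp: S_def)
    then show False using that by (simp add: i_def)
  qed
  define \<nu> where "\<nu> = \<mu>(i := \<mu> i - 1)"
  have "sum \<mu> {1..N} = Suc (sum \<nu> {1..N})"
  proof -
    have "i \<in> {1..N}" "\<mu> i > 0" using i by (auto simp: S_def)
    moreover have "sum \<nu> ({1..N} - {i}) = sum \<mu> ({1..N} - {i})"
      by (intro sum.cong) (auto simp: \<nu>_def)
    moreover have "\<nu> i = \<mu> i - 1" by (simp add: \<nu>_def)
    ultimately show ?thesis
      using sum.remove[of "{1..N}" i \<mu>] sum.remove[of "{1..N}" i \<nu>] by simp
  qed
  then have 1: "k = sum \<nu> {1..N}" using Suc(2) by simp
  have 2: "\<nu> (Suc j) \<le> \<nu> j" if "1 \<le> j" "j < N" for j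
    using Suc(4)[OF that] mx[of "Suc j"] that by (auto simp: \<nu>_def)
  obtain w where w: "hw w" "set w \<subseteq> {1..N}" "\<And>j. j \<in> {1..N} \<Longrightarrow> count_list w j = \<nu> j"
    using Suc(1)[OF 1 _ 2] by blast
  have c: "count_list (w @ [i]) j = \<mu> j" if "j \<in> {1..N}" for j
    using w(3)[OF that] i by (auto simp: \<nu>_def S_def)
  have "hw (w @ [i])"
    using w(1) Suc(4) c by (intro hw_snocI) auto
  then show ?case using Suc(3)[of "w @ [i]"] c w(2) i by (auto simp: S_def)
qed

text \<open>The induction hypothesis of the next lemma enters as the assumption \<open>IH\<close>,
  so that the cases \<open>x < z\<close> and \<open>z < x\<close> of the last letters can share this
  argument.\<close>

lemma connect_last:
  assumes IH: "\<And>v v'. length v = length u \<Longrightarrow> hw v \<Longrightarrow> hw v' \<Longrightarrow> set v \<subseteq> {1..N} \<Longrightarrow> set v' \<subseteq> {1..N} \<Longrightarrow>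
      (\<And>i. i \<in> {1..N} \<Longrightarrow> count_list v i = count_list v' i) \<Longrightarrow> crystal_eq v v'"
    and hw: "hw (u @ [z])" "hw (u' @ [x])"
    and sets: "set (u @ [z]) \<subseteq> {1..N}" "set (u' @ [x]) \<subseteq> {1..N}"
    and cnt: "\<And>i. i \<in> {1..N} \<Longrightarrow> count_list (u @ [z]) i = count_list (u' @ [x]) i"
    and "x < z"
  shows "crystal_eq (u @ [z]) (u' @ [x])"
proof -
  define lam where "lam = count_list (u @ [z])"
  define \<nu> where "\<nu> = (\<lambda>i. if i = x \<or> i = z then lam i - 1 else lam i)"
  have xz: "1 \<le> x" "x < z" "z \<le> N" using sets \<open>x < z\<close> by auto
  have cu: "count_list u i = (if i = z then lam i - 1 else lam i)" for i by (auto simp: lam_def)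
  have cu': "count_list u' i = (if i = x then lam i - 1 else lam i)" if "i \<in> {1..N}" for i
    using cnt[OF that] by (auto simp: lam_def split: if_splits)
  have pz: "lam z \<ge> 1" and px: "lam x \<ge> 1" using cnt[of x] xz by (auto simp: lam_def)
  have hu: "hw u" "hw u'" using hw hw_append by blast+
  have dom: "lam (Suc i) \<le> lam i" if "1 \<le> i" "i < N" for i
    using hw_dominant[OF hw(1) that] by (simp add: lam_def)
  have domu: "count_list u (Suc i) \<le> count_list u i" if "1 \<le> i" "i < N" for i
    using hw_dominant[OF hu(1) that] .
  have domu': "count_list u' (Suc i) \<le> count_list u' i" if "1 \<le> i" "i < N" for i
    using hw_dominant[OF hu(2) that] .
  have mono: "lam j \<le> lam i" if "1 \<le> i" "i \<le> j" "j \<le> N" for i j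
    using that(2,3)
  proof (induction rule: dec_induct)
    case (step k)
    then show ?case using dom[of k] that by auto
  qed simp
  \<comment> \<open>Row \<open>x\<close> can lose a box, so it is strictly longer than row
    \<open>Suc x\<close> and hence than row \<open>z\<close>. After removal of both boxes the strict
    inequality persists, and some \<open>y\<close> in between is a descent of
    \<open>\<nu>\<close>.\<close>
  have "lam z < lam x"
    using domu'[of x] mono[of "Suc x" z] xz cu'[of x] cu'[of "Suc x"] px by auto
  then have "\<nu> z < \<nu> x" using xz pz by (auto simp: \<nu>_def)
  obtain y where y: "x \<le> y" "y < z" "\<nu> (Suc y) < \<nu> y"
  proof (rule ccontr)
    assume "\<not> thesis"
    then have *: "\<nu> k \<le> \<nu> (Suc k)" if "x \<le> k" "k < z" for k using \<open>\<And>y. \<lbrakk>x \<le> y; y < z; \<nu> (Suc y) < \<nu> y\<rbrakk> \<Longrightarrow> thesis\<close> that not_le by blast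
    have "x \<le> z" using xz by simp
    then have "\<nu> x \<le> \<nu> z" by (induction rule: dec_induct) (auto intro: order_trans *)
    then show False using \<open>\<nu> z < \<nu> x\<close> by simp
  qed
  have dom\<nu>: "\<nu> (Suc i) \<le> \<nu> i" if "1 \<le> i" "i < N" for i
    using domu[OF that] domu'[OF that] cu[of i] cu[of "Suc i"] cu'[of i] cu'[of "Suc i"] that dom[OF that] xz
    by (auto simp: \<nu>_def split: if_splits)
  define \<mu> where "\<mu> = \<nu>(y := \<nu> y - 1)"
  have dom\<mu>: "\<mu> (Suc i) \<le> \<mu> i" if "1 \<le> i" "i < N" for i
    using dom\<nu>[OF that] y by (auto simp: \<mu>_def)
  \<comment> \<open>\<open>v\<close> lacks the boxes in rows \<open>x\<close>, \<open>y\<close>,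
    \<open>z\<close>. Thus \<open>v @ [y, x]\<close> has the weight of \<open>u\<close> and
    \<open>v @ [y, z]\<close> that of \<open>u'\<close>, and the induction hypothesis applies to
    both pairs.\<close>
  obtain v where v: "hw v" "set v \<subseteq> {1..N}" "\<And>i. i \<in> {1..N} \<Longrightarrow> count_list v i = \<mu> i"
    using ex_hw_of_weight[of \<mu>] dom\<mu> by blast
  have v1: "count_list (v @ [y]) i = \<nu> i" if "i \<in> {1..N}" for i
    using v(3)[OF that] y by (auto simp: \<mu>_def)
  have h1: "hw (v @ [y])" using v1 dom\<nu> by (intro hw_snocI v(1)) auto
  have v2: "count_list (v @ [y, x]) i = count_list u i" if "i \<in> {1..N}" for i
    using v1[OF that] px xz by (auto simp: cu \<nu>_def)
  have v3: "count_list (v @ [y, z]) i = count_list u' i" if "i \<in> {1..N}" for i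
    using v1[OF that] pz xz cu'[OF that] by (auto simp: \<nu>_def)
  have h2: "hw (v @ [y, x])" using hw_snocI[OF h1, of x] v2 domu by auto
  have h3: "hw (v @ [y, z])" using hw_snocI[OF h1, of z] v3 domu' by auto
  have vs: "set (v @ [y, x]) \<subseteq> {1..N}" "set (v @ [y, z]) \<subseteq> {1..N}" using v(2) y xz by auto
  have us: "set u \<subseteq> {1..N}" "set u' \<subseteq> {1..N}" using sets by auto
  have len: "length (v @ [y, x]) = length u"
    using sum_count_set[OF us(1)] sum_count_set[OF vs(1)] v2 by (metis (no_types, lifting) finite_atLeastAtMost sum.cong)
  have e1: "crystal_eq u (v @ [y, x])"
    using IH[OF len h2 hu(1) vs(1) us(1) v2] crystal_eq_sym by blast
  have e2: "crystal_eq (v @ [y, z]) u'"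
    using IH[OF _ h3 hu(2) vs(2) us(2) v3] len by simp
  have "crystal_eq [y, x, z] [y, z, x]"
    unfolding crystal_eq_def using knuth.intros(1)[OF y(1,2)] knuth_bisim knuth_bi_unique by blast
  then have "crystal_eq (v @ [y, x, z]) (v @ [y, z, x])"
    using crystal_eq_append[of _ _ v "[]"] by simp
  moreover have "crystal_eq (u @ [z]) (v @ [y, x, z])"
    using crystal_eq_append[OF e1, of "[]" "[z]"] by simp
  moreover have "crystal_eq (v @ [y, z, x]) (u' @ [x])"
    using crystal_eq_append[OF e2, of "[]" "[x]"] by simp
  ultimately show ?thesis by (blast intro: crystal_eq_trans)
qed

lemma hw_same_weight:
  assumes "hw w" "hw w'" "set w \<subseteq> {1..N}" "set w' \<subseteq> {1..N}"
    "\<And>i. i \<in> {1..N} \<Longrightarrow> count_list w i = count_list w' i"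
  shows "crystal_eq w w'"
  using assms
proof (induction "length w" arbitrary: w w')
  case 0
  have "length w' = 0"
    using sum_count_set[OF 0(4)] sum_count_set[OF 0(5)] 0(1,6) by simp
  then show ?case using 0(1) by (simp add: crystal_eq_refl)
next
  case (Suc k)
  have "length w' = length w"
    using sum_count_set[OF Suc(5)] sum_count_set[OF Suc(6)] Suc(7) by (metis (no_types, lifting) finite_atLeastAtMost sum.cong)
  then obtain u z u' x where w: "w = u @ [z]" "w' = u' @ [x]" "length u = k" "length u' = k"
    using Suc(2) by (metis length_Suc_conv_rev)
  have IH: "crystal_eq v v'" if "length v = k" "hw v" "hw v'" "set v \<subseteq> {1..N}" "set v' \<subseteq> {1..N}"
      "\<And>i. i \<in> {1..N} \<Longrightarrow> count_list v i = count_list v' i" for v v'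
    using Suc(1)[of v v'] that by auto
  consider "x = z" | "x < z" | "z < x" by linarith
  then show ?case
  proof cases
    case 1
    have "crystal_eq u u'"
    proof (rule IH)
      show "hw u" "hw u'" using Suc(3,4) hw_append unfolding w by blast+
      show "count_list u i = count_list u' i" if "i \<in> {1..N}" for i
        using Suc(7)[OF that] 1 unfolding w by (auto split: if_splits)
    qed (use w Suc(5,6) in auto)
    then show ?thesis using crystal_eq_append[of u u' "[]" "[z]"] 1 w by simp
  next
    case 2
    show ?thesis unfolding w
      by (rule connect_last[OF _ _ _ _ _ _ 2]) (use IH Suc w in auto)
  next
    case 3
    have "crystal_eq (u' @ [x]) (u @ [z])"
      by (rule connect_last[OF _ _ _ _ _ _ 3]) (use IH Suc w in auto)
    then show ?thesis unfolding w by (rule crystal_eq_sym)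
  qed
qed

text \<open>Columns are encoded by membership predicates: an operator alters the predicate at two
  places, and the increasing order is automatic.\<close>

definition col :: "(nat \<Rightarrow> bool) \<Rightarrow> nat list" where
  "col P = filter P [1..<Suc N]"

lemma col_split:
  assumes "1 \<le> i" "i < N"
  obtains a b where "\<And>x. x \<in> set a \<union> set b \<Longrightarrow> x \<noteq> i \<and> x \<noteq> Suc i"
    and "\<And>P. col P = filter P a @ filter P [i, Suc i] @ filter P b"
proof
  have "[1..<Suc N] = [1..<i] @ [i..<Suc N]"
    using assms upt_add_eq_append[of 1 i "Suc N - i"] by simp
  moreover have "[i..<Suc N] = [i, Suc i] @ [i+2..<Suc N]"
    using assms by (simp add: upt_conv_Cons del: upt_Suc)
  ultimately show "col P = filter P [1..<i] @ filter P [i, Suc i] @ filter P [i+2..<Suc N]" for P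
    by (simp add: col_def)
qed auto

lemma col_eps_phi:
  assumes "1 \<le> i" "i < N"
  shows "eps i (col P) = (if P (Suc i) \<and> \<not> P i then 1 else 0)"
    and "phi i (col P) = (if P i \<and> \<not> P (Suc i) then 1 else 0)"
proof -
  obtain a b where ab: "\<And>x. x \<in> set a \<union> set b \<Longrightarrow> x \<noteq> i \<and> x \<noteq> Suc i"
    "\<And>P. col P = filter P a @ filter P [i, Suc i] @ filter P b"
    using col_split[OF assms] by blast
  have "eps i (filter P a) = 0 \<and> phi i (filter P a) = 0" "eps i (filter P b) = 0 \<and> phi i (filter P b) = 0"
    using neutral[of "filter P a" i] neutral[of "filter P b" i] ab(1) by auto
  then show "eps i (col P) = (if P (Suc i) \<and> \<not> P i then 1 else 0)"
    and "phi i (col P) = (if P i \<and> \<not> P (Suc i) then 1 else 0)"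
    using assms by (auto simp: ab(2) eps_append phi_append ph_gl ep_gl)
qed

lemma col_fw:
  assumes "1 \<le> i" "i < N" "P i" "\<not> P (Suc i)" "\<And>j. Q j \<longleftrightarrow> (if j = i then False else if j = Suc i then True else P j)"
  shows "fw i (col P) = Some (col Q)"
proof -
  obtain a b where ab: "\<And>x. x \<in> set a \<union> set b \<Longrightarrow> x \<noteq> i \<and> x \<noteq> Suc i"
    "\<And>P. col P = filter P a @ filter P [i, Suc i] @ filter P b"
    using col_split[OF assms(1,2)] by blast
  have "eps i (filter P a) = 0 \<and> phi i (filter P a) = 0" "eps i (filter P b) = 0 \<and> phi i (filter P b) = 0"
    using neutral[of "filter P a" i] neutral[of "filter P b" i] ab(1) by auto
  moreover have "filter Q a = filter P a" "filter Q b = filter P b"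
    using ab(1) assms(5) by (auto intro!: filter_cong)
  ultimately show ?thesis
    using assms by (auto simp: ab(2) fw_append eps_append phi_append ph_gl ep_gl gl_f_def)
qed

text \<open>In the full column every \<open>i\<close> is followed by \<open>Suc i\<close> and
  cancels with it. This is the determinant representation, on which all \<open>eps\<close> and
  \<open>phi\<close> vanish.\<close>

lemma full_column_trivial: "crystal_eq (col (\<lambda>_. True) @ w) w"
proof -
  let ?c = "col (\<lambda>_. True)"
  define R where "R u v \<longleftrightarrow> u = ?c @ v" for u v
  have z: "eps i ?c = 0" "phi i ?c = 0" for i
    using col_eps_phi[of i] eps_outside[of i] phi_outside[of i] by (cases "1 \<le> i \<and> i < N"; auto)+
  have "bisim R"
    unfolding bisim_def
  proof (intro allI impI)
    fix u v i
    assume "R u v"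
    moreover have "ew i ?c = None" "eps i v = 0 \<Longrightarrow> ew i v = None"
      using z ew_None_iff by auto
    ultimately show "rel_option R (fw i u) (fw i v) \<and> rel_option R (ew i u) (ew i v)"
      by (cases "fw i v"; cases "ew i v") (auto simp: R_def fw_append ew_append z)
  qed
  moreover have "bi_unique R" by (auto simp: bi_unique_def R_def)
  ultimately show ?thesis unfolding crystal_eq_def by (intro exI[of _ R]) (auto simp: R_def)
qed

text \<open>Contents that differ by a constant are evened out by full columns. Two counts
  \<open>c\<close> and \<open>c'\<close>, one for each word, avoid a negative shift.\<close>

lemma hw_weight_shift:
  assumes "hw w" "hw w'" "set w \<subseteq> {1..N}" "set w' \<subseteq> {1..N}"
    "\<And>i. i \<in> {1..N} \<Longrightarrow> count_list w i + c = count_list w' i + c'"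
  shows "crystal_eq w w'"
proof -
  define cols where "cols k = concat (replicate k (col (\<lambda>_. True)))" for k
  have eq: "crystal_eq (cols k @ v) v" for k v
  proof (induction k)
    case (Suc k)
    then show ?case
      using crystal_eq_trans[OF full_column_trivial[of "cols k @ v"]] by (simp add: cols_def)
  qed (simp add: cols_def crystal_eq_refl)
  have cnt: "count_list (cols k @ v) i = k + count_list v i" if "i \<in> {1..N}" for k v i
  proof (induction k)
    case (Suc k)
    have "count_list (col (\<lambda>_. True)) i = 1"
      using that distinct_count_one[of "[1..<Suc N]" i] by (simp add: col_def del: upt_Suc)
    then show ?case using Suc by (simp add: cols_def)
  qed (simp add: cols_def)
  have hwc: "hw (cols k @ v)" if "hw v" for k v
    using that crystal_eq_eps[OF eq[of k v]] by (simp add: hw_def)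
  have setc: "set (cols k @ v) \<subseteq> {1..N}" if "set v \<subseteq> {1..N}" for k v
    using that by (auto simp: cols_def col_def)
  have "crystal_eq (cols c @ w) (cols c' @ w')"
  proof (rule hw_same_weight)
    show "count_list (cols c @ w) i = count_list (cols c' @ w') i" if "i \<in> {1..N}" for i
      using cnt[OF that] assms(5)[OF that] by simp
  qed (use assms hwc setc in auto)
  then show ?thesis using eq crystal_eq_sym crystal_eq_trans by blast
qed

end

section \<open>Virtualization\<close>

text \<open>Colours outside \<open>1..n\<close> are cut off, because \<open>f_letter\<close> at
  colour 0 would send \<open>Bar 1\<close> to \<open>Bar 0\<close>. Quantifiers over colours can
  then be unrestricted.\<close>

definition sp_f :: "nat \<Rightarrow> nat \<Rightarrow> letter \<Rightarrow> letter option" where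
  "sp_f n i x = (if i \<in> {1..n} then f_letter n i x else None)"

definition sp_e :: "nat \<Rightarrow> nat \<Rightarrow> letter \<Rightarrow> letter option" where
  "sp_e n i x = (if i \<in> {1..n} then e_letter n i x else None)"

locale sp_words =
  fixes n :: nat
  assumes n_pos: "1 \<le> n"
begin

sublocale letter_crystal "sp_f n" "sp_e n"
  by unfold_locales (auto simp: sp_f_def sp_e_def f_letter_def e_letter_def split: if_splits)

sublocale A: gl_words "2 * n" .

text \<open>The rank in the ordered alphabet; barring a letter is the reflection of
  \<open>1..2n\<close> that takes \<open>p\<close> to \<open>2 * n + 1 - p\<close>.\<close>

definition pos :: "letter \<Rightarrow> nat" where
  "pos x = (case x of Unb i \<Rightarrow> i | Bar i \<Rightarrow> 2 * n + 1 - i)"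

text \<open>The virtual letter: \<open>pos x\<close> followed by a column realising the letter dual to
  \<open>2 * n + 1 - pos x\<close>. The operators of colour \<open>i\<close> act on it as those of type
  \<open>A\<^bsub>2n-1\<^esub>\<close> of the colours \<open>i\<close> and \<open>2 * n - i\<close> in succession.\<close>

definition vlet :: "letter \<Rightarrow> nat list" where
  "vlet x = pos x # A.col (\<lambda>j. j \<noteq> 2 * n + 1 - pos x)"

definition vword :: "word \<Rightarrow> nat list" where
  "vword w = concat (map vlet w)"

lemma vword_simps [simp]: "vword [] = []" "vword (x # w) = vlet x @ vword w"
  by (simp_all add: vword_def)

lemma ph_sp: "ph i x = (if 1 \<le> i \<and> (i < n \<and> (x = Unb i \<or> x = Bar (Suc i)) \<or> i = n \<and> x = Unb n) then 1 else 0)"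
  and ep_sp: "ep i x = (if 1 \<le> i \<and> (i < n \<and> (x = Unb (Suc i) \<or> x = Bar i) \<or> i = n \<and> x = Bar n) then 1 else 0)"
  by (auto simp: ph_def ep_def sp_f_def sp_e_def f_letter_def e_letter_def)

lemma alphabet_cases:
  assumes "x \<in> alphabet n"
  obtains k where "x = Unb k" "1 \<le> k" "k \<le> n" | k where "x = Bar k" "1 \<le> k" "k \<le> n"
  using assms by (auto simp: alphabet_def)

lemma sp_f_alphabet: "x \<in> alphabet n \<Longrightarrow> sp_f n i x = Some y \<Longrightarrow> y \<in> alphabet n"
  and sp_e_alphabet: "x \<in> alphabet n \<Longrightarrow> sp_e n i x = Some y \<Longrightarrow> y \<in> alphabet n"
  by (auto simp: alphabet_def sp_f_def sp_e_def f_letter_def e_letter_def split: if_splits)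

lemma fw_alphabet: "fw i w = Some w' \<Longrightarrow> set w \<subseteq> alphabet n \<Longrightarrow> set w' \<subseteq> alphabet n"
  and ew_alphabet: "ew i w = Some w' \<Longrightarrow> set w \<subseteq> alphabet n \<Longrightarrow> set w' \<subseteq> alphabet n"
  using set_fw set_ew sp_f_alphabet sp_e_alphabet by metis+

text \<open>A column lacking only \<open>c\<close> has one \<open>-\<close> of colour
  \<open>c\<close>, a column lacking only \<open>Suc c\<close> has one \<open>+\<close>. For
  \<open>i < n\<close> at most one of the letter and the column carries a sign of colour
  \<open>c\<close>; at colour \<open>n\<close> both carry the same sign, whence the factor
  2.\<close>

lemma vlet_eps_phi:
  assumes "x \<in> alphabet n" "1 \<le> i" "i \<le> n" "c = i \<or> c = 2 * n - i"
  shows "A.eps c (vlet x) = (if i = n then 2 else 1) * ep i x" (is ?A)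
    and "A.phi c (vlet x) = (if i = n then 2 else 1) * ph i x" (is ?B)
proof -
  define p where "p = pos x"
  define q where "q = 2 * n + 1 - p"
  have c: "1 \<le> c" "c < 2 * n" using assms by auto
  have pq: "p + q = 2 * n + 1" and x: "x = (if p \<le> n then Unb p else Bar q)" "1 \<le> p"
    using assms(1) by (auto elim!: alphabet_cases simp: p_def q_def pos_def)
  have v: "vlet x = p # A.col (\<lambda>j. j \<noteq> q)" by (simp only: vlet_def p_def q_def)
  have E: "A.eps c (vlet x) = (if p = Suc c then 1 else 0) + ((if q = c then 1 else 0) - (if p = c then 1 else 0))"
    "A.phi c (vlet x) = (if q = Suc c then 1 else 0) + ((if p = c then 1 else 0) - (if q = c then 1 else 0))"
    using c by (simp_all add: v A.col_eps_phi[OF c] A.ph_gl A.ep_gl)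
  have "ep i x = (if i < n \<and> (p = Suc i \<or> q = i) \<or> i = n \<and> p = Suc n then 1 else 0)"
    "ph i x = (if i < n \<and> (p = i \<or> q = Suc i) \<or> i = n \<and> p = n then 1 else 0)"
    using pq assms(2,3) unfolding x ep_sp ph_sp by (cases "p \<le> n"; simp; linarith)+
  moreover consider "i = n" "c = n" | "i < n" "c = i" | "i < n" "c + i = 2 * n"
    using assms by fastforce
  then have "A.eps c (vlet x) = (if i = n then 2 else 1) *
        (if i < n \<and> (p = Suc i \<or> q = i) \<or> i = n \<and> p = Suc n then 1 else 0) \<and>
      A.phi c (vlet x) = (if i = n then 2 else 1) *
        (if i < n \<and> (p = i \<or> q = Suc i) \<or> i = n \<and> p = n then 1 else 0)"
  proof cases
    case 1
    have "q = n \<longleftrightarrow> p = Suc n" "q = Suc n \<longleftrightarrow> p = n" using pq by auto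
    then show ?thesis unfolding E using 1 by simp
  next
    case 2
    have "p = i \<Longrightarrow> q \<noteq> i \<and> q \<noteq> Suc i" "p = Suc i \<Longrightarrow> q \<noteq> i \<and> q \<noteq> Suc i" using pq 2 by auto
    then show ?thesis unfolding E using 2 by auto
  next
    case 3
    have "p = Suc c \<longleftrightarrow> q = i" "q = c \<longleftrightarrow> p = Suc i" "p = c \<longleftrightarrow> q = Suc i" "q = Suc c \<longleftrightarrow> p = i"
      using pq 3(2) by auto
    moreover have "p = i \<Longrightarrow> q \<noteq> i \<and> q \<noteq> Suc i" "p = Suc i \<Longrightarrow> q \<noteq> i \<and> q \<noteq> Suc i" using pq 3 by auto
    ultimately show ?thesis unfolding E using 3(1) by auto
  qed
  ultimately show ?A ?B
    by simp_all
qed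

text \<open>The common factor passes through the truncated subtraction of the tensor product
  rule.\<close>

lemma vword_eps_phi:
  assumes "set w \<subseteq> alphabet n" "1 \<le> i" "i \<le> n" "c = i \<or> c = 2 * n - i"
  shows "A.eps c (vword w) = (if i = n then 2 else 1) * eps i w" (is ?A)
    and "A.phi c (vword w) = (if i = n then 2 else 1) * phi i w" (is ?B)
proof -
  have "?A \<and> ?B"
    using assms(1)
    by (induction w)
      (auto simp: A.eps_append A.phi_append vlet_eps_phi[OF _ assms(2-4)] diff_mult_distrib2)
  then show ?A ?B by auto
qed

lemma vlet_f:
  assumes "x \<in> alphabet n" "sp_f n i x = Some y"
  obtains u where "A.fw i (vlet x) = Some u" "A.fw (2 * n - i) u = Some (vlet y)"
proof -
  have i: "1 \<le> i" "i \<le> n" using assms(2) by (auto simp: sp_f_def split: if_splits)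
  define D where "D k = A.col (\<lambda>j. j \<noteq> k)" for k
  have Df: "A.fw c (D (Suc c)) = Some (D c)" if "1 \<le> c" "c < 2 * n" for c
    unfolding D_def by (rule A.col_fw) (use that in auto)
  have De: "A.eps c (D k) = (if k = c then 1 else 0)" "A.phi c (D k) = (if k = Suc c then 1 else 0)"
    if "1 \<le> c" "c < 2 * n" for c k
    unfolding D_def using A.col_eps_phi[OF that] by auto
  have v: "vlet x = pos x # D (2 * n + 1 - pos x)" for x by (simp add: vlet_def D_def)
  consider "i < n" "x = Unb i" "y = Unb (Suc i)" | "i < n" "x = Bar (Suc i)" "y = Bar i"
    | "i = n" "x = Unb n" "y = Bar n"
    using assms(2) by (auto simp: sp_f_def f_letter_def split: if_splits)
  then show ?thesis
  proof cases
    case 1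
    define k where "k = 2 * n - i"
    have k: "1 \<le> k" "k < 2 * n" "Suc k \<noteq> i" "Suc i \<noteq> k" using 1 i by (auto simp: k_def)
    have "2 * n + 1 - i = Suc k" "2 * n + 1 - Suc i = k" using i by (auto simp: k_def)
    then have vv: "vlet x = i # D (Suc k)" "vlet y = Suc i # D k"
      by (simp_all only: v pos_def 1 letter.case)
    show ?thesis
      by (rule that[of "Suc i # D (Suc k)"])
        (use k 1(1) i in \<open>simp_all add: vv De Df A.ph_gl gl_f_def flip: k_def\<close>)
  next
    case 2
    define k where "k = 2 * n - i"
    have k: "1 \<le> k" "k < 2 * n" "k \<noteq> i" using 2 i by (auto simp: k_def)
    have "2 * n + 1 - Suc i = k" "2 * n + 1 - k = Suc i" "2 * n + 1 - i = Suc k" "2 * n + 1 - Suc k = i"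
      using i by (auto simp: k_def)
    then have vv: "vlet x = k # D (Suc i)" "vlet y = Suc k # D i"
      by (simp_all only: v pos_def 2 letter.case)
    \<comment> \<open>For a barred letter the roles are exchanged: colour \<open>i\<close> moves the
      column and colour \<open>2 * n - i\<close> the letter.\<close>
    show ?thesis
      by (rule that[of "k # D i"])
        (use k 2(1) i in \<open>simp_all add: vv De Df A.ph_gl gl_f_def flip: k_def\<close>)
  next
    case 3
    have "2 * n + 1 - n = Suc n" "2 * n + 1 - Suc n = n" and k: "2 * n - i = n" using 3 by auto
    then have vv: "vlet x = n # D (Suc n)" "vlet y = Suc n # D n"
      by (simp_all only: v pos_def 3 letter.case)
    show ?thesis
      by (rule that[of "Suc n # D (Suc n)"])
        (use 3(1) i in \<open>simp_all add: vv k De Df A.ph_gl gl_f_def\<close>)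
  qed
qed

text \<open>Both type A steps must hit the block of the letter on which \<open>fw i\<close> acts.
  The comparison that selects a block involves the type C numbers multiplied by one common factor,
  so it comes out the same as in type C.\<close>

lemma vword_f:
  assumes "set w \<subseteq> alphabet n" "fw i w = Some w'"
  obtains u where "A.fw i (vword w) = Some u" "A.fw (2 * n - i) u = Some (vword w')"
  using assms
proof (induction w arbitrary: w' thesis)
  case (Cons x w)
  have i: "1 \<le> i \<and> i \<le> n"
  proof (rule ccontr)
    assume *: "\<not> ?thesis"
    have "phi i v = 0" for v
      by (induction v) (use * in \<open>auto simp: ph_sp\<close>)
    then show False using Cons.prems(3) fw_Some(1) by (metis nat.distinct(1))
  qed
  let ?c = "2 * n - i"
  have x: "x \<in> alphabet n" and w: "set w \<subseteq> alphabet n" using Cons.prems by auto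
  note E = vword_eps_phi[OF w] and L = vlet_eps_phi[OF x]
  show ?case
  proof (cases "ph i x > eps i w")
    case True
    then obtain y where y: "sp_f n i x = Some y" and e0: "eps i w = 0"
      by (auto simp: ph_def split: if_splits)
    then have w': "w' = y # w" using Cons.prems True by simp
    obtain u where u: "A.fw i (vlet x) = Some u" "A.fw ?c u = Some (vlet y)"
      using vlet_f[OF x y] by blast
    have "A.eps i (vword w) = 0" "A.eps ?c (vword w) = 0" using E[of i i] E[of i ?c] i e0 by auto
    moreover have "A.phi i (vlet x) > 0" "A.phi ?c u > 0"
      using u A.fw_None_iff by (metis not_gr_zero option.distinct(1))+
    ultimately show ?thesis
      using u by (intro Cons.prems(1)[of "u @ vword w"]) (auto simp: A.fw_append w')
  next
    case False
    then obtain v where v: "fw i w = Some v" "w' = x # v" using Cons.prems by auto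
    obtain u where u: "A.fw i (vword w) = Some u" "A.fw ?c u = Some (vword v)"
      using Cons.IH[OF _ w v(1)] by blast
    have sv: "set v \<subseteq> alphabet n" using fw_alphabet[OF v(1) w] .
    have "\<not> A.eps i (vword w) < A.phi i (vlet x)"
      using False E[of i i] L[of i i] i by auto
    \<comment> \<open>For the intermediate word \<open>u\<close> the number
      \<open>A.eps ?c u\<close> is obtained backwards: it is one less than that of
      \<open>vword v\<close>.\<close>
    moreover have "\<not> A.eps ?c u < A.phi ?c (vlet x)"
      using False A.fw_Some(2)[OF u(2)] vword_eps_phi(1)[OF sv, of i ?c] L(2)[of i ?c] i fw_Some(2)[OF v(1)]
      by auto
    ultimately show ?thesis
      using u by (intro Cons.prems(1)[of "vlet x @ u"]) (auto simp: A.fw_append v)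
  qed
qed simp

lemma pos_inj: "x \<in> alphabet n \<Longrightarrow> y \<in> alphabet n \<Longrightarrow> pos x = pos y \<Longrightarrow> x = y"
  by (auto simp: alphabet_def pos_def)

lemma pos_range: "x \<in> alphabet n \<Longrightarrow> pos x \<in> {1..2 * n}"
  by (auto simp: alphabet_def pos_def)

lemma count_vlet:
  assumes "x \<in> alphabet n" "a \<in> {1..2 * n}"
  shows "count_list (vlet x) a + (if pos x = 2 * n + 1 - a then 1 else 0)
    = 1 + (if pos x = a then 1 else 0)"
proof -
  define p where "p = pos x"
  define q where "q = 2 * n + 1 - p"
  have v: "vlet x = p # A.col (\<lambda>j. j \<noteq> q)" by (simp only: vlet_def p_def q_def)
  have "distinct (A.col (\<lambda>j. j \<noteq> q))" "a \<in> set (A.col (\<lambda>j. j \<noteq> q)) \<longleftrightarrow> a \<noteq> q"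
    using assms(2) by (auto simp: A.col_def)
  then have "count_list (A.col (\<lambda>j. j \<noteq> q)) a = (if a = q then 0 else 1)"
    by (simp add: distinct_count_one)
  moreover have "p = 2 * n + 1 - a \<longleftrightarrow> a = q"
    using assms(2) pos_range[OF assms(1)] by (auto simp: p_def q_def)
  ultimately show ?thesis
    unfolding v p_def[symmetric] by (simp only: count_list.simps) simp
qed

lemma length_vlet: assumes "x \<in> alphabet n" shows "length (vlet x) = 2 * n"
proof -
  have "distinct (A.col (\<lambda>j. j \<noteq> 2 * n + 1 - pos x))" by (simp add: A.col_def)
  then have "length (A.col (\<lambda>j. j \<noteq> 2 * n + 1 - pos x)) = card ({1..2 * n} - {2 * n + 1 - pos x})"
    by (subst distinct_card[symmetric]) (auto simp: A.col_def intro!: arg_cong[where f = card])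
  moreover have "2 * n + 1 - pos x \<in> {1..2 * n}" using pos_range[OF assms] by auto
  ultimately show ?thesis
    using n_pos by (simp only: vlet_def list.size card_Diff_singleton) simp
qed

text \<open>Blocks have the constant length \<open>2 * n\<close>, and each begins with the rank of
  its letter.\<close>

lemma vword_inj:
  assumes "set w \<subseteq> alphabet n" "set w' \<subseteq> alphabet n" "vword w = vword w'"
  shows "w = w'"
  using assms
proof (induction w arbitrary: w')
  case Nil
  then show ?case using length_vlet by (cases w') (auto simp: vlet_def)
next
  case (Cons x w)
  then obtain y v where y: "w' = y # v" by (cases w') (auto simp: vlet_def)
  have "length (vlet x) = length (vlet y)" using Cons y length_vlet by simp
  then have "vlet x = vlet y" "vword w = vword v" using Cons y by auto
  then show ?case using Cons y pos_inj by (auto simp: vlet_def)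
qed

lemma count_vword:
  assumes "set w \<subseteq> alphabet n" "a \<in> {1..2 * n}"
  shows "count_list (vword w) a + length (filter (\<lambda>x. pos x = 2 * n + 1 - a) w)
    = length w + length (filter (\<lambda>x. pos x = a) w)"
  using assms(1)
proof (induction w)
  case (Cons x w)
  then show ?case using count_vlet[of x a] assms(2) by (auto split: if_splits)
qed simp

definition wt :: "word \<Rightarrow> nat \<Rightarrow> int" where
  "wt w i = int (count_list w (Unb i)) - int (count_list w (Bar i))"

lemma wt_simps [simp]: "wt [] i = 0"
  "wt (x # w) i = wt w i + (if x = Unb i then 1 else if x = Bar i then - 1 else 0)"
  "wt (u @ v) i = wt u i + wt v i"
  by (auto simp: wt_def)

lemma wt_phi_eps:
  assumes "1 \<le> i" "i \<le> n"
  shows "int (phi i w) - int (eps i w) = wt w i - (if i < n then wt w (Suc i) else 0)"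
proof (induction w)
  case (Cons x w)
  then show ?case using assms by (auto simp: ph_sp ep_sp)
qed (auto simp: wt_def)

text \<open>The type A bisimulation is pulled back along \<open>vword\<close>: zero values are
  detected by \<open>eps\<close> and \<open>phi\<close>, nonzero values by two type A steps.
  Injectivity of \<open>vword\<close>, hence bi-uniqueness, holds for words on the alphabet, and
  \<open>S\<close> is restricted to these.\<close>

lemma crystal_eq_of_vword:
  assumes "set w \<subseteq> alphabet n" "set w' \<subseteq> alphabet n" "A.crystal_eq (vword w) (vword w')"
  shows "crystal_eq w w'"
proof -
  obtain R where R: "R (vword w) (vword w')" "A.bisim R" "bi_unique R"
    using assms(3) unfolding A.crystal_eq_def by blast
  define S where "S u v \<longleftrightarrow> set u \<subseteq> alphabet n \<and> set v \<subseteq> alphabet n \<and> R (vword u) (vword v)" for u v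
  have out: "fw i u = None" "ew i u = None" if "\<not> (1 \<le> i \<and> i \<le> n)" for i u
  proof -
    have "phi i u = 0 \<and> eps i u = 0" by (induction u) (use that in \<open>auto simp: ph_sp ep_sp\<close>)
    then show "fw i u = None" "ew i u = None" by (simp_all add: fw_None_iff ew_None_iff)
  qed
  have "bisim S"
    unfolding bisim_def
  proof (intro allI impI)
    fix u v i
    assume S: "S u v"
    show "rel_option S (fw i u) (fw i v) \<and> rel_option S (ew i u) (ew i v)"
    proof (cases "1 \<le> i \<and> i \<le> n")
      case False
      then show ?thesis using out by simp
    next
      case i: True
      have su: "set u \<subseteq> alphabet n" and sv: "set v \<subseteq> alphabet n" and Ruv: "R (vword u) (vword v)"
        using S by (auto simp: S_def)
      have ph: "phi i u = phi i v"
        using A.bisim_phi[OF R(2) Ruv, of i] vword_eps_phi(2)[OF su, of i i] vword_eps_phi(2)[OF sv, of i i] i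
        by (auto split: if_splits)
      have ep: "eps i u = eps i v"
        using A.bisim_eps[OF R(2) Ruv, of i] vword_eps_phi(1)[OF su, of i i] vword_eps_phi(1)[OF sv, of i i] i
        by (auto split: if_splits)
      have f: "rel_option S (fw i u) (fw i v)"
      proof (cases "fw i u")
        case None
        then show ?thesis using ph fw_None_iff by (metis option.rel_inject(1))
      next
        case (Some u')
        then obtain v' where v': "fw i v = Some v'" using ph fw_None_iff by (metis not_None_eq)
        obtain a where a: "A.fw i (vword u) = Some a" "A.fw (2 * n - i) a = Some (vword u')"
          using vword_f[OF su Some] by blast
        obtain b where b: "A.fw i (vword v) = Some b" "A.fw (2 * n - i) b = Some (vword v')"
          using vword_f[OF sv v'] by blast
        have "R a b" using A.bisim_fw[OF R(2) Ruv, of i] a b by simp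
        then have "R (vword u') (vword v')" using A.bisim_fw[OF R(2), of a b "2 * n - i"] a b by simp
        then show ?thesis using Some v' fw_alphabet su sv by (auto simp: S_def)
      qed
      have e: "rel_option S (ew i u) (ew i v)"
      proof (cases "ew i u")
        case None
        then show ?thesis using ep ew_None_iff by (metis option.rel_inject(1))
      next
        case (Some u')
        then obtain v' where v': "ew i v = Some v'" using ep ew_None_iff by (metis not_None_eq)
        have su': "set u' \<subseteq> alphabet n" and sv': "set v' \<subseteq> alphabet n"
          using ew_alphabet Some v' su sv by blast+
        obtain a where a: "A.fw i (vword u') = Some a" "A.fw (2 * n - i) a = Some (vword u)"
          using vword_f[OF su'] Some fw_ew by blast
        obtain b where b: "A.fw i (vword v') = Some b" "A.fw (2 * n - i) b = Some (vword v)"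
          using vword_f[OF sv'] v' fw_ew by blast
        \<comment> \<open>The two steps of the lowering operator are undone in reverse order, colour
          \<open>2 * n - i\<close> before colour \<open>i\<close>.\<close>
        have "R a b" using A.bisim_ew[OF R(2) Ruv, of "2 * n - i"] a b A.fw_ew by simp
        then have "R (vword u') (vword v')" using A.bisim_ew[OF R(2), of a b i] a b A.fw_ew by simp
        then show ?thesis using Some v' su' sv' by (auto simp: S_def)
      qed
      show ?thesis using e f by blast
    qed
  qed
  moreover have "bi_unique S"
    using R(3) vword_inj unfolding bi_unique_def S_def by metis
  moreover have "S w w'" using R(1) assms by (simp add: S_def)
  ultimately show ?thesis unfolding crystal_eq_def by blast
qed

lemma hw_vword:
  assumes "set w \<subseteq> alphabet n" "hw w"
  shows "A.hw (vword w)"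
  unfolding A.hw_def
proof
  fix c
  show "A.eps c (vword w) = 0"
  proof (cases "1 \<le> c \<and> c < 2 * n")
    case True
    define i where "i = (if c \<le> n then c else 2 * n - c)"
    have "1 \<le> i" "i \<le> n" "c = i \<or> c = 2 * n - i" using True by (auto simp: i_def)
    then show ?thesis using vword_eps_phi(1)[OF assms(1), of i c] assms(2) by (simp add: hw_def)
  qed (rule A.eps_outside)
qed

lemma filter_pos:
  assumes "set w \<subseteq> alphabet n" "1 \<le> i" "i \<le> n"
  shows "length (filter (\<lambda>x. pos x = i) w) = count_list w (Unb i)" (is ?A)
    and "length (filter (\<lambda>x. pos x = 2 * n + 1 - i) w) = count_list w (Bar i)" (is ?B)
proof -
  have "?A \<and> ?B"
    using assms(1)
  proof (induction w)
    case (Cons x w)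
    then have x: "x \<in> alphabet n" by simp
    have "pos (Unb i) = i" "pos (Bar i) = 2 * n + 1 - i" "Unb i \<in> alphabet n" "Bar i \<in> alphabet n"
      using assms by (auto simp: pos_def alphabet_def)
    then have "pos x = i \<longleftrightarrow> x = Unb i" "pos x = 2 * n + 1 - i \<longleftrightarrow> x = Bar i"
      using pos_inj[OF x] by metis+
    then show ?case using Cons by auto
  qed simp
  then show ?A ?B by auto
qed

theorem hw_same_weight:
  assumes "hw w" "hw w'" "set w \<subseteq> alphabet n" "set w' \<subseteq> alphabet n"
    "\<And>i. 1 \<le> i \<Longrightarrow> i \<le> n \<Longrightarrow> wt w i = wt w' i"
  shows "crystal_eq w w'"
proof (rule crystal_eq_of_vword[OF assms(3,4)])
  \<comment> \<open>The content minus the length is the weight coordinate, with reversed sign at the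
    mirrored position. The lengths become the shifts \<open>c = length w'\<close> and
    \<open>c' = length w\<close>.\<close>
  have *: "int (count_list (vword v) a) - int (length v) = (if a \<le> n then wt v a else - wt v (2 * n + 1 - a))"
    if "set v \<subseteq> alphabet n" "a \<in> {1..2 * n}" for v a
  proof (cases "a \<le> n")
    case True
    then show ?thesis using count_vword[OF that] filter_pos[OF that(1), of a] that by (simp add: wt_def)
  next
    case False
    define b where "b = 2 * n + 1 - a"
    have b: "1 \<le> b" "b \<le> n" "a = 2 * n + 1 - b" "2 * n + 1 - a = b" using False that by (auto simp: b_def)
    show ?thesis using count_vword[OF that] filter_pos[OF that(1) b(1,2)] False
      by (simp add: wt_def b(4)) (simp add: b(3))
  qed
  have sub: "set (vword v) \<subseteq> {1..2 * n}" if "set v \<subseteq> alphabet n" for v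
    using that pos_range by (induction v) (auto simp: vlet_def A.col_def)
  show "A.crystal_eq (vword w) (vword w')"
  proof (rule A.hw_weight_shift)
    show "A.hw (vword w)" "A.hw (vword w')" using hw_vword assms by auto
    show "set (vword w) \<subseteq> {1..2 * n}" "set (vword w') \<subseteq> {1..2 * n}" using sub assms by auto
    show "count_list (vword w) a + length w' = count_list (vword w') a + length w" if "a \<in> {1..2 * n}" for a
      using *[OF assms(3) that] *[OF assms(4) that] assms(5)[of a] assms(5)[of "2 * n + 1 - a"] that
      by (auto split: if_splits)
  qed
qed

end

section \<open>The crystal of words in type C\<close>

lemma signature_Nil: "signature n i [] = []"
  by (simp add: signature_def)

lemma signature_Cons:
  "signature n i (x # w) =
     (if f_letter n i x \<noteq> None then [(0, Plus)] else if e_letter n i x \<noteq> None then [(0, Minus)] else [])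
       @ map (apfst Suc) (signature n i w)"
proof -
  have "[0..<length (x # w)] = 0 # map Suc [0..<length w]"
    by (simp add: upt_conv_Cons map_Suc_upt del: upt_Suc)
  then show ?thesis
    unfolding signature_def map_concat by (auto simp: comp_def intro!: arg_cong[where f = concat])
qed

lemma cancel_signs_map: "cancel_signs (map (apfst Suc) s) = map (apfst Suc) (cancel_signs s)"
  by (induction s rule: cancel_signs.induct) (auto split: list.splits sign.splits)

context sp_words
begin

text \<open>The arrows are defined by \<open>f_word\<close> alone, so it suffices to follow the
  leftmost surviving \<open>+\<close> and the number of surviving \<open>-\<close>; the latter
  decides whether a new leading \<open>+\<close> survives.\<close>

lemma cancelled_signature:
  assumes "1 \<le> i" "i \<le> n"
  shows "\<exists>ms ps. cancel_signs (signature n i w) = map (\<lambda>k. (k, Minus)) ms @ map (\<lambda>k. (k, Plus)) ps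
    \<and> length ms = eps i w
    \<and> fw i w = (case ps of [] \<Rightarrow> None | k # _ \<Rightarrow> Some (w[k := the (f_letter n i (w ! k))]))"
proof (induction w)
  case Nil
  show ?case by (intro exI[of _ "[]"]) (simp add: signature_Nil)
next
  case (Cons x w)
  have fx: "sp_f n i x = f_letter n i x" and ex: "sp_e n i x = e_letter n i x"
    using assms by (auto simp: sp_f_def sp_e_def)
  from Cons obtain ms ps where c:
    "cancel_signs (signature n i w) = map (\<lambda>k. (k, Minus)) ms @ map (\<lambda>k. (k, Plus)) ps"
    and l: "length ms = eps i w"
    and f: "fw i w = (case ps of [] \<Rightarrow> None | k # _ \<Rightarrow> Some (w[k := the (f_letter n i (w ! k))]))"
    by (elim exE conjE) (rule that)
  note l = l[symmetric]
  have c': "cancel_signs (map (apfst Suc) (signature n i w))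
      = map (\<lambda>k. (k, Minus)) (map Suc ms) @ map (\<lambda>k. (k, Plus)) (map Suc ps)"
    by (simp add: cancel_signs_map c)
  note rules = signature_Cons c' ph_def ep_def fx ex f
  consider "f_letter n i x = None" "e_letter n i x = None"
    | "f_letter n i x = None" "e_letter n i x \<noteq> None"
    | "f_letter n i x \<noteq> None" "ms \<noteq> []" | "f_letter n i x \<noteq> None" "ms = []"
    by blast
  then show ?case
  proof cases
    case 1
    then show ?thesis
      using l by (intro exI[of _ "map Suc ms"] exI[of _ "map Suc ps"]) (auto simp: rules split: list.splits)
  next
    case 2
    then show ?thesis
      using l by (intro exI[of _ "0 # map Suc ms"] exI[of _ "map Suc ps"]) (auto simp: rules split: list.splits)
  next
    case 3
    then obtain m ms' where ms: "ms = m # ms'" by (cases ms) auto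
    have "e_letter n i x = None" using E_F[of i x] 3(1) by (auto simp: fx ex)
    then show ?thesis
      using l 3 by (intro exI[of _ "map Suc ms'"] exI[of _ "map Suc ps"]) (auto simp: rules ms split: list.splits)
  next
    case 4
    have "e_letter n i x = None" using E_F[of i x] 4(1) by (auto simp: fx ex)
    then show ?thesis
      using l 4 by (intro exI[of _ "[]"] exI[of _ "0 # map Suc ps"]) (auto simp: rules split: list.splits)
  qed
qed

lemma f_word_eq:
  assumes "1 \<le> i" "i \<le> n"
  shows "f_word n i w = fw i w"
proof -
  have fP: "filter (\<lambda>p. snd p = Plus) (map (\<lambda>k. (k, Minus)) ms @ map (\<lambda>k. (k, Plus)) ps) = map (\<lambda>k. (k, Plus)) ps"
    for ms ps :: "nat list" by (induction ms) (simp_all add: filter_map comp_def)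
  obtain ms ps where *: "cancel_signs (signature n i w) = map (\<lambda>k. (k, Minus)) ms @ map (\<lambda>k. (k, Plus)) ps"
    "fw i w = (case ps of [] \<Rightarrow> None | k # _ \<Rightarrow> Some (w[k := the (f_letter n i (w ! k))]))"
    using cancelled_signature[OF assms, of w] by (elim exE conjE) (rule that)
  show ?thesis unfolding f_word_def * fP by (cases ps) auto
qed

lemma fw_outside: "\<not> (1 \<le> i \<and> i \<le> n) \<Longrightarrow> fw i w = None"
proof -
  assume "\<not> (1 \<le> i \<and> i \<le> n)"
  then have "phi i w = 0" by (induction w) (auto simp: ph_sp)
  then show ?thesis by (simp add: fw_None_iff)
qed

lemma crystal_arrow_iff: "crystal_arrow n i u v \<longleftrightarrow> fw i u = Some v"
  using f_word_eq fw_outside by (cases "1 \<le> i \<and> i \<le> n") (auto simp: crystal_arrow_def)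

lemma crystal_component_eq:
  "crystal_component n w = {v. (\<lambda>x y. \<exists>i. fw i x = Some y \<or> ew i x = Some y)\<^sup>*\<^sup>* w v}"
  unfolding crystal_component_def crystal_arrow_iff by (simp add: fw_ew)

lemma component_fw: "u \<in> crystal_component n w \<Longrightarrow> fw i u = Some v \<Longrightarrow> v \<in> crystal_component n w"
  and component_ew: "u \<in> crystal_component n w \<Longrightarrow> ew i u = Some v \<Longrightarrow> v \<in> crystal_component n w"
  unfolding crystal_component_eq by (auto intro: rtranclp.rtrancl_into_rtrancl)

lemma component_refl: "w \<in> crystal_component n w"
  by (simp add: crystal_component_eq)

lemma bisim_component:
  assumes "bisim R" "R w w'" "u \<in> crystal_component n w"
  shows "\<exists>v \<in> crystal_component n w'. R u v"
proof -
  have "(\<lambda>x y. \<exists>i. fw i x = Some y \<or> ew i x = Some y)\<^sup>*\<^sup>* w u"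
    using assms(3) by (simp add: crystal_component_eq)
  then show ?thesis
  proof (induction rule: rtranclp_induct)
    case base
    then show ?case using assms(2) component_refl by blast
  next
    case (step y z)
    then obtain v i where v: "v \<in> crystal_component n w'" "R y v" "fw i y = Some z \<or> ew i y = Some z" by blast
    have "rel_option R (fw i y) (fw i v)" "rel_option R (ew i y) (ew i v)"
      using bisim_fw[OF assms(1) v(2)] bisim_ew[OF assms(1) v(2)] by auto
    then have "\<exists>v'. (fw i v = Some v' \<or> ew i v = Some v') \<and> R z v'"
      using v(3) by (auto simp: option_rel_Some1)
    then show ?case using component_fw[OF v(1)] component_ew[OF v(1)] by blast
  qed
qed

lemma bisim_conversep: "bisim R \<Longrightarrow> bisim R\<inverse>\<inverse>"
  by (auto simp: bisim_def option.rel_conversep)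

text \<open>From right to left, \<open>R\<close> restricts to the graph of a bijection of the
  components. Conversely the graph of \<open>\<phi>\<close> is a bisimulation: preservation of zero
  values follows because components are closed under the operators and \<open>\<phi>\<close> is
  onto, so that an arrow at \<open>\<phi> u\<close> comes from one at \<open>u\<close>.\<close>

theorem crystal_equiv_iff: "crystal_equiv n w w' \<longleftrightarrow> crystal_eq w w'"
proof
  assume "crystal_eq w w'"
  then obtain R where R: "R w w'" "bisim R" "bi_unique R" by (auto simp: crystal_eq_def)
  define \<phi> where "\<phi> u = (THE v. R u v)" for u
  have \<phi>: "\<phi> u = v" if "R u v" for u v
    unfolding \<phi>_def using that R(3) by (auto simp: bi_unique_def)
  have dom: "\<phi> u \<in> crystal_component n w' \<and> R u (\<phi> u)" if u: "u \<in> crystal_component n w" for u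
    using bisim_component[OF R(2,1) u] \<phi> by blast
  have cod: "\<exists>u \<in> crystal_component n w. R u v" if "v \<in> crystal_component n w'" for v
    using bisim_component[OF bisim_conversep[OF R(2)], of w' w v] R(1) that by auto
  have "bij_betw \<phi> (crystal_component n w) (crystal_component n w')"
    unfolding bij_betw_def
  proof
    show "inj_on \<phi> (crystal_component n w)"
      using dom R(3) unfolding inj_on_def bi_unique_def by metis
    show "\<phi> ` crystal_component n w = crystal_component n w'"
      using dom cod \<phi> by blast
  qed
  moreover have "crystal_arrow n i u v \<longleftrightarrow> crystal_arrow n i (\<phi> u) (\<phi> v)"
    if u: "u \<in> crystal_component n w" and v: "v \<in> crystal_component n w" for u v i
  proof -
    have "rel_option R (fw i u) (fw i (\<phi> u))" using bisim_fw[OF R(2)] dom[OF u] by blast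
    then show ?thesis
      unfolding crystal_arrow_iff using dom[OF v] R(3)
      by (cases "fw i u"; cases "fw i (\<phi> u)") (auto simp: bi_unique_def)
  qed
  ultimately show "crystal_equiv n w w'"
    using \<phi>[OF R(1)] unfolding crystal_equiv_def crystal_isomorphism_def by blast
next
  let ?A = "crystal_component n w" and ?B = "crystal_component n w'"
  assume "crystal_equiv n w w'"
  then obtain \<phi> where \<phi>: "bij_betw \<phi> ?A ?B" "\<phi> w = w'"
    and ar: "\<And>u v i. u \<in> ?A \<Longrightarrow> v \<in> ?A \<Longrightarrow> fw i u = Some v \<longleftrightarrow> fw i (\<phi> u) = Some (\<phi> v)"
    unfolding crystal_equiv_def crystal_isomorphism_def crystal_arrow_iff by blast
  define R where "R u v \<longleftrightarrow> u \<in> ?A \<and> v = \<phi> u" for u v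
  have B: "\<phi> u \<in> ?B" if "u \<in> ?A" for u using \<phi>(1) that by (auto simp: bij_betw_def)
  have inv: "\<exists>u \<in> ?A. v = \<phi> u" if "v \<in> ?B" for v using \<phi>(1) that by (auto simp: bij_betw_def)
  have "bisim R"
    unfolding bisim_def
  proof (intro allI impI)
    fix u v i
    assume "R u v"
    then have u: "u \<in> ?A" and v: "v = \<phi> u" by (auto simp: R_def)
    have "rel_option R (fw i u) (fw i v)"
    proof (cases "fw i u")
      case None
      have "fw i v = None"
      proof (rule ccontr)
        assume "fw i v \<noteq> None"
        then obtain v' where v': "fw i v = Some v'" by blast
        then obtain u' where "u' \<in> ?A" "v' = \<phi> u'" using inv component_fw B u v by blast
        then show False using ar[OF u, of u' i] v' v None by simp
      qed
      then show ?thesis using None by simp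
    next
      case (Some u')
      then have "u' \<in> ?A" using component_fw u by blast
      then show ?thesis using ar[OF u, of u' i] Some v by (simp add: R_def)
    qed
    moreover have "rel_option R (ew i u) (ew i v)"
    proof (cases "ew i u")
      case None
      have "ew i v = None"
      proof (rule ccontr)
        assume "ew i v \<noteq> None"
        then obtain v' where v': "ew i v = Some v'" by blast
        then obtain u' where "u' \<in> ?A" "v' = \<phi> u'" using inv component_ew B u v by blast
        then show False using ar[of u' u i] u v' v None fw_ew by simp
      qed
      then show ?thesis using None by simp
    next
      case (Some u')
      then have "u' \<in> ?A" using component_ew u by blast
      then show ?thesis using ar[of u' u i] u Some v fw_ew by (simp add: R_def)
    qed
    ultimately show "rel_option R (fw i u) (fw i v) \<and> rel_option R (ew i u) (ew i v)" by blast
  qed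
  moreover have "bi_unique R"
    using \<phi>(1) by (auto simp: bi_unique_def R_def bij_betw_def inj_on_def)
  moreover have "R w w'" using \<phi>(2) component_refl by (simp add: R_def)
  ultimately show "crystal_eq w w'" unfolding crystal_eq_def by blast
qed

end

section \<open>Admissible columns and the row condition\<close>

definition ct :: "nat set \<Rightarrow> nat \<Rightarrow> nat" where
  "ct X j = card {i \<in> X. i \<le> j}"

definition unb :: "letter list \<Rightarrow> nat set" where
  "unb C = {i. Unb i \<in> set C}"

definition bar :: "letter list \<Rightarrow> nat set" where
  "bar C = {i. Bar i \<in> set C}"

lemma ct_0: "0 \<notin> X \<Longrightarrow> ct X 0 = 0"
  by (auto simp: ct_def card_eq_0_iff)

lemma ct_Suc: "ct X (Suc j) = ct X j + (if Suc j \<in> X then 1 else 0)"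
proof -
  have "{i \<in> X. i \<le> Suc j} = (if Suc j \<in> X then insert (Suc j) {i \<in> X. i \<le> j} else {i \<in> X. i \<le> j})"
    by (auto simp: le_Suc_eq)
  moreover have "finite {i \<in> X. i \<le> j}" by (rule finite_subset[of _ "{..j}"]) auto
  ultimately show ?thesis by (simp add: ct_def)
qed

lemma ct_bound:
  assumes "\<And>i. i \<in> X \<Longrightarrow> i \<le> n" "n \<le> j"
  shows "ct X j = ct X n"
proof -
  have "{i \<in> X. i \<le> j} = {i \<in> X. i \<le> n}" using assms by fastforce
  then show ?thesis by (simp add: ct_def)
qed

lemma ct_card:
  assumes "\<And>i. i \<in> X \<Longrightarrow> i \<le> n" "n \<le> j"
  shows "ct X j = card X"
proof -
  have "{i \<in> X. i \<le> j} = X" using assms by fastforce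
  then show ?thesis by (simp add: ct_def)
qed

lemma ct_Un_disjoint:
  assumes "X \<inter> Y = {}"
  shows "ct (X \<union> Y) j = ct X j + ct Y j"
proof -
  have "{i \<in> X \<union> Y. i \<le> j} = {i \<in> X. i \<le> j} \<union> {i \<in> Y. i \<le> j}" by auto
  moreover have "finite {i \<in> X. i \<le> j}" "finite {i \<in> Y. i \<le> j}"
    by (rule finite_subset[of _ "{..j}"]; auto)+
  ultimately show ?thesis using assms by (auto simp: ct_def intro!: card_Un_disjoint)
qed

lemma ct_Diff:
  assumes "Y \<subseteq> X"
  shows "ct (X - Y) j + ct Y j = ct X j"
proof -
  have "X - Y \<union> Y = X" "(X - Y) \<inter> Y = {}" using assms by blast+
  then show ?thesis using ct_Un_disjoint[of "X - Y" Y j] by metis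
qed

definition upto_below :: "nat set \<Rightarrow> nat \<Rightarrow> nat \<Rightarrow> nat set" where
  "upto_below E j m = {e \<in> E. j < e \<and> e \<le> m}"

lemma finite_upto_below: "finite (upto_below E j m)"
  by (rule finite_subset[of _ "{..m}"]) (auto simp: upto_below_def)

lemma card_upto_below: "j \<le> m \<Longrightarrow> card (upto_below E j m) + ct E j = ct E m"
proof -
  assume "j \<le> m"
  then have "{i \<in> E. i \<le> m} = upto_below E j m \<union> {i \<in> E. i \<le> j}" by (auto simp: upto_below_def)
  moreover have "finite {i \<in> E. i \<le> j}" by (rule finite_subset[of _ "{..j}"]) auto
  moreover have "upto_below E j m \<inter> {i \<in> E. i \<le> j} = {}" by (auto simp: upto_below_def)
  ultimately show ?thesis using card_Un_disjoint[OF finite_upto_below] by (simp add: ct_def)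
qed

text \<open>\<open>E\<close> is the set of letters available for the \<open>t\<^sub>i\<close>. By the last two parts, the number of
  \<open>t\<^sub>i \<le> j\<close> is the maximum over \<open>m \<ge> j\<close> of the number of \<open>z\<^sub>i \<le> m\<close> minus the number of available
  letters in \<open>{j<..m}\<close>; this is what turns the greedy choice into linear inequalities.\<close>

lemma split_ts_below:
  fixes C :: "letter list"
  defines "E \<equiv> {t. 1 \<le> t \<and> Unb t \<notin> set C \<and> Bar t \<notin> set C}"
  assumes "sorted_wrt (>) zs" "\<And>z. z \<in> set zs \<Longrightarrow> z \<notin> E"
    "\<And>z. z \<in> set zs \<Longrightarrow> length (filter (\<lambda>y. y \<le> z) zs) \<le> card {e \<in> E. e < min b z}"
    and ts: "ts = split_ts_below C b zs"
  shows "length ts = length zs" (is ?P1)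
    and "set ts \<subseteq> E \<and> (\<forall>t \<in> set ts. t < b) \<and> distinct ts" (is ?P2)
    and "\<forall>m. length (filter (\<lambda>z. z \<le> m) zs) \<le> length (filter (\<lambda>t. t \<le> m) ts)" (is ?P3)
    and "\<forall>j. \<exists>m \<ge> j. (m = j \<or> m \<in> set zs) \<and>
      length (filter (\<lambda>t. t \<le> j) ts) + card {e \<in> E. j < e \<and> e \<le> m \<and> e < b}
        = length (filter (\<lambda>z. z \<le> m) zs)" (is ?P4)
proof -
  have "?P1 \<and> ?P2 \<and> ?P3 \<and> ?P4"
    using assms(2-)
  proof (induction zs arbitrary: b ts)
    case Nil
    then show ?case by (auto intro!: card_eq_0_iff[THEN iffD2])
  next
    case (Cons z zs)
    have zs: "\<And>y. y \<in> set zs \<Longrightarrow> y < z" "sorted_wrt (>) zs" using Cons.prems(1) by auto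
    have fle: "filter (\<lambda>y. y \<le> z) (z # zs) = z # zs" using zs(1) by (auto simp: filter_id_conv intro: less_imp_le)
    define S where "S = {e \<in> E. e < min b z}"
    have finS: "finite S" by (rule finite_subset[of _ "{..b}"]) (auto simp: S_def)
    define t where "t = (GREATEST t. 1 \<le> t \<and> t < min b z \<and> Unb t \<notin> set C \<and> Bar t \<notin> set C)"
    have cS: "Suc (length zs) \<le> card S" using Cons.prems(3)[of z] fle by (simp add: S_def)
    then have "S \<noteq> {}" by auto
    then obtain e where e: "e \<in> S" by blast
    have tS: "t = (GREATEST t. t \<in> S)"
      unfolding t_def by (rule arg_cong[where f = Greatest]) (auto simp: S_def E_def)
    have t: "t \<in> S" unfolding tS by (rule GreatestI_nat[where b = b]) (use e in \<open>auto simp: S_def\<close>)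
    have tmax: "x \<le> t" if "x \<in> S" for x
      unfolding tS by (rule Greatest_le_nat[where b = b]) (use that in \<open>auto simp: S_def\<close>)
    have tE: "t \<in> E" "t < b" "t < z" using t by (auto simp: S_def)
    have bel: "{e \<in> E. e < t} = S - {t}" using tmax tE by (fastforce simp: S_def)
    define ts' where "ts' = split_ts_below C t zs"
    have ts: "ts = t # ts'" using Cons.prems(4) by (simp add: Let_def ts'_def t_def)
    \<comment> \<open>The greedy hypothesis passes to the tail with bound \<open>t\<close>. Letters
      \<open>y' \<le> t\<close> see the same candidates as before; for the others the candidates
      have lost exactly \<open>t\<close>, and the list has lost exactly \<open>z\<close>.\<close>
    have pre: "length (filter (\<lambda>y. y \<le> y') zs) \<le> card {e \<in> E. e < min t y'}" if y': "y' \<in> set zs" for y'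
    proof (cases "y' \<le> t")
      case True
      have "length (filter (\<lambda>y. y \<le> y') zs) \<le> length (filter (\<lambda>y. y \<le> y') (z # zs))" by simp
      also have "\<dots> \<le> card {e \<in> E. e < min b y'}" using Cons.prems(3)[of y'] y' by auto
      also have "min b y' = min t y'" using True tE by auto
      finally show ?thesis .
    next
      case False
      have "length (filter (\<lambda>y. y \<le> y') zs) \<le> length zs" by simp
      also have "\<dots> \<le> card (S - {t})" using cS finS t by simp
      also have "S - {t} = {e \<in> E. e < min t y'}" using False bel by (simp add: min_absorb1)
      finally show ?thesis .
    qed
    have zE: "y \<notin> E" if "y \<in> set zs" for y using Cons.prems(2) that by simp
    note ih = Cons.IH[OF zs(2) zE pre ts'_def]
    have IH: "length ts' = length zs" "set ts' \<subseteq> E" "\<And>s. s \<in> set ts' \<Longrightarrow> s < t" "distinct ts'"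
      using ih by blast+
    have IH5: "length (filter (\<lambda>z. z \<le> m) zs) \<le> length (filter (\<lambda>t. t \<le> m) ts')" for m
      using ih[THEN conjunct2, THEN conjunct2, THEN conjunct1] by (rule spec)
    have IH4: "\<exists>m \<ge> j. (m = j \<or> m \<in> set zs) \<and>
      length (filter (\<lambda>t. t \<le> j) ts') + card {e \<in> E. j < e \<and> e \<le> m \<and> e < t}
        = length (filter (\<lambda>z. z \<le> m) zs)" for j
      using ih[THEN conjunct2, THEN conjunct2, THEN conjunct2] by (rule spec)
    have P4: "\<exists>m \<ge> j. (m = j \<or> m \<in> set (z # zs)) \<and>
      length (filter (\<lambda>t. t \<le> j) ts) + card {e \<in> E. j < e \<and> e \<le> m \<and> e < b}
        = length (filter (\<lambda>z. z \<le> m) (z # zs))" for j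
    proof (cases "t \<le> j")
      case True
      have "filter (\<lambda>t. t \<le> j) ts = ts" using IH(3) True by (fastforce simp: ts filter_id_conv)
      then have l: "length (filter (\<lambda>t. t \<le> j) ts) = Suc (length zs)" by (simp add: ts IH(1))
      show ?thesis
      proof (cases "j < z")
        case j: True
        have "z \<notin> E" using Cons.prems(2) by simp
        then have "{e \<in> E. j < e \<and> e \<le> z \<and> e < b} \<subseteq> {}"
          using tmax True by (fastforce simp: S_def le_less)
        then have 0: "card {e \<in> E. j < e \<and> e \<le> z \<and> e < b} = 0" by simp
        show ?thesis
          by (intro exI[of _ z]) (use j l 0 fle in \<open>simp\<close>)
      next
        case j: False
        have f: "filter (\<lambda>z. z \<le> j) (z # zs) = z # zs" using zs(1) j by (fastforce simp: filter_id_conv)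
        have 0: "card {e \<in> E. j < e \<and> e \<le> j \<and> e < b} = 0" by (auto simp: card_eq_0_iff)
        show ?thesis
          by (intro exI[of _ j]) (simp only: f 0 l, simp)
      qed
    next
      case False
      then have ft: "filter (\<lambda>t. t \<le> j) ts = filter (\<lambda>t. t \<le> j) ts'" by (simp add: ts)
      obtain m where m: "j \<le> m" "m = j \<or> m \<in> set zs"
        "length (filter (\<lambda>t. t \<le> j) ts') + card {e \<in> E. j < e \<and> e \<le> m \<and> e < t}
        = length (filter (\<lambda>z. z \<le> m) zs)"
        using IH4[of j] by blast
      show ?thesis
      proof (cases "m < t")
        case True
        then have "{e \<in> E. j < e \<and> e \<le> m \<and> e < t} = {e \<in> E. j < e \<and> e \<le> m \<and> e < b}"
          using tE by auto
        then show ?thesis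
          using m True tE by (intro exI[of _ m]) (auto simp: ft)
      next
        case mt: False
        \<comment> \<open>The witness of the tail lies at or beyond \<open>t\<close>, so its
          interval contains every available letter between \<open>j\<close> and \<open>t\<close>.
          This forces equality with \<open>length zs\<close>, and \<open>z\<close> can serve as
          witness: the count on each side grows by one, by \<open>t\<close> and
          \<open>z\<close>.\<close>
        let ?I = "{e \<in> E. j < e \<and> e < t}"
        have finI: "finite ?I" by (rule finite_subset[of _ "{..t}"]) auto
        have I: "{e \<in> E. j < e \<and> e \<le> m \<and> e < t} = ?I" using mt by auto
        have "length (filter (\<lambda>t. \<not> t \<le> j) ts') = card (set (filter (\<lambda>t. \<not> t \<le> j) ts'))"
          using IH(4) by (metis distinct_card distinct_filter)
        also have "\<dots> \<le> card ?I" using IH(2,3) finI by (intro card_mono) auto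
        finally have "length zs \<le> length (filter (\<lambda>t. t \<le> j) ts') + card ?I"
          using sum_length_filter_compl[of "\<lambda>t. t \<le> j" ts'] IH(1) by simp
        moreover have "length (filter (\<lambda>z. z \<le> m) zs) \<le> length zs" by simp
        ultimately have eq: "length (filter (\<lambda>t. t \<le> j) ts') + card ?I = length zs"
          using m(3) unfolding I by linarith
        have "z \<notin> E" using Cons.prems(2) by simp
        then have "{e \<in> E. j < e \<and> e \<le> z \<and> e < b} = insert t ?I"
          using tmax tE False by (fastforce simp: S_def le_less)
        moreover have "card (insert t ?I) = Suc (card ?I)" using finI by simp
        ultimately have "length (filter (\<lambda>t. t \<le> j) ts) + card {e \<in> E. j < e \<and> e \<le> z \<and> e < b}
            = length (filter (\<lambda>y. y \<le> z) (z # zs))"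
          using eq ft fle by simp
        then show ?thesis using False tE by (intro exI[of _ z]) auto
      qed
    qed
    have "length (filter (\<lambda>y. y \<le> m) (z # zs)) \<le> length (filter (\<lambda>t. t \<le> m) ts)" for m
      using IH5[of m] tE by (auto simp: ts)
    then show ?case using P4 IH(1-4) tE by (fastforce simp: ts)
  qed
  then show ?P1 ?P2 ?P3 ?P4 by blast+
qed


text \<open>Admissibility says that this is nowhere positive on \<open>{..n}\<close>.\<close>

definition excess :: "letter list \<Rightarrow> nat \<Rightarrow> int" where
  "excess C m = int (ct (unb C) m) + int (ct (bar C) m) - int m"

lemma unb_bar_alphabet:
  assumes "set C \<subseteq> alphabet n"
  shows "i \<in> unb C \<Longrightarrow> 1 \<le> i \<and> i \<le> n" and "i \<in> bar C \<Longrightarrow> 1 \<le> i \<and> i \<le> n"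
  using assms by (auto simp: unb_def bar_def alphabet_def)

lemma finite_unb_bar: "finite (unb C)" "finite (bar C)"
  unfolding unb_def bar_def
  using finite_vimageI[of "set C" Unb] finite_vimageI[of "set C" Bar] by (auto simp: inj_def vimage_def)

lemma card_unb_bar: "card (set C) = card (unb C) + card (bar C)"
proof -
  have "x \<in> set C \<longleftrightarrow> x \<in> Unb ` unb C \<union> Bar ` bar C" for x
    by (cases x) (auto simp: unb_def bar_def)
  then have "set C = Unb ` unb C \<union> Bar ` bar C" by blast
  then have "card (set C) = card (Unb ` unb C) + card (Bar ` bar C)"
    using finite_unb_bar[of C] by (subst card_Un_disjoint[symmetric]) auto
  then show ?thesis by (simp add: card_image inj_on_def)
qed

text \<open>The letters above \<open>Bar (Suc j)\<close> are exactly the barred letters of index at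
  most \<open>j\<close>; the shift by one keeps both counting functions at the same
  argument.\<close>

lemma card_letters_le:
  shows "card {x \<in> set C. x \<le> Unb j} = ct (unb C) j"
    and "card {x \<in> set C. x \<le> Bar (Suc j)} + ct (bar C) j = card (set C)"
proof -
  have "x \<in> set C \<and> x \<le> Unb j \<longleftrightarrow> x \<in> Unb ` {i \<in> unb C. i \<le> j}" for x
    by (cases x) (auto simp: unb_def)
  then have "{x \<in> set C. x \<le> Unb j} = Unb ` {i \<in> unb C. i \<le> j}" by blast
  then show "card {x \<in> set C. x \<le> Unb j} = ct (unb C) j"
    by (simp add: ct_def card_image inj_on_def)
  have "x \<in> set C \<longleftrightarrow> x \<in> {x \<in> set C. x \<le> Bar (Suc j)} \<union> Bar ` {i \<in> bar C. i \<le> j}" for x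
    by (cases x) (auto simp: bar_def not_less_eq_eq)
  then have "set C = {x \<in> set C. x \<le> Bar (Suc j)} \<union> Bar ` {i \<in> bar C. i \<le> j}" by blast
  moreover have "card ({x \<in> set C. x \<le> Bar (Suc j)} \<union> Bar ` {i \<in> bar C. i \<le> j})
      = card {x \<in> set C. x \<le> Bar (Suc j)} + card (Bar ` {i \<in> bar C. i \<le> j})"
    using finite_unb_bar[of C] by (intro card_Un_disjoint) auto
  ultimately show "card {x \<in> set C. x \<le> Bar (Suc j)} + ct (bar C) j = card (set C)"
    by (simp add: ct_def card_image inj_on_def)
qed

lemma admissible_iff:
  "admissible n C \<longleftrightarrow> set C \<subseteq> alphabet n \<and> sorted_wrt (<) C \<and> (\<forall>m \<le> n. excess C m \<le> 0)"
proof -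
  have *: "card {x \<in> set C. x \<le> Unb m \<or> x \<ge> Bar m} = ct (unb C) m + ct (bar C) m" for m
  proof -
    let ?U = "Unb ` {i \<in> unb C. i \<le> m}" and ?B = "Bar ` {i \<in> bar C. i \<le> m}"
    have "x \<in> set C \<and> (x \<le> Unb m \<or> x \<ge> Bar m) \<longleftrightarrow> x \<in> ?U \<union> ?B" for x
      by (cases x) (auto simp: unb_def bar_def)
    then have "{x \<in> set C. x \<le> Unb m \<or> x \<ge> Bar m} = ?U \<union> ?B" by blast
    moreover have "card (?U \<union> ?B) = card ?U + card ?B"
      using finite_unb_bar[of C] by (intro card_Un_disjoint) auto
    ultimately show ?thesis by (simp add: ct_def card_image inj_on_def)
  qed
  have "(\<forall>m\<in>{1..n}. ct (unb C) m + ct (bar C) m \<le> m) \<longleftrightarrow> (\<forall>m \<le> n. excess C m \<le> 0)"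
    if "set C \<subseteq> alphabet n"
  proof -
    have "0 \<notin> unb C" "0 \<notin> bar C" using unb_bar_alphabet[OF that, of 0] by auto
    then have "excess C 0 = 0" by (simp add: excess_def ct_0)
    then have "excess C m \<le> 0 \<longleftrightarrow> m = 0 \<or> ct (unb C) m + ct (bar C) m \<le> m" for m
      by (cases m) (auto simp: excess_def)
    then show ?thesis by (auto simp: Suc_le_eq)
  qed
  then show ?thesis unfolding admissible_def * by auto
qed

lemma ct_set_distinct: "distinct xs \<Longrightarrow> ct (set xs) j = length (filter (\<lambda>x. x \<le> j) xs)"
  by (simp add: ct_def distinct_card[symmetric])

lemma split_zs_props:
  assumes "set C \<subseteq> alphabet n"
  shows "set (split_zs C) = unb C \<inter> bar C" and "sorted_wrt (>) (split_zs C)"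
    and "distinct (split_zs C)"
proof -
  have fin: "finite {z. Unb z \<in> set C \<and> Bar z \<in> set C}"
    using finite_unb_bar[of C] by (auto simp: unb_def)
  then show "set (split_zs C) = unb C \<inter> bar C"
    by (auto simp: split_zs_def unb_def bar_def)
  show "sorted_wrt (>) (split_zs C)"
    using strict_sorted_list_of_set by (auto simp: split_zs_def sorted_wrt_rev)
  show "distinct (split_zs C)" by (simp add: split_zs_def)
qed

text \<open>The last two parts say that the number of \<open>t\<close> up to \<open>j\<close> minus
  the number of \<open>z\<close> up to \<open>j\<close> is the maximum of
  \<open>excess C m - excess C j\<close> over \<open>j \<le> m \<le> n\<close>.\<close>

lemma split_ts_props:
  assumes C: "admissible n C"
  defines "Z \<equiv> set (split_zs C)" and "T \<equiv> set (split_ts n C)"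
  shows "T \<inter> unb C = {}" "T \<inter> bar C = {}" "card T = card Z" "finite T"
    "\<And>t. t \<in> T \<Longrightarrow> 1 \<le> t \<and> t \<le> n"
    and "\<And>j m. j \<le> m \<Longrightarrow> excess C m - excess C j \<le> int (ct T j) - int (ct Z j)"
    and "\<And>j. j \<le> n \<Longrightarrow> \<exists>m. j \<le> m \<and> m \<le> n \<and>
      excess C m - excess C j = int (ct T j) - int (ct Z j)"
proof -
  have al: "set C \<subseteq> alphabet n" and ex: "\<And>m. m \<le> n \<Longrightarrow> excess C m \<le> 0"
    using C by (auto simp: admissible_iff)
  let ?U = "unb C" and ?B = "bar C"
  define E where "E = {t. 1 \<le> t \<and> Unb t \<notin> set C \<and> Bar t \<notin> set C}"
  note zp = split_zs_props[OF al]
  have Z: "Z = ?U \<inter> ?B" using zp(1) by (simp add: Z_def)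
  have z0: "0 \<notin> ?U" "0 \<notin> ?B" using unb_bar_alphabet[OF al, of 0] by auto
  \<comment> \<open>Each index up to \<open>m\<close> contributes two letters if it is a
    \<open>z\<close>, none if it is available for a \<open>t\<close>, and one otherwise.\<close>
  have exE: "excess C m = int (ct Z m) - int (ct E m)" for m
  proof (induction m)
    case 0
    then show ?case using z0 by (simp add: excess_def ct_0 Z E_def)
  next
    case (Suc m)
    then show ?case
      by (auto simp: excess_def ct_Suc Z E_def unb_def bar_def)
  qed
  have Zr: "1 \<le> z \<and> z \<le> n" if "z \<in> Z" for z using that unb_bar_alphabet[OF al, of z] by (simp add: Z)
  have ZE: "z \<notin> E" if "z \<in> Z" for z using that by (auto simp: Z E_def unb_def)
  have lenZ: "length (filter (\<lambda>y. y \<le> m) (split_zs C)) = ct Z m" for m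
    using ct_set_distinct[OF zp(3)] by (simp add: Z_def)
  have pre: "length (filter (\<lambda>y. y \<le> z) (split_zs C)) \<le> card {e \<in> E. e < min (n + 1) z}"
    if "z \<in> set (split_zs C)" for z
  proof -
    have z: "z \<in> Z" "z \<le> n" using that Zr by (auto simp: Z_def)
    have "{e \<in> E. e < min (n + 1) z} = {e \<in> E. e \<le> z}" using z ZE[OF z(1)] by (auto simp: le_less)
    then have "card {e \<in> E. e < min (n + 1) z} = ct E z" by (simp add: ct_def)
    then show ?thesis using ex[OF z(2)] exE[of z] lenZ by simp
  qed
  have ZEl: "z \<notin> E" if "z \<in> set (split_zs C)" for z using that ZE by (simp add: Z_def)
  note sb = split_ts_below[of "split_zs C" C "n + 1" "split_ts n C", folded E_def,
      OF zp(2) ZEl pre split_ts_def]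
  have ts: "set (split_ts n C) \<subseteq> E" "distinct (split_ts n C)" using sb(2) by auto
  show Tr: "1 \<le> t \<and> t \<le> n" if "t \<in> T" for t using sb(2) that by (auto simp: T_def E_def)
  show "T \<inter> ?U = {}" "T \<inter> ?B = {}" using ts(1) by (auto simp: T_def E_def unb_def bar_def)
  show "finite T" by (simp add: T_def)
  show "card T = card Z" using sb(1) ts(2) zp(3) by (simp add: T_def Z_def distinct_card)
  have lenT: "length (filter (\<lambda>y. y \<le> m) (split_ts n C)) = ct T m" for m
    using ct_set_distinct[OF ts(2)] by (simp add: T_def)
  show "excess C m - excess C j \<le> int (ct T j) - int (ct Z j)" if "j \<le> m" for j m
  proof -
    have "ct Z m \<le> ct T m" using sb(3) by (simp add: lenZ lenT)
    moreover have "card (upto_below T j m) \<le> card (upto_below E j m)"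
      using ts(1) by (intro card_mono finite_upto_below) (auto simp: upto_below_def T_def)
    ultimately show ?thesis
      using card_upto_below[OF that, of T] card_upto_below[OF that, of E] by (simp add: exE)
  qed
  show "\<exists>m. j \<le> m \<and> m \<le> n \<and> excess C m - excess C j = int (ct T j) - int (ct Z j)"
    if j: "j \<le> n" for j
  proof -
    obtain m where m: "j \<le> m" "m = j \<or> m \<in> Z"
      "ct T j + card {e \<in> E. j < e \<and> e \<le> m \<and> e < n + 1} = ct Z m"
      using sb(4) unfolding lenZ lenT Z_def by blast
    have mn: "m \<le> n" using m(2) j Zr by auto
    have "{e \<in> E. j < e \<and> e \<le> m \<and> e < n + 1} = upto_below E j m"
      using mn by (auto simp: upto_below_def)
    then have "ct T j + card (upto_below E j m) = ct Z m" using m(3) by simp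
    then have "excess C m - excess C j = int (ct T j) - int (ct Z j)"
      using card_upto_below[OF m(1), of E] by (simp add: exE)
    then show ?thesis using m(1) mn by blast
  qed
qed

lemma length_exchange:
  assumes "inj f" "f ` Z \<subseteq> set C" "set C \<inter> f ` T = {}" "finite T" "card T = card Z" "distinct C"
  shows "length (sorted_list_of_set (set C - f ` Z \<union> f ` T)) = length C"
proof -
  have im: "card (f ` Z) = card Z" "card (f ` T) = card T"
    using assms(1) by (auto intro!: card_image intro: inj_on_subset)
  have "card (set C - f ` Z \<union> f ` T) = card (set C - f ` Z) + card (f ` T)"
    using assms(3,4) by (intro card_Un_disjoint) auto
  also have "card (set C - f ` Z) = card (set C) - card (f ` Z)"
    using assms(2) by (intro card_Diff_subset) (auto intro: finite_subset)
  finally show ?thesis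
    using im assms(5,6) card_mono[OF _ assms(2)] by (simp add: distinct_card)
qed

lemma ct_exchange:
  assumes "Z \<subseteq> X" "X \<inter> T = {}"
  shows "int (ct (X - Z \<union> T) j) = int (ct X j) + (int (ct T j) - int (ct Z j))"
proof -
  have "ct (X - Z \<union> T) j = ct (X - Z) j + ct T j" using assms(2) by (intro ct_Un_disjoint) auto
  then show ?thesis using ct_Diff[OF assms(1), of j] by simp
qed

lemma left_column_props:
  assumes C: "admissible n C"
  shows "sorted_wrt (<) (left_column n C)" "length (left_column n C) = length C"
    "set (left_column n C) \<subseteq> alphabet n"
    "bar (left_column n C) = bar C"
    "int (ct (unb (left_column n C)) j) =
      int (ct (unb C) j) + (int (ct (set (split_ts n C)) j) - int (ct (set (split_zs C)) j))"
proof -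
  have al: "set C \<subseteq> alphabet n" and so: "sorted_wrt (<) C" using C by (auto simp: admissible_iff)
  let ?Z = "set (split_zs C)" and ?T = "set (split_ts n C)"
  note zp = split_zs_props[OF al] and tp = split_ts_props[OF C]
  have s: "set (left_column n C) = set C - Unb ` ?Z \<union> Unb ` ?T" by (simp add: left_column_def)
  show "sorted_wrt (<) (left_column n C)" by (simp add: left_column_def)
  show "length (left_column n C) = length C"
    unfolding left_column_def
    by (rule length_exchange) (use zp(1) tp so in \<open>auto simp: unb_def bar_def inj_on_def strict_sorted_iff\<close>)
  show "set (left_column n C) \<subseteq> alphabet n" using al tp(5) unfolding s by (auto simp: alphabet_def)
  show "bar (left_column n C) = bar C" by (auto simp: bar_def s)
  have u: "unb (left_column n C) = unb C - ?Z \<union> ?T" by (auto simp: unb_def s)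
  show "int (ct (unb (left_column n C)) j) =
      int (ct (unb C) j) + (int (ct ?T j) - int (ct ?Z j))"
    unfolding u by (rule ct_exchange) (use zp(1) tp(1,2) in auto)
qed

lemma right_column_props:
  assumes C: "admissible n C"
  shows "sorted_wrt (<) (right_column n C)" "length (right_column n C) = length C"
    "set (right_column n C) \<subseteq> alphabet n"
    "unb (right_column n C) = unb C"
    "int (ct (bar (right_column n C)) j) =
      int (ct (bar C) j) + (int (ct (set (split_ts n C)) j) - int (ct (set (split_zs C)) j))"
proof -
  have al: "set C \<subseteq> alphabet n" and so: "sorted_wrt (<) C" using C by (auto simp: admissible_iff)
  let ?Z = "set (split_zs C)" and ?T = "set (split_ts n C)"
  note zp = split_zs_props[OF al] and tp = split_ts_props[OF C]
  have s: "set (right_column n C) = set C - Bar ` ?Z \<union> Bar ` ?T" by (simp add: right_column_def)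
  show "sorted_wrt (<) (right_column n C)" by (simp add: right_column_def)
  show "length (right_column n C) = length C"
    unfolding right_column_def
    by (rule length_exchange) (use zp(1) tp so in \<open>auto simp: unb_def bar_def inj_on_def strict_sorted_iff\<close>)
  show "set (right_column n C) \<subseteq> alphabet n" using al tp(5) unfolding s by (auto simp: alphabet_def)
  show "unb (right_column n C) = unb C" by (auto simp: unb_def s)
  have u: "bar (right_column n C) = bar C - ?Z \<union> ?T" by (auto simp: bar_def s)
  show "int (ct (bar (right_column n C)) j) =
      int (ct (bar C) j) + (int (ct ?T j) - int (ct ?Z j))"
    unfolding u by (rule ct_exchange) (use zp(1) tp(1,2) in auto)
qed

lemma card_le_sorted:
  fixes A :: "'a::linorder list"
  assumes "sorted_wrt (<) A" "k < length A"
  shows "A ! k \<le> y \<longleftrightarrow> k < card {x \<in> set A. x \<le> y}"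
proof
  have inj: "inj_on ((!) A) {..<length A}" using assms(1) by (auto simp: inj_on_nth strict_sorted_iff)
  have mono: "A ! i \<le> A ! j" if "i \<le> j" "j < length A" for i j
    using sorted_wrt_nth_less[OF assms(1), of i j] that by (cases "i = j") auto
  show "k < card {x \<in> set A. x \<le> y}" if "A ! k \<le> y"
  proof -
    have "(!) A ` {..k} \<subseteq> {x \<in> set A. x \<le> y}"
      using mono that assms(2) by (auto intro: order_trans)
    then have "card ((!) A ` {..k}) \<le> card {x \<in> set A. x \<le> y}" by (intro card_mono) auto
    moreover have "card ((!) A ` {..k}) = Suc k"
      using assms(2) by (subst card_image) (auto intro: inj_on_subset[OF inj])
    ultimately show ?thesis by simp
  qed
  show "A ! k \<le> y" if k: "k < card {x \<in> set A. x \<le> y}"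
  proof (rule ccontr)
    assume n: "\<not> A ! k \<le> y"
    have "{x \<in> set A. x \<le> y} \<subseteq> (!) A ` {..<k}"
    proof
      fix x assume "x \<in> {x \<in> set A. x \<le> y}"
      then obtain i where i: "i < length A" "x = A ! i" "A ! i \<le> y" by (auto simp: in_set_conv_nth)
      then have "i < k" using mono[of k i] n by (meson not_le order_trans)
      then show "x \<in> (!) A ` {..<k}" using i by auto
    qed
    then have "card {x \<in> set A. x \<le> y} \<le> card ((!) A ` {..<k})" by (intro card_mono) auto
    also have "\<dots> \<le> k" using card_image_le[of "{..<k}" "(!) A"] by simp
    finally show False using k by simp
  qed
qed

text \<open>The entry at position \<open>k\<close> is at most \<open>y\<close> exactly if more than
  \<open>k\<close> letters are, so entrywise comparison becomes comparison of counting
  functions.\<close>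

lemma rows_le_iff:
  fixes A B :: "'a::linorder list"
  assumes "sorted_wrt (<) A" "sorted_wrt (<) B" "length B \<le> length A"
  shows "(\<forall>k < length B. A ! k \<le> B ! k) \<longleftrightarrow> (\<forall>y. card {x \<in> set B. x \<le> y} \<le> card {x \<in> set A. x \<le> y})"
proof
  assume *: "\<forall>k < length B. A ! k \<le> B ! k"
  show "\<forall>y. card {x \<in> set B. x \<le> y} \<le> card {x \<in> set A. x \<le> y}"
  proof (rule allI, rule ccontr)
    fix y
    define k where "k = card {x \<in> set A. x \<le> y}"
    assume "\<not> card {x \<in> set B. x \<le> y} \<le> card {x \<in> set A. x \<le> y}"
    then have k: "k < card {x \<in> set B. x \<le> y}" by (simp add: k_def)
    also have "\<dots> \<le> card (set B)" by (intro card_mono) auto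
    also have "\<dots> \<le> length B" by (rule card_length)
    finally have kB: "k < length B" .
    then have "B ! k \<le> y" using k card_le_sorted[OF assms(2)] by blast
    then have "A ! k \<le> y" using * kB order_trans by blast
    then show False using card_le_sorted[OF assms(1), of k y] kB assms(3) by (simp add: k_def)
  qed
next
  assume *: "\<forall>y. card {x \<in> set B. x \<le> y} \<le> card {x \<in> set A. x \<le> y}"
  show "\<forall>k < length B. A ! k \<le> B ! k"
  proof (intro allI impI)
    fix k assume k: "k < length B"
    have "k < card {x \<in> set B. x \<le> B ! k}" using card_le_sorted[OF assms(2) k] by blast
    also have "\<dots> \<le> card {x \<in> set A. x \<le> B ! k}" using * by blast
    finally show "A ! k \<le> B ! k" using card_le_sorted[OF assms(1), of k] k assms(3) by simp
  qed
qed

text \<open>The mixed form of \<open>excess\<close>, with the unbarred letters of one column and the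
  barred letters of the next; \<open>slack C C\<close> is \<open>excess C\<close>.\<close>

definition slack :: "letter list \<Rightarrow> letter list \<Rightarrow> nat \<Rightarrow> int" where
  "slack C D j = int (ct (unb C) j) + int (ct (bar D) j) - int j"

text \<open>The row condition on two adjacent columns, with the letters \<open>t\<^sub>i\<close> eliminated.\<close>

definition linked :: "nat \<Rightarrow> letter list \<Rightarrow> letter list \<Rightarrow> bool" where
  "linked n C D \<longleftrightarrow> length D \<le> length C \<and>
     (\<forall>j m. j \<le> m \<and> m \<le> n \<longrightarrow> excess D m \<le> slack C D j \<and>
        excess C m + int (length D) - int (length C) \<le> slack C D j)"

text \<open>Thresholds at unbarred letters bound the change from \<open>D\<close> to its left
  column, thresholds at barred letters the change from \<open>C\<close> to its right column. Each
  change is a maximum of excess differences, and adding the excess at \<open>j\<close> makes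
  \<open>slack C D j\<close> appear on the right in both cases.\<close>

lemma linked_iff:
  assumes C: "admissible n C" and D: "admissible n D"
  shows "linked n C D \<longleftrightarrow> length D \<le> length C \<and>
    (\<forall>k < length D. right_column n C ! k \<le> left_column n D ! k)"
proof (cases "length D \<le> length C")
  case len: True
  let ?R = "right_column n C" and ?L = "left_column n D"
  note r = right_column_props[OF C] and l = left_column_props[OF D]
  define dC where "dC j = int (ct (set (split_ts n C)) j) - int (ct (set (split_zs C)) j)" for j
  define dD where "dD j = int (ct (set (split_ts n D)) j) - int (ct (set (split_zs D)) j)" for j
  have card: "card (set ?R) = length C" "card (set ?L) = length D"
    using r(1,2) l(1,2) by (auto simp: strict_sorted_iff distinct_card)
  have mC: "dC j \<le> x \<longleftrightarrow> (\<forall>m. j \<le> m \<and> m \<le> n \<longrightarrow> excess C m - excess C j \<le> x)" if "j \<le> n" for j x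
    using split_ts_props(6)[OF C, of j] split_ts_props(7)[OF C that] unfolding dC_def[symmetric]
    by (metis order_trans)
  have mD: "dD j \<le> x \<longleftrightarrow> (\<forall>m. j \<le> m \<and> m \<le> n \<longrightarrow> excess D m - excess D j \<le> x)" if "j \<le> n" for j x
    using split_ts_props(6)[OF D, of j] split_ts_props(7)[OF D that] unfolding dD_def[symmetric]
    by (metis order_trans)
  have "(\<forall>k < length D. ?R ! k \<le> ?L ! k) \<longleftrightarrow> (\<forall>y. card {x \<in> set ?L. x \<le> y} \<le> card {x \<in> set ?R. x \<le> y})"
    using rows_le_iff[OF r(1) l(1)] len r(2) l(2) by simp
  also have "\<dots> \<longleftrightarrow> (\<forall>j. ct (unb ?L) j \<le> ct (unb ?R) j \<and>
      card {x \<in> set ?L. x \<le> Bar (Suc j)} \<le> card {x \<in> set ?R. x \<le> Bar (Suc j)})" (is "?lhs \<longleftrightarrow> ?rhs")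
  proof
    assume ?lhs
    then have "card {x \<in> set ?L. x \<le> Unb j} \<le> card {x \<in> set ?R. x \<le> Unb j}"
      "card {x \<in> set ?L. x \<le> Bar (Suc j)} \<le> card {x \<in> set ?R. x \<le> Bar (Suc j)}" for j
      by blast+
    then show ?rhs by (simp add: card_letters_le(1))
  next
    assume rhs: ?rhs
    show ?lhs
    proof
      fix y
      show "card {x \<in> set ?L. x \<le> y} \<le> card {x \<in> set ?R. x \<le> y}"
      proof (cases y)
        case (Unb j)
        then show ?thesis using rhs by (simp add: card_letters_le(1))
      next
        case (Bar j)
        show ?thesis
        proof (cases j)
          case 0
          \<comment> \<open>The threshold \<open>Bar 0\<close> lies above every letter and only
            compares the heights.\<close>
          have "x \<le> Bar 0" for x by (cases x) auto
          then show ?thesis using len card by (simp add: Bar 0)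
        next
          case (Suc k)
          then show ?thesis using rhs Bar by blast
        qed
      qed
    qed
  qed
  also have "\<dots> \<longleftrightarrow> (\<forall>j \<le> n. ct (unb ?L) j \<le> ct (unb ?R) j \<and>
      card {x \<in> set ?L. x \<le> Bar (Suc j)} \<le> card {x \<in> set ?R. x \<le> Bar (Suc j)})" (is "?lhs \<longleftrightarrow> ?rhs")
  proof
    assume rhs: ?rhs
    show ?lhs
    proof
      fix j
      show "ct (unb ?L) j \<le> ct (unb ?R) j \<and>
        card {x \<in> set ?L. x \<le> Bar (Suc j)} \<le> card {x \<in> set ?R. x \<le> Bar (Suc j)}"
      proof (cases "j \<le> n")
        case False
        then have *: "ct (unb ?L) j = ct (unb ?L) n" "ct (bar ?L) j = ct (bar ?L) n"
          "ct (unb ?R) j = ct (unb ?R) n" "ct (bar ?R) j = ct (bar ?R) n"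
          using unb_bar_alphabet[OF r(3)] unb_bar_alphabet[OF l(3)] by (auto intro!: ct_bound)
        then have "card {x \<in> set ?L. x \<le> Bar (Suc j)} = card {x \<in> set ?L. x \<le> Bar (Suc n)}"
          "card {x \<in> set ?R. x \<le> Bar (Suc j)} = card {x \<in> set ?R. x \<le> Bar (Suc n)}"
          using card_letters_le(2)[of "?L"] card_letters_le(2)[of "?R"]
          by (metis List.finite_set add_right_cancel)+
        then show ?thesis using * rhs by simp
      qed (use rhs in simp)
    qed
  qed simp
  also have "\<dots> \<longleftrightarrow> (\<forall>j \<le> n.
      dD j \<le> int (ct (unb C) j) - int (ct (unb D) j) \<and>
      dC j \<le> int (length C) - int (length D) + int (ct (bar D) j) - int (ct (bar C) j))"
  proof -
    have "ct (unb ?L) j \<le> ct (unb ?R) j \<longleftrightarrow> dD j \<le> int (ct (unb C) j) - int (ct (unb D) j)" for j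
      using l(5)[of j] r(4) unfolding dD_def by simp linarith
    moreover have "card {x \<in> set ?L. x \<le> Bar (Suc j)} \<le> card {x \<in> set ?R. x \<le> Bar (Suc j)} \<longleftrightarrow>
      dC j \<le> int (length C) - int (length D) + int (ct (bar D) j) - int (ct (bar C) j)" for j
      using card_letters_le(2)[of "?L" j] card_letters_le(2)[of "?R" j] r(5)[of j] l(4) card
      unfolding dC_def by simp linarith
    ultimately show ?thesis by blast
  qed
  also have "\<dots> \<longleftrightarrow> (\<forall>j \<le> n. \<forall>m. j \<le> m \<and> m \<le> n \<longrightarrow> excess D m \<le> slack C D j \<and>
        excess C m + int (length D) - int (length C) \<le> slack C D j)"
  proof -
    have "dD j \<le> int (ct (unb C) j) - int (ct (unb D) j) \<longleftrightarrow>
        (\<forall>m. j \<le> m \<and> m \<le> n \<longrightarrow> excess D m \<le> slack C D j)" if "j \<le> n" for j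
      unfolding mD[OF that] by (simp add: slack_def excess_def algebra_simps)
    moreover have "dC j \<le> int (length C) - int (length D) + int (ct (bar D) j) - int (ct (bar C) j) \<longleftrightarrow>
        (\<forall>m. j \<le> m \<and> m \<le> n \<longrightarrow> excess C m + int (length D) - int (length C) \<le> slack C D j)" if "j \<le> n" for j
      unfolding mC[OF that] by (simp add: slack_def excess_def algebra_simps)
    ultimately show ?thesis by blast
  qed
  also have "\<dots> \<longleftrightarrow> linked n C D"
    using len unfolding linked_def by (meson order_trans)
  finally show ?thesis using len by simp
qed (simp add: linked_def)

section \<open>Operators on columns\<close>

text \<open>A window of two adjacent columns \<open>C\<close>, \<open>D\<close> around the colour \<open>i = k + 1\<close>: \<open>x\<close> is the excess of
  \<open>D\<close>, \<open>y\<close> the excess of \<open>C\<close> shifted by the difference of the heights, and \<open>g\<close> the slack. The flags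
  \<open>c1, c2, c3, c4\<close> (\<open>d1, d2, d3, d4\<close>) tell whether \<open>i, i + 1, Bar (i + 1), Bar i\<close> occur in \<open>C\<close> (\<open>D\<close>).
  The hypotheses on the flags in the lemmas below say that the operator of colour \<open>i\<close> acts on the
  column in question rather than on the other one.\<close>

locale pair_window =
  fixes x y g :: "nat \<Rightarrow> int" and k n :: nat and c1 c2 c3 c4 d1 d2 d3 d4 :: bool
  assumes n: "Suc (Suc k) \<le> n"
    and L: "\<And>j m. j \<le> m \<Longrightarrow> m \<le> n \<Longrightarrow> x m \<le> g j \<and> y m \<le> g j"
    and x: "x (Suc k) = x k + of_bool d1 + of_bool d4 - 1"
      "x (Suc (Suc k)) = x (Suc k) + of_bool d2 + of_bool d3 - 1"
    and y: "y (Suc k) = y k + of_bool c1 + of_bool c4 - 1"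
      "y (Suc (Suc k)) = y (Suc k) + of_bool c2 + of_bool c3 - 1"
    and g: "g (Suc k) = g k + of_bool c1 + of_bool d4 - 1"
      "g (Suc (Suc k)) = g (Suc k) + of_bool c2 + of_bool d3 - 1"
begin

lemma near:
  "x k \<le> g k" "y k \<le> g k" "x (Suc k) \<le> g k" "y (Suc k) \<le> g k"
  "x (Suc (Suc k)) \<le> g k" "y (Suc (Suc k)) \<le> g k" "x (Suc k) \<le> g (Suc k)" "y (Suc k) \<le> g (Suc k)"
  "x (Suc (Suc k)) \<le> g (Suc k)" "y (Suc (Suc k)) \<le> g (Suc k)"
  "x (Suc (Suc k)) \<le> g (Suc (Suc k))" "y (Suc (Suc k)) \<le> g (Suc (Suc k))"
  using L n by auto

lemma above:
  assumes "Suc k < m" "m \<le> n"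
  shows "x m \<le> g k" "y m \<le> g k" "x m \<le> g (Suc k)" "y m \<le> g (Suc k)"
    "x m \<le> g (Suc (Suc k))" "y m \<le> g (Suc (Suc k))"
  using L assms by auto

lemma below:
  assumes "j \<le> k"
  shows "x k \<le> g j" "y k \<le> g j" "x (Suc k) \<le> g j" "y (Suc k) \<le> g j"
    "x (Suc (Suc k)) \<le> g j" "y (Suc (Suc k)) \<le> g j"
  using L assms n by auto

text \<open>Either a lowering operator moves \<open>i\<close> to \<open>i + 1\<close> in
  \<open>C\<close> (\<open>\<delta> = 0\<close>, \<open>\<epsilon> = 1\<close>), or a raising
  operator moves \<open>Bar i\<close> to \<open>Bar (i + 1)\<close> in \<open>D\<close>
  (\<open>\<delta> = 1\<close>, \<open>\<epsilon> = 0\<close>). The slack drops at \<open>i\<close>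
  only, and the flags make the new value \<open>g i - 1\<close> equal to \<open>g (i - 1)\<close> or
  \<open>g (i + 1)\<close>, which settles \<open>m > i\<close>.\<close>

lemma lower_slack:
  assumes "c1 \<and> \<not> c2 \<and> (c3 \<or> \<not> c4) \<and> \<not> (d3 \<and> \<not> d4) \<and> (d1 \<and> \<not> d2 \<longrightarrow> d4 \<and> \<not> d3) \<and> \<delta> = 0 \<and> \<epsilon> = 1
    \<or> d4 \<and> \<not> d3 \<and> (d2 \<or> \<not> d1) \<and> \<not> (c2 \<and> \<not> c1) \<and> (c4 \<and> \<not> c3 \<longrightarrow> c1 \<and> \<not> c2) \<and> \<delta> = 1 \<and> \<epsilon> = 0"
    and "j \<le> m" "m \<le> n"
  shows "x m - (if m = Suc k then \<delta> else 0) \<le> g j - (if j = Suc k then 1 else 0)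
    \<and> y m - (if m = Suc k then \<epsilon> else 0) \<le> g j - (if j = Suc k then 1 else (0 :: int))"
proof -
  consider "j \<noteq> Suc k" | "j = Suc k" "m = Suc k" | "j = Suc k" "Suc k < m" using assms(2) by linarith
  then show ?thesis
  proof cases
    case 1
    then show ?thesis using L[OF assms(2,3)] assms(1) by auto
  next
    case 2
    then show ?thesis using near x y g assms(1) unfolding of_bool_def by (smt (verit))
  next
    case 3
    then show ?thesis using above[OF 3(2) assms(3)] x y g assms(1) unfolding of_bool_def by (smt (verit))
  qed
qed

text \<open>A lowering operator moves \<open>Bar (i + 1)\<close> to \<open>Bar i\<close> in
  \<open>C\<close>; in \<open>raise_x\<close> a raising operator moves \<open>i + 1\<close> to
  \<open>i\<close> in \<open>D\<close>. The slack stays, and the raised excess equals its value at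
  \<open>i - 1\<close> or \<open>i + 1\<close>, which settles \<open>j < i\<close>. The flags of the
  other column matter at \<open>j = m = i\<close>.\<close>

lemma raise_y:
  assumes "c3 \<and> \<not> c4 \<and> \<not> (c1 \<and> \<not> c2) \<and>
      (c2 \<and> \<not> c1 \<or> \<not> (d3 \<and> \<not> d4) \<and> (d1 \<and> \<not> d2 \<longrightarrow> d4 \<and> \<not> d3))"
    and "j \<le> m" "m \<le> n"
  shows "x m \<le> g j \<and> y m + (if m = Suc k then 1 else 0) \<le> g j"
proof -
  consider "m \<noteq> Suc k" | "j = Suc k" "m = Suc k" | "j \<le> k" "m = Suc k" using assms(2) by linarith
  then show ?thesis
  proof cases
    case 1
    then show ?thesis using L[OF assms(2,3)] by auto
  next
    case 2
    then show ?thesis using near x y g assms(1) unfolding of_bool_def by (smt (verit))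
  next
    case 3
    then show ?thesis using below[OF 3(1)] x y g assms(1) unfolding of_bool_def by (smt (verit))
  qed
qed

lemma raise_x:
  assumes "d2 \<and> \<not> d1 \<and> \<not> (d4 \<and> \<not> d3) \<and>
      (d3 \<and> \<not> d4 \<or> \<not> (c2 \<and> \<not> c1) \<and> (c4 \<and> \<not> c3 \<longrightarrow> c1 \<and> \<not> c2))"
    and "j \<le> m" "m \<le> n"
  shows "x m + (if m = Suc k then 1 else 0) \<le> g j \<and> y m \<le> g j"
proof -
  consider "m \<noteq> Suc k" | "j = Suc k" "m = Suc k" | "j \<le> k" "m = Suc k" using assms(2) by linarith
  then show ?thesis
  proof cases
    case 1
    then show ?thesis using L[OF assms(2,3)] by auto
  next
    case 2
    then show ?thesis using near x y g assms(1) unfolding of_bool_def by (smt (verit))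
  next
    case 3
    then show ?thesis using below[OF 3(1)] x y g assms(1) unfolding of_bool_def by (smt (verit))
  qed
qed

text \<open>A lowering operator moves \<open>Bar (i + 1)\<close> to \<open>Bar i\<close> in
  \<open>D\<close>; in \<open>raise_y_slack\<close> a raising operator moves \<open>i + 1\<close> to
  \<open>i\<close> in \<open>C\<close>. The slack rises along with the excess at \<open>i\<close>,
  so the critical pairs are \<open>j < i = m\<close>, where the raised excess again equals a
  neighbouring value.\<close>

lemma raise_x_slack:
  assumes "d3 \<and> \<not> d4 \<and> \<not> (d1 \<and> \<not> d2)" "j \<le> m" "m \<le> n"
  shows "x m + (if m = Suc k then 1 else 0) \<le> g j + (if j = Suc k then 1 else 0)
    \<and> y m \<le> g j + (if j = Suc k then 1 else 0)"
proof -
  consider "m \<noteq> Suc k \<or> j = Suc k" | "j \<le> k" "m = Suc k" using assms(2) by linarith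
  then show ?thesis
  proof cases
    case 1
    then show ?thesis using L[OF assms(2,3)] by auto
  next
    case 2
    then show ?thesis using below[OF 2(1)] x y g assms(1) unfolding of_bool_def by (smt (verit))
  qed
qed

lemma raise_y_slack:
  assumes "c2 \<and> \<not> c1 \<and> \<not> (c4 \<and> \<not> c3)" "j \<le> m" "m \<le> n"
  shows "x m \<le> g j + (if j = Suc k then 1 else 0)
    \<and> y m + (if m = Suc k then 1 else 0) \<le> g j + (if j = Suc k then 1 else 0)"
proof -
  consider "m \<noteq> Suc k \<or> j = Suc k" | "j \<le> k" "m = Suc k" using assms(2) by linarith
  then show ?thesis
  proof cases
    case 1
    then show ?thesis using L[OF assms(2,3)] by auto
  next
    case 2
    then show ?thesis using below[OF 2(1)] x y g assms(1) unfolding of_bool_def by (smt (verit))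
  qed
qed

end


text \<open>Colour \<open>n\<close> exchanges \<open>n\<close> and \<open>Bar n\<close> in one
  column and changes no excess; the slack can drop at \<open>n\<close> only, so
  \<open>j = m = n\<close> is the critical pair. The hypothesis \<open>x n = y n\<close> holds
  because the excess at \<open>n\<close> is the height minus \<open>n\<close>.\<close>

lemma lower_slack_last:
  fixes x y g :: "nat \<Rightarrow> int" and c1 c4 d1 d4 :: bool
  assumes L: "\<And>j m. j \<le> m \<Longrightarrow> m \<le> n \<Longrightarrow> x m \<le> g j \<and> y m \<le> g j" and "k \<le> n"
    and "x n = x k + of_bool d1 + of_bool d4 - 1" "y n = y k + of_bool c1 + of_bool c4 - 1"
      "g n = g k + of_bool c1 + of_bool d4 - 1" "x n = y n"
    and "c1 \<and> \<not> c4 \<and> \<not> (d1 \<and> \<not> d4) \<or> d4 \<and> \<not> d1 \<and> \<not> (c4 \<and> \<not> c1)"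
    and "j \<le> m" "m \<le> n"
  shows "x m \<le> g j - (if j = n then 1 else 0) \<and> y m \<le> g j - (if j = n then 1 else (0 :: int))"
proof (cases "j = n")
  case True
  then have "m = n" using assms(8,9) by simp
  moreover have "x k \<le> g k" "y k \<le> g k" "x n \<le> g k" "y n \<le> g n" using L assms(2) by auto
  ultimately show ?thesis using True assms(3-7) unfolding of_bool_def by (smt (verit))
qed (use L[OF assms(8,9)] in simp)

lemma less_letter_simps [simp]:
  "Unb i < Unb j \<longleftrightarrow> i < j" "Unb i < Bar j" "\<not> Bar i < Unb j" "Bar i < Bar j \<longleftrightarrow> j < i"
  by (auto simp: less_letter_def)

definition opt :: "bool \<Rightarrow> 'a \<Rightarrow> 'a list" where
  "opt p x = (if p then [x] else [])"

text \<open>Sortedness is provided for all sixteen choices of the four flags, so the result of an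
  operator is seen to be a column at once.\<close>

lemma sorted_column_split:
  assumes "sorted_wrt (<) C"
  obtains a b c where
    "\<And>x. x \<in> set a \<union> set b \<union> set c \<Longrightarrow> x \<notin> {Unb i, Unb (Suc i), Bar (Suc i), Bar i}"
    "\<And>p q r s. sorted_wrt (<) (a @ opt p (Unb i) @ opt q (Unb (Suc i)) @ b @ opt r (Bar (Suc i)) @ opt s (Bar i) @ c)"
    "C = a @ opt (Unb i \<in> set C) (Unb i) @ opt (Unb (Suc i) \<in> set C) (Unb (Suc i)) @ b
      @ opt (Bar (Suc i) \<in> set C) (Bar (Suc i)) @ opt (Bar i \<in> set C) (Bar i) @ c"
proof
  let ?a = "filter (\<lambda>x. x < Unb i) C" and ?b = "filter (\<lambda>x. Unb (Suc i) < x \<and> x < Bar (Suc i)) C"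
    and ?c = "filter (\<lambda>x. Bar i < x) C"
  show "x \<notin> {Unb i, Unb (Suc i), Bar (Suc i), Bar i}" if "x \<in> set ?a \<union> set ?b \<union> set ?c" for x
    using that by auto
  have flt: "sorted_wrt (<) (filter P C)" for P using assms by (simp add: sorted_wrt_filter)
  have tr: "x < Unb i \<Longrightarrow> x < Unb (Suc i)" "Bar i < x \<Longrightarrow> Bar (Suc i) < x" "Bar i < x \<Longrightarrow> Unb j < x"
    "x < Unb i \<Longrightarrow> x < Bar j" "x < Unb i \<Longrightarrow> Unb (Suc i) < y \<Longrightarrow> x < y" "x < Unb i \<Longrightarrow> Bar i < y \<Longrightarrow> x < y"
    "Unb (Suc i) < x \<Longrightarrow> Unb i < x" "x < Bar (Suc i) \<Longrightarrow> x < Bar i" "x < Bar (Suc i) \<Longrightarrow> Bar i < y \<Longrightarrow> x < y" for x y j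
    by (cases x; cases y; auto)+
  show sorted: "sorted_wrt (<) (?a @ opt p (Unb i) @ opt q (Unb (Suc i)) @ ?b @ opt r (Bar (Suc i)) @ opt s (Bar i) @ ?c)"
    for p q r s
    by (cases p; cases q; cases r; cases s) (auto simp: opt_def sorted_wrt_append flt intro: tr)
  show "C = ?a @ opt (Unb i \<in> set C) (Unb i) @ opt (Unb (Suc i) \<in> set C) (Unb (Suc i)) @ ?b
      @ opt (Bar (Suc i) \<in> set C) (Bar (Suc i)) @ opt (Bar i \<in> set C) (Bar i) @ ?c" (is "C = ?W")
  proof (rule strict_sorted_equal[OF sorted assms])
    have "x \<in> set C \<longleftrightarrow> x \<in> set ?W" for x
    proof (cases x)
      case (Unb k)
      consider "k < i" | "k = i" | "k = Suc i" | "Suc i < k" by linarith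
      then show ?thesis by cases (auto simp: Unb opt_def)
    next
      case (Bar k)
      consider "k < i" | "k = i" | "k = Suc i" | "Suc i < k" by linarith
      then show ?thesis by cases (auto simp: Bar opt_def)
    qed
    then show "set C = set ?W" by blast
  qed
qed

lemma sorted_column_split_last:
  assumes "sorted_wrt (<) C" "set C \<subseteq> alphabet n"
  obtains a c where
    "\<And>x. x \<in> set a \<union> set c \<Longrightarrow> x \<notin> {Unb n, Bar n}"
    "\<And>p s. sorted_wrt (<) (a @ opt p (Unb n) @ opt s (Bar n) @ c)"
    "C = a @ opt (Unb n \<in> set C) (Unb n) @ opt (Bar n \<in> set C) (Bar n) @ c"
proof
  let ?a = "filter (\<lambda>x. x < Unb n) C" and ?c = "filter (\<lambda>x. Bar n < x) C"
  show "x \<notin> {Unb n, Bar n}" if "x \<in> set ?a \<union> set ?c" for x using that by auto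
  have flt: "sorted_wrt (<) (filter P C)" for P using assms by (simp add: sorted_wrt_filter)
  have tr: "Bar n < x \<Longrightarrow> Unb j < x" "x < Unb n \<Longrightarrow> x < Bar j" "x < Unb n \<Longrightarrow> Bar n < y \<Longrightarrow> x < y" for x y j
    by (cases x; cases y; auto)+
  show sorted: "sorted_wrt (<) (?a @ opt p (Unb n) @ opt s (Bar n) @ ?c)" for p s
    by (cases p; cases s) (auto simp: opt_def sorted_wrt_append flt intro: tr)
  show "C = ?a @ opt (Unb n \<in> set C) (Unb n) @ opt (Bar n \<in> set C) (Bar n) @ ?c" (is "C = ?W")
  proof (rule strict_sorted_equal[OF sorted assms(1)])
    have "x \<in> set C \<longleftrightarrow> x \<in> set ?W" for x
      using subsetD[OF assms(2), of x] by (cases x) (auto simp: opt_def alphabet_def le_less)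
    then show "set C = set ?W" by blast
  qed
qed

lemma ct_zero_eq: "ct X 0 = of_bool (0 \<in> X)"
proof -
  have "{i \<in> X. i \<le> 0} = (if 0 \<in> X then {0} else {})" by auto
  then show ?thesis by (simp add: ct_def)
qed

lemma ct_move_up:
  assumes "i \<in> X" "Suc i \<notin> X"
  shows "int (ct (insert (Suc i) (X - {i})) j) = int (ct X j) - (if j = i then 1 else 0)"
  by (induction j) (use assms in \<open>auto simp: ct_zero_eq ct_Suc\<close>)

lemma ct_move_down:
  assumes "Suc i \<in> X" "i \<notin> X"
  shows "int (ct (insert i (X - {Suc i})) j) = int (ct X j) + (if j = i then 1 else 0)"
  by (induction j) (use assms in \<open>auto simp: ct_zero_eq ct_Suc\<close>)

lemma ct_delete: "i \<in> X \<Longrightarrow> int (ct (X - {i}) j) = int (ct X j) - (if i \<le> j then 1 else 0)"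
  by (induction j) (auto simp: ct_zero_eq ct_Suc le_Suc_eq)

lemma ct_insert: "i \<notin> X \<Longrightarrow> int (ct (insert i X) j) = int (ct X j) + (if i \<le> j then 1 else 0)"
  by (induction j) (auto simp: ct_zero_eq ct_Suc le_Suc_eq)

context sp_words
begin

lemma neutral:
  assumes "\<And>x. x \<in> set a \<Longrightarrow> x \<notin> {Unb i, Unb (Suc i), Bar (Suc i), Bar i}"
  shows "eps i a = 0 \<and> phi i a = 0"
  using assms by (induction a) (auto simp: ph_sp ep_sp)

lemma neutral_last:
  assumes "\<And>x. x \<in> set a \<Longrightarrow> x \<notin> {Unb n, Bar n}"
  shows "eps n a = 0 \<and> phi n a = 0"
  using assms by (induction a) (auto simp: ph_sp ep_sp)

lemma opt_eps_phi:
  assumes "1 \<le> i" "i < n"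
  shows "eps i (opt p (Unb i)) = 0" "phi i (opt p (Unb i)) = of_bool p"
    "eps i (opt p (Unb (Suc i))) = of_bool p" "phi i (opt p (Unb (Suc i))) = 0"
    "eps i (opt p (Bar (Suc i))) = 0" "phi i (opt p (Bar (Suc i))) = of_bool p"
    "eps i (opt p (Bar i)) = of_bool p" "phi i (opt p (Bar i)) = 0"
  using assms by (auto simp: opt_def ph_sp ep_sp)

text \<open>The four letters on which colour \<open>i < n\<close> acts occur in a column in the order
  \<open>i, i + 1, Bar (i + 1), Bar i\<close>, with signs \<open>+ - + -\<close>.\<close>

lemma column_signs:
  assumes "sorted_wrt (<) C" "1 \<le> i" "i < n"
  defines "p \<equiv> i \<in> unb C" and "q \<equiv> Suc i \<in> unb C"
    and "r \<equiv> Suc i \<in> bar C" and "s \<equiv> i \<in> bar C"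
  shows "eps i C = of_bool (q \<and> \<not> p) + (of_bool (s \<and> \<not> r) - of_bool (p \<and> \<not> q))"
    and "phi i C = of_bool (r \<and> \<not> s) + (of_bool (p \<and> \<not> q) - of_bool (s \<and> \<not> r))"
    and "fw i C = Some C' \<Longrightarrow> sorted_wrt (<) C' \<and>
      (p \<and> \<not> q \<and> \<not> (s \<and> \<not> r) \<and> unb C' = insert (Suc i) (unb C - {i}) \<and> bar C' = bar C \<or>
       r \<and> \<not> s \<and> \<not> (p \<and> \<not> q) \<and> unb C' = unb C \<and> bar C' = insert i (bar C - {Suc i}))"
      (is "_ \<Longrightarrow> ?Qf")
    and "ew i C = Some C' \<Longrightarrow> sorted_wrt (<) C' \<and>
      (q \<and> \<not> p \<and> \<not> (s \<and> \<not> r) \<and> unb C' = insert i (unb C - {Suc i}) \<and> bar C' = bar C \<or>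
       s \<and> \<not> r \<and> \<not> (p \<and> \<not> q) \<and> unb C' = unb C \<and> bar C' = insert (Suc i) (bar C - {i}))"
      (is "_ \<Longrightarrow> ?Qe")
proof -
  obtain a b c where n: "\<And>x. x \<in> set a \<union> set b \<union> set c \<Longrightarrow> x \<notin> {Unb i, Unb (Suc i), Bar (Suc i), Bar i}"
    and so: "\<And>p q r s. sorted_wrt (<) (a @ opt p (Unb i) @ opt q (Unb (Suc i)) @ b @ opt r (Bar (Suc i)) @ opt s (Bar i) @ c)"
    and C: "C = a @ opt (Unb i \<in> set C) (Unb i) @ opt (Unb (Suc i) \<in> set C) (Unb (Suc i)) @ b
      @ opt (Bar (Suc i) \<in> set C) (Bar (Suc i)) @ opt (Bar i \<in> set C) (Bar i) @ c"
    using sorted_column_split[OF assms(1), of i] by blast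
  define W where "W p q r s = a @ opt p (Unb i) @ opt q (Unb (Suc i)) @ b @ opt r (Bar (Suc i)) @ opt s (Bar i) @ c"
    for p q r s
  have C: "C = W p q r s" using C by (simp add: W_def p_def q_def r_def s_def unb_def bar_def)
  have z: "eps i a = 0" "phi i a = 0" "eps i b = 0" "phi i b = 0" "eps i c = 0" "phi i c = 0"
    using neutral[of a i] neutral[of b i] neutral[of c i] n by auto
  have za: "fw i a = None" "fw i b = None" "fw i c = None" "ew i a = None" "ew i b = None" "ew i c = None"
    using z by (auto simp: fw_None_iff ew_None_iff)
  note o = opt_eps_phi[OF assms(2,3)]
  show "eps i C = of_bool (q \<and> \<not> p) + (of_bool (s \<and> \<not> r) - of_bool (p \<and> \<not> q))"
    unfolding C W_def by (cases p; cases q; cases r; cases s) (simp_all add: eps_append phi_append z o)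
  show "phi i C = of_bool (r \<and> \<not> s) + (of_bool (p \<and> \<not> q) - of_bool (s \<and> \<not> r))"
    unfolding C W_def by (cases p; cases q; cases r; cases s) (simp_all add: eps_append phi_append z o)
  have f1: "fw i (opt True (Unb i)) = Some (opt True (Unb (Suc i)))"
    "fw i (opt True (Bar (Suc i))) = Some (opt True (Bar i))"
    "ew i (opt True (Unb (Suc i))) = Some (opt True (Unb i))"
    "ew i (opt True (Bar i)) = Some (opt True (Bar (Suc i)))"
    using assms(2,3) by (auto simp: opt_def ph_sp ep_sp sp_f_def f_letter_def sp_e_def e_letter_def)
  have oF: "opt False x = []" for x :: letter by (simp add: opt_def)
  have fW: "fw i (W p q r s) = (if p \<and> \<not> q \<and> (r \<or> \<not> s) then Some (W False True r s)
      else if r \<and> \<not> s \<and> \<not> (p \<and> \<not> q) then Some (W p q False True) else None)"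
    unfolding W_def by (cases p; cases q; cases r; cases s) (simp_all add: fw_append eps_append phi_append z za o f1 oF)
  have eW: "ew i (W p q r s) = (if q \<and> \<not> p \<and> (r \<or> \<not> s) then Some (W True False r s)
      else if s \<and> \<not> r \<and> \<not> (p \<and> \<not> q) then Some (W p q True False) else None)"
    unfolding W_def by (cases p; cases q; cases r; cases s) (simp_all add: ew_append eps_append phi_append z za o f1 oF)
  have uW: "unb (W p' q' r' s') = unb (a @ b @ c) \<union> {j. p' \<and> j = i \<or> q' \<and> j = Suc i}"
    and bW: "bar (W p' q' r' s') = bar (a @ b @ c) \<union> {j. r' \<and> j = Suc i \<or> s' \<and> j = i}"
    for p' q' r' s' by (auto simp: W_def opt_def unb_def bar_def)
  have nn: "i \<notin> unb (a @ b @ c)" "Suc i \<notin> unb (a @ b @ c)"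
    "i \<notin> bar (a @ b @ c)" "Suc i \<notin> bar (a @ b @ c)"
    using n by (auto simp: unb_def bar_def)
  have so': "sorted_wrt (<) (W p' q' r' s')" for p' q' r' s' using so by (simp add: W_def)
  show "fw i C = Some C' \<Longrightarrow> ?Qf"
    unfolding C fW using so' nn by (auto simp: uW bW split: if_splits)
  show "ew i C = Some C' \<Longrightarrow> ?Qe"
    unfolding C eW using so' nn by (auto simp: uW bW split: if_splits)
qed

lemma column_signs_last:
  assumes "sorted_wrt (<) C" "set C \<subseteq> alphabet n"
  defines "p \<equiv> n \<in> unb C" and "s \<equiv> n \<in> bar C"
  shows "eps n C = of_bool (s \<and> \<not> p)" and "phi n C = of_bool (p \<and> \<not> s)"
    and "fw n C = Some C' \<Longrightarrow> sorted_wrt (<) C' \<and> p \<and> \<not> s \<and> unb C' = unb C - {n} \<and> bar C' = insert n (bar C)"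
    and "ew n C = Some C' \<Longrightarrow> sorted_wrt (<) C' \<and> s \<and> \<not> p \<and> unb C' = insert n (unb C) \<and> bar C' = bar C - {n}"
proof -
  obtain a c where n: "\<And>x. x \<in> set a \<union> set c \<Longrightarrow> x \<notin> {Unb n, Bar n}"
    and so: "\<And>p s. sorted_wrt (<) (a @ opt p (Unb n) @ opt s (Bar n) @ c)"
    and C: "C = a @ opt (Unb n \<in> set C) (Unb n) @ opt (Bar n \<in> set C) (Bar n) @ c"
    using sorted_column_split_last[OF assms(1,2)] by blast
  define W where "W p s = a @ opt p (Unb n) @ opt s (Bar n) @ c" for p s
  have C: "C = W p s" using C by (simp add: W_def p_def s_def unb_def bar_def)
  have z: "eps n a = 0" "phi n a = 0" "eps n c = 0" "phi n c = 0"
    using neutral_last[of a] neutral_last[of c] n by auto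
  have za: "fw n a = None" "fw n c = None" "ew n a = None" "ew n c = None"
    using z by (auto simp: fw_None_iff ew_None_iff)
  have o: "eps n (opt p (Unb n)) = 0" "phi n (opt p (Unb n)) = of_bool p"
    "eps n (opt p (Bar n)) = of_bool p" "phi n (opt p (Bar n)) = 0" for p
    using n_pos by (auto simp: opt_def ph_sp ep_sp)
  show "eps n C = of_bool (s \<and> \<not> p)" "phi n C = of_bool (p \<and> \<not> s)"
    unfolding C W_def by (cases p; cases s; simp add: eps_append phi_append z o)+
  have f1: "fw n (opt True (Unb n)) = Some (opt True (Bar n))"
    "ew n (opt True (Bar n)) = Some (opt True (Unb n))"
    using n_pos by (auto simp: opt_def ph_sp ep_sp sp_f_def f_letter_def sp_e_def e_letter_def)
  have oF: "opt False x = []" for x :: letter by (simp add: opt_def)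
  have fW: "fw n (W p s) = (if p \<and> \<not> s then Some (W False True) else None)"
    unfolding W_def by (cases p; cases s) (simp_all add: fw_append eps_append phi_append z za o f1 oF)
  have eW: "ew n (W p s) = (if s \<and> \<not> p then Some (W True False) else None)"
    unfolding W_def by (cases p; cases s) (simp_all add: ew_append eps_append phi_append z za o f1 oF)
  have uW: "unb (W p' s') = unb (a @ c) \<union> {j. p' \<and> j = n}"
    and bW: "bar (W p' s') = bar (a @ c) \<union> {j. s' \<and> j = n}"
    for p' s' by (auto simp: W_def opt_def unb_def bar_def)
  have nn: "n \<notin> unb (a @ c)" "n \<notin> bar (a @ c)"
    using n by (auto simp: unb_def bar_def)
  have so': "sorted_wrt (<) (W p' s')" for p' s' using so by (simp add: W_def)
  show "fw n C = Some C' \<Longrightarrow> sorted_wrt (<) C' \<and> p \<and> \<not> s \<and> unb C' = unb C - {n} \<and> bar C' = insert n (bar C)"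
    unfolding C fW using so' nn by (auto simp: uW bW split: if_splits)
  show "ew n C = Some C' \<Longrightarrow> sorted_wrt (<) C' \<and> s \<and> \<not> p \<and> unb C' = insert n (unb C) \<and> bar C' = bar C - {n}"
    unfolding C eW using so' nn by (auto simp: uW bW split: if_splits)
qed

end

section \<open>Stability of the row condition\<close>

lemma excess_Suc:
  "excess C (Suc m) = excess C m + of_bool (Suc m \<in> unb C) + of_bool (Suc m \<in> bar C) - 1"
  by (simp add: excess_def ct_Suc)

lemma slack_Suc:
  "slack C D (Suc j) = slack C D j + of_bool (Suc j \<in> unb C) + of_bool (Suc j \<in> bar D) - 1"
  by (simp add: slack_def ct_Suc)

lemma pair_window_linked:
  assumes "linked n C D" "Suc (Suc k) \<le> n"
  shows "pair_window (excess D) (\<lambda>m. excess C m + int (length D) - int (length C)) (slack C D) k n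
    (Suc k \<in> unb C) (Suc (Suc k) \<in> unb C) (Suc (Suc k) \<in> bar C) (Suc k \<in> bar C)
    (Suc k \<in> unb D) (Suc (Suc k) \<in> unb D) (Suc (Suc k) \<in> bar D) (Suc k \<in> bar D)"
  by unfold_locales (use assms in \<open>auto simp: linked_def excess_Suc slack_Suc\<close>)

lemma linkedI:
  assumes "length D \<le> length C"
    and "\<And>j m. j \<le> m \<Longrightarrow> m \<le> n \<Longrightarrow> excess D m \<le> slack C D j \<and>
        excess C m + int (length D) - int (length C) \<le> slack C D j"
  shows "linked n C D"
  using assms by (simp add: linked_def)

lemma linkedD:
  assumes "linked n C D" "j \<le> m" "m \<le> n"
  shows "excess D m \<le> slack C D j \<and>
        excess C m + int (length D) - int (length C) \<le> slack C D j"
  using assms by (simp add: linked_def)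

lemma excess_full:
  assumes "set C \<subseteq> alphabet n" "sorted_wrt (<) C"
  shows "excess C n = int (length C) - int n"
proof -
  have "ct (unb C) n = card (unb C)" "ct (bar C) n = card (bar C)"
    using unb_bar_alphabet[OF assms(1)] by (auto intro!: ct_card)
  then show ?thesis
    using card_unb_bar[of C] assms(2) by (simp add: excess_def strict_sorted_iff distinct_card)
qed

lemma pair_window_last:
  assumes "admissible n C" "admissible n D" "n = Suc k"
  shows "excess D n = excess D k + of_bool (n \<in> unb D) + of_bool (n \<in> bar D) - 1"
    "excess C n + int (length D) - int (length C) =
      excess C k + int (length D) - int (length C) + of_bool (n \<in> unb C) + of_bool (n \<in> bar C) - 1"
    "slack C D n = slack C D k + of_bool (n \<in> unb C) + of_bool (n \<in> bar D) - 1"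
    "excess D n = excess C n + int (length D) - int (length C)"
proof -
  show "excess D n = excess C n + int (length D) - int (length C)"
    using assms(1,2) by (simp add: excess_full admissible_def)
qed (simp_all add: assms(3) excess_Suc slack_Suc)

context sp_words
begin

lemma length_ew: "ew i w = Some w' \<Longrightarrow> length w' = length w"
  using fw_ew length_fw by metis

lemma fw_colour: "fw i w = Some w' \<Longrightarrow> 1 \<le> i \<and> i \<le> n"
  using fw_outside by fastforce

lemma ew_colour: "ew i w = Some w' \<Longrightarrow> 1 \<le> i \<and> i \<le> n"
  using fw_colour fw_ew by blast

lemma colour_cases:
  assumes "1 \<le> i" "i \<le> n"
  obtains k where "i = Suc k" "Suc (Suc k) \<le> n" | k where "i = n" "n = Suc k"
proof -
  obtain k where k: "i = Suc k" using assms(1) by (cases i) auto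
  show ?thesis
  proof (cases "i = n")
    case True
    then show ?thesis using k by (intro that(2)[of k]) auto
  next
    case False
    then show ?thesis using k assms(2) by (intro that(1)[of k]) auto
  qed
qed

text \<open>A colour \<open>i < n\<close> changes the excess at \<open>i\<close> only. When it
  rises, the other letters of colour \<open>i\<close> make the new value equal to the old excess at
  \<open>i - 1\<close> or \<open>i + 1\<close>, which is not positive. Colour \<open>n\<close>
  preserves the excess.\<close>

lemma admissible_op:
  assumes C: "admissible n C" and g: "g = fw i \<or> g = ew i" and f: "g C = Some C'"
  shows "admissible n C'"
proof -
  have al: "set C \<subseteq> alphabet n" and so: "sorted_wrt (<) C" and ex: "\<And>m. m \<le> n \<Longrightarrow> excess C m \<le> 0"
    using C by (auto simp: admissible_iff)
  have al': "set C' \<subseteq> alphabet n" using g f fw_alphabet ew_alphabet al by blast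
  have i: "1 \<le> i" "i \<le> n" using g f fw_colour ew_colour by blast+
  from i show ?thesis
  proof (cases rule: colour_cases)
    case (1 k)
    have "i < n" using 1 by simp
    note s = column_signs(3,4)[OF so i(1) this, of C']
    have ex3: "excess C k \<le> 0" "excess C i \<le> 0" "excess C (Suc i) \<le> 0"
      using ex 1 by auto
    have step: "excess C i = excess C k + of_bool (i \<in> unb C) + of_bool (i \<in> bar C) - 1"
      "excess C (Suc i) = excess C i + of_bool (Suc i \<in> unb C) + of_bool (Suc i \<in> bar C) - 1"
      unfolding 1(1) by (rule excess_Suc)+
    have "excess C' m \<le> excess C m \<or> m = i \<and> excess C' m \<le> 0" for m
      using g
    proof
      assume "g = fw i"
      then have "fw i C = Some C'" using f by simp
      from s(1)[OF this] show ?thesis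
        by (elim conjE disjE; use ex3 step in
            \<open>simp add: excess_def[of C'] ct_move_up ct_move_down of_bool_def split: if_splits\<close>)
          (auto simp: excess_def)
    next
      assume "g = ew i"
      then have "ew i C = Some C'" using f by simp
      from s(2)[OF this] show ?thesis
        by (elim conjE disjE; use ex3 step in
            \<open>simp add: excess_def[of C'] ct_move_up ct_move_down of_bool_def split: if_splits\<close>)
          (auto simp: excess_def)
    qed
    then have "excess C' m \<le> 0" if "m \<le> n" for m using ex[OF that] by (meson order_trans)
    moreover have "sorted_wrt (<) C'" using g f s by blast
    ultimately show ?thesis using al' by (simp add: admissible_iff)
  next
    case (2 k)
    note s = column_signs_last(3,4)[OF so al, of C']
    have "sorted_wrt (<) C' \<and> excess C' m = excess C m" for m
      using g f 2(1) s by (auto simp: excess_def ct_delete ct_insert)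
    then show ?thesis using ex al' by (simp add: admissible_iff)
  qed
qed

context
  fixes C D
  assumes C: "admissible n C" and D: "admissible n D" and l: "linked n C D"
begin

lemma pair_alphabet: "set C \<subseteq> alphabet n" "set D \<subseteq> alphabet n"
  and pair_sorted: "sorted_wrt (<) C" "sorted_wrt (<) D"
  and pair_length: "length D \<le> length C"
  using C D l by (auto simp: admissible_iff linked_def)

text \<open>The pair is read as \<open>D @ C\<close>, and \<open>act\<close> is the condition of the
  tensor product rule for acting on \<open>C\<close>. Expressed through the signs of the columns it
  supplies the flag hypotheses of \<open>pair_window\<close>.\<close>

lemma linked_fw_left:
  assumes f: "fw i C = Some C'" and act: "phi i D \<le> eps i C"
  shows "linked n C' D"
proof -
  have len: "length C' = length C" using length_fw[OF f] .
  have i: "1 \<le> i" "i \<le> n" using fw_colour[OF f] by auto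
  from i show ?thesis
  proof (cases rule: colour_cases)
    case (1 k)
    note W = pair_window_linked[OF l 1(2), folded 1(1)]
    have "i < n" using 1 by simp
    note sC = column_signs[OF pair_sorted(1) i(1) this] and sD = column_signs[OF pair_sorted(2) i(1) this]
    show ?thesis
    proof (rule linkedI)
      fix j m assume jm: "j \<le> m" "m \<le> n"
      show "excess D m \<le> slack C' D j \<and>
        excess C' m + int (length D) - int (length C') \<le> slack C' D j"
        using sC(3)[OF f]
      proof (elim conjE disjE, goal_cases)
        case 1
        have "excess C' m = excess C m - (if m = i then 1 else 0)"
          "slack C' D j = slack C D j - (if j = i then 1 else 0)"
          using 1 by (simp_all add: excess_def slack_def ct_move_up)
        moreover note pair_window.lower_slack[OF W, of 0 1, OF _ jm]
        ultimately show ?case using 1 act \<open>i = Suc k\<close> unfolding sC(1,2) sD(1,2) len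
          by (auto simp: of_bool_def split: if_splits)
      next
        case 2
        have "excess C' m = excess C m + (if m = i then 1 else 0)"
          "slack C' D j = slack C D j"
          using 2 by (simp_all add: excess_def slack_def ct_move_down)
        moreover note pair_window.raise_y[OF W, OF _ jm]
        ultimately show ?case using 2 act \<open>i = Suc k\<close> unfolding sC(1,2) sD(1,2) len
          by (auto simp: of_bool_def split: if_splits)
      qed
    qed (use pair_length len in simp)
  next
    case (2 k)
    have f': "fw n C = Some C'" using f 2 by simp
    note sC = column_signs_last[OF pair_sorted(1) pair_alphabet(1)] and sD = column_signs_last[OF pair_sorted(2) pair_alphabet(2)]
    note last = pair_window_last[OF C D 2(2)]
    have kn: "k \<le> n" using 2 by simp
    have act': "phi n D \<le> eps n C" using act 2 by simp
    show ?thesis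
    proof (rule linkedI)
      fix j m assume jm: "j \<le> m" "m \<le> n"
      have e: "excess C' m = excess C m" for m
        using sC(3)[OF f'] by (simp add: excess_def ct_delete ct_insert)
      have cu: "slack C' D j = slack C D j - (if j = n then 1 else 0)"
        using sC(3)[OF f'] jm by (simp add: slack_def ct_delete ct_insert)
      show "excess D m \<le> slack C' D j \<and>
        excess C' m + int (length D) - int (length C') \<le> slack C' D j"
        using lower_slack_last[where x = "excess D" and g = "slack C D" and
            y = "\<lambda>m. excess C m + int (length D) - int (length C)",
            OF linkedD[OF l] kn last _ jm] act'
        unfolding e cu len sC(1,2) sD(1,2) using sC(3)[OF f'] by (auto split: if_splits)
    qed (use pair_length len in simp)
  qed
qed

text \<open>The slack sees only the barred letters of \<open>D\<close>: moving an unbarred letter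
  just lowers the excess of \<open>D\<close>, moving a barred one raises excess and slack
  together.\<close>

lemma linked_fw_right:
  assumes f: "fw i D = Some D'" and act: "eps i C < phi i D"
  shows "linked n C D'"
proof -
  have len: "length D' = length D" using length_fw[OF f] .
  have i: "1 \<le> i" "i \<le> n" using fw_colour[OF f] by auto
  from i show ?thesis
  proof (cases rule: colour_cases)
    case (1 k)
    note W = pair_window_linked[OF l 1(2), folded 1(1)]
    have "i < n" using 1 by simp
    note sC = column_signs[OF pair_sorted(1) i(1) this] and sD = column_signs[OF pair_sorted(2) i(1) this]
    show ?thesis
    proof (rule linkedI)
      fix j m assume jm: "j \<le> m" "m \<le> n"
      show "excess D' m \<le> slack C D' j \<and>
        excess C m + int (length D') - int (length C) \<le> slack C D' j"
        using sD(3)[OF f]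
      proof (elim conjE disjE, goal_cases)
        case 1
        have "excess D' m = excess D m - (if m = i then 1 else 0)"
          "slack C D' j = slack C D j"
          using 1 by (simp_all add: excess_def slack_def ct_move_up)
        moreover note linkedD[OF l jm]
        ultimately show ?case using 1 act \<open>i = Suc k\<close> unfolding sC(1,2) sD(1,2) len
          by (auto simp: of_bool_def split: if_splits)
      next
        case 2
        have "excess D' m = excess D m + (if m = i then 1 else 0)"
          "slack C D' j = slack C D j + (if j = i then 1 else 0)"
          using 2 by (simp_all add: excess_def slack_def ct_move_down)
        moreover note pair_window.raise_x_slack[OF W, OF _ jm]
        ultimately show ?case using 2 act \<open>i = Suc k\<close> unfolding sC(1,2) sD(1,2) len
          by (auto simp: of_bool_def split: if_splits)
      qed
    qed (use pair_length len in simp)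
  next
    case (2 k)
    have f': "fw n D = Some D'" using f 2 by simp
    note sC = column_signs_last[OF pair_sorted(1) pair_alphabet(1)] and sD = column_signs_last[OF pair_sorted(2) pair_alphabet(2)]
    show ?thesis
    proof (rule linkedI)
      fix j m assume jm: "j \<le> m" "m \<le> n"
      have e: "excess D' m = excess D m" for m
        using sD(3)[OF f'] by (simp add: excess_def ct_delete ct_insert)
      have cu: "slack C D' j = slack C D j + (if j = n then 1 else 0)"
        using sD(3)[OF f'] jm by (simp add: slack_def ct_delete ct_insert)
      show "excess D' m \<le> slack C D' j \<and>
        excess C m + int (length D') - int (length C) \<le> slack C D' j"
        using linkedD[OF l jm] unfolding e cu len by auto
    qed (use pair_length len in simp)
  qed
qed

lemma linked_ew_left:
  assumes f: "ew i C = Some C'" and act: "phi i D < eps i C"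
  shows "linked n C' D"
proof -
  have len: "length C' = length C" using length_ew[OF f] .
  have i: "1 \<le> i" "i \<le> n" using ew_colour[OF f] by auto
  from i show ?thesis
  proof (cases rule: colour_cases)
    case (1 k)
    note W = pair_window_linked[OF l 1(2), folded 1(1)]
    have "i < n" using 1 by simp
    note sC = column_signs[OF pair_sorted(1) i(1) this] and sD = column_signs[OF pair_sorted(2) i(1) this]
    show ?thesis
    proof (rule linkedI)
      fix j m assume jm: "j \<le> m" "m \<le> n"
      show "excess D m \<le> slack C' D j \<and>
        excess C' m + int (length D) - int (length C') \<le> slack C' D j"
        using sC(4)[OF f]
      proof (elim conjE disjE, goal_cases)
        case 1
        have "excess C' m = excess C m + (if m = i then 1 else 0)"
          "slack C' D j = slack C D j + (if j = i then 1 else 0)"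
          using 1 by (simp_all add: excess_def slack_def ct_move_down)
        moreover note pair_window.raise_y_slack[OF W, OF _ jm]
        ultimately show ?case using 1 act \<open>i = Suc k\<close> unfolding sC(1,2) sD(1,2) len
          by (auto simp: of_bool_def split: if_splits)
      next
        case 2
        have "excess C' m = excess C m - (if m = i then 1 else 0)"
          "slack C' D j = slack C D j"
          using 2 by (simp_all add: excess_def slack_def ct_move_up)
        moreover note linkedD[OF l jm]
        ultimately show ?case using 2 act \<open>i = Suc k\<close> unfolding sC(1,2) sD(1,2) len
          by (auto simp: of_bool_def split: if_splits)
      qed
    qed (use pair_length len in simp)
  next
    case (2 k)
    have f': "ew n C = Some C'" using f 2 by simp
    note sC = column_signs_last[OF pair_sorted(1) pair_alphabet(1)] and sD = column_signs_last[OF pair_sorted(2) pair_alphabet(2)]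
    show ?thesis
    proof (rule linkedI)
      fix j m assume jm: "j \<le> m" "m \<le> n"
      have e: "excess C' m = excess C m" for m
        using sC(4)[OF f'] by (simp add: excess_def ct_delete ct_insert)
      have cu: "slack C' D j = slack C D j + (if j = n then 1 else 0)"
        using sC(4)[OF f'] jm by (simp add: slack_def ct_delete ct_insert)
      show "excess D m \<le> slack C' D j \<and>
        excess C' m + int (length D) - int (length C') \<le> slack C' D j"
        using linkedD[OF l jm] unfolding e cu len by auto
    qed (use pair_length len in simp)
  qed
qed

lemma linked_ew_right:
  assumes f: "ew i D = Some D'" and act: "eps i C \<le> phi i D"
  shows "linked n C D'"
proof -
  have len: "length D' = length D" using length_ew[OF f] .
  have i: "1 \<le> i" "i \<le> n" using ew_colour[OF f] by auto
  from i show ?thesis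
  proof (cases rule: colour_cases)
    case (1 k)
    note W = pair_window_linked[OF l 1(2), folded 1(1)]
    have "i < n" using 1 by simp
    note sC = column_signs[OF pair_sorted(1) i(1) this] and sD = column_signs[OF pair_sorted(2) i(1) this]
    show ?thesis
    proof (rule linkedI)
      fix j m assume jm: "j \<le> m" "m \<le> n"
      show "excess D' m \<le> slack C D' j \<and>
        excess C m + int (length D') - int (length C) \<le> slack C D' j"
        using sD(4)[OF f]
      proof (elim conjE disjE, goal_cases)
        case 1
        have "excess D' m = excess D m + (if m = i then 1 else 0)"
          "slack C D' j = slack C D j"
          using 1 by (simp_all add: excess_def slack_def ct_move_down)
        moreover note pair_window.raise_x[OF W, OF _ jm]
        ultimately show ?case using 1 act \<open>i = Suc k\<close> unfolding sC(1,2) sD(1,2) len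
          by (auto simp: of_bool_def split: if_splits)
      next
        case 2
        have "excess D' m = excess D m - (if m = i then 1 else 0)"
          "slack C D' j = slack C D j - (if j = i then 1 else 0)"
          using 2 by (simp_all add: excess_def slack_def ct_move_up)
        moreover note pair_window.lower_slack[OF W, of 1 0, OF _ jm]
        ultimately show ?case using 2 act \<open>i = Suc k\<close> unfolding sC(1,2) sD(1,2) len
          by (auto simp: of_bool_def split: if_splits)
      qed
    qed (use pair_length len in simp)
  next
    case (2 k)
    have f': "ew n D = Some D'" using f 2 by simp
    note sC = column_signs_last[OF pair_sorted(1) pair_alphabet(1)] and sD = column_signs_last[OF pair_sorted(2) pair_alphabet(2)]
    note last = pair_window_last[OF C D 2(2)]
    have kn: "k \<le> n" using 2 by simp
    have act': "eps n C \<le> phi n D" using act 2 by simp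
    show ?thesis
    proof (rule linkedI)
      fix j m assume jm: "j \<le> m" "m \<le> n"
      have e: "excess D' m = excess D m" for m
        using sD(4)[OF f'] by (simp add: excess_def ct_delete ct_insert)
      have cu: "slack C D' j = slack C D j - (if j = n then 1 else 0)"
        using sD(4)[OF f'] jm by (simp add: slack_def ct_delete ct_insert)
      show "excess D' m \<le> slack C D' j \<and>
        excess C m + int (length D') - int (length C) \<le> slack C D' j"
        using lower_slack_last[where x = "excess D" and g = "slack C D" and
            y = "\<lambda>m. excess C m + int (length D) - int (length C)",
            OF linkedD[OF l] kn last _ jm] act'
        unfolding e cu len sC(1,2) sD(1,2) using sD(4)[OF f'] by (auto split: if_splits)
    qed (use pair_length len in simp)
  qed
qed

end

end

section \<open>Operators on tableaux\<close>

lemma shape_cong: "map length T = map length T' \<Longrightarrow> shape T = shape T'"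
proof -
  assume *: "map length T = map length T'"
  then have "length T = length T'" by (rule map_eq_imp_length_eq)
  moreover have "length (T ! j) = length (T' ! j)" if "j < length T" for j
    using * that calculation by (metis nth_map)
  ultimately show ?thesis by (auto simp: shape_def)
qed

lemma shape_inj:
  assumes "shape T = shape T'" "[] \<notin> set T" "[] \<notin> set T'"
  shows "map length T = map length T'"
proof -
  have mem: "(i, j) \<in> shape S \<longleftrightarrow> j < length S \<and> i < length (S ! j)" for i j S
    by (simp add: shape_def)
  have *: "j < length S \<longleftrightarrow> (0, j) \<in> shape S" if "[] \<notin> set S" for j and S :: tableau
    using that by (auto simp: mem in_set_conv_nth)
  have "j < length T \<longleftrightarrow> j < length T'" for j
    using *[OF assms(2)] *[OF assms(3)] assms(1) by simp
  then have l: "length T = length T'" by (metis linorder_neqE_nat less_irrefl)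
  show ?thesis
  proof (rule nth_equalityI)
    fix j assume "j < length (map length T)"
    then have j: "j < length T" "j < length T'" using l by auto
    have "i < length (T ! j) \<longleftrightarrow> i < length (T' ! j)" for i
      using mem[of i j T] mem[of i j T'] assms(1) j by simp
    then have "length (T ! j) = length (T' ! j)" by (metis linorder_neqE_nat less_irrefl)
    then show "map length T ! j = map length T' ! j" using j by simp
  qed (use l in simp)
qed

lemma length_filter_decreasing:
  fixes hs :: "nat list"
  assumes "sorted_wrt (\<ge>) hs"
  shows "j < length (filter (\<lambda>h. y \<le> h) hs) \<longleftrightarrow> j < length hs \<and> y \<le> hs ! j"
  using assms
proof (induction hs arbitrary: j)
  case (Cons h hs)
  show ?case
  proof (cases "y \<le> h")
    case True
    then show ?thesis using Cons by (cases j) auto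
  next
    case False
    then have "filter (\<lambda>h. y \<le> h) (h # hs) = []" using Cons.prems by (auto simp: filter_empty_conv)
    moreover have "(h # hs) ! j \<le> h" if "j < length (h # hs)"
      using that Cons.prems by (cases j) auto
    ultimately show ?thesis using False by fastforce
  qed
qed simp

text \<open>The highest weight column of height \<open>h\<close>.\<close>

definition std :: "nat \<Rightarrow> letter list" where
  "std h = map Unb [1..<Suc h]"

lemma length_std [simp]: "length (std h) = h"
  by (simp add: std_def)

lemma std_Suc: "std (Suc h) = std h @ [Unb (Suc h)]"
  by (simp add: std_def)

lemma std_0 [simp]: "std 0 = []"
  by (simp add: std_def)

lemma set_std: "set (std h) = Unb ` {Suc 0..h}"
  by (auto simp: std_def)

lemma unb_std: "unb (std h) = {1..h}" and bar_std: "bar (std h) = {}"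
  by (auto simp: std_def unb_def bar_def)

lemma ct_empty [simp]: "ct {} j = 0"
  by (simp add: ct_def)

lemma ct_interval: "ct {Suc 0..h} j = min j h"
proof -
  have "{i \<in> {Suc 0..h}. i \<le> j} = {Suc 0..min j h}" by auto
  then show ?thesis by (simp add: ct_def)
qed

lemma linked_std: "q \<le> p \<Longrightarrow> linked n (std p) (std q)"
  by (auto simp: linked_def excess_def slack_def unb_std bar_std ct_interval)

lemma admissible_std: "h \<le> n \<Longrightarrow> admissible n (std h)"
  unfolding admissible_iff
proof (intro conjI allI impI)
  show "sorted_wrt (<) (std h)"
    by (induction h) (auto simp: std_Suc sorted_wrt_append set_std)
  assume "h \<le> n"
  then show "set (std h) \<subseteq> alphabet n" by (auto simp: std_def alphabet_def)
  show "excess (std h) m \<le> 0" for m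
    by (simp add: excess_def unb_std bar_std ct_interval)
qed

context sp_words
begin

abbreviation tab :: "tableau \<Rightarrow> bool" where
  "tab \<equiv> symplectic_tableau n"

lemma tab_iff:
  "tab T \<longleftrightarrow> [] \<notin> set T \<and> (\<forall>C \<in> set T. admissible n C) \<and> successively (linked n) T"
proof -
  have "(\<forall>j. Suc j < length T \<longrightarrow> length (T ! Suc j) \<le> length (T ! j) \<and>
      (\<forall>k < length (T ! Suc j). right_column n (T ! j) ! k \<le> left_column n (T ! Suc j) ! k))
    \<longleftrightarrow> successively (linked n) T" if "\<forall>C \<in> set T. admissible n C"
    using that by (auto simp: successively_conv_nth linked_iff)
  then show ?thesis unfolding symplectic_tableau_def by blast
qed

lemma tab_Cons: "tab (C # T) \<Longrightarrow> tab T"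
  by (auto simp: tab_iff successively_Cons)

lemma reading_simps [simp]: "reading [] = []" "reading (C # T) = reading T @ C"
  "reading (S @ T) = reading T @ reading S"
  by (simp_all add: reading_def)

lemma reading_alphabet: "tab T \<Longrightarrow> set (reading T) \<subseteq> alphabet n"
  by (auto simp: tab_iff reading_def admissible_def)

context
  fixes g i
  assumes g: "g = fw i \<or> g = ew i"
begin

lemma op_admissible: "admissible n C \<Longrightarrow> g C = Some C' \<Longrightarrow> admissible n C'"
  using g admissible_op by blast

lemma op_length: "g C = Some C' \<Longrightarrow> length C' = length C"
  using g length_fw length_ew by blast

lemma op_linked_left:
  assumes "admissible n C" "admissible n D" "linked n C D" "g C = Some C'" "g (D @ C) = Some (D @ C')"
  shows "linked n C' D"
proof -
  have "C' \<noteq> C" using g assms(4) fw_neq fw_ew by metis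
  then have "g = fw i \<and> phi i D \<le> eps i C \<or> g = ew i \<and> phi i D < eps i C"
    using g assms(5) op_length[OF assms(4)]
    by (auto simp: fw_append ew_append split: if_splits dest: length_fw length_ew)
  then show ?thesis using linked_fw_left[OF assms(1-3)] linked_ew_left[OF assms(1-3)] assms(4) by blast
qed

lemma op_linked_right:
  assumes "admissible n C" "admissible n D" "linked n C D" "g D = Some D'" "g (D @ C) = Some (D' @ C)"
  shows "linked n C D'"
proof -
  have "D' \<noteq> D" using g assms(4) fw_neq fw_ew by metis
  then have "g = fw i \<and> eps i C < phi i D \<or> g = ew i \<and> eps i C \<le> phi i D"
    using g assms(5) op_length[OF assms(4)]
    by (auto simp: fw_append ew_append split: if_splits dest: length_fw length_ew)
  then show ?thesis using linked_fw_right[OF assms(1-3)] linked_ew_right[OF assms(1-3)] assms(4) by blast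
qed

lemma op_reading:
  assumes "g (reading T) = Some r"
  shows "\<exists>A X B X'. T = A @ X # B \<and> g X = Some X' \<and> r = reading (A @ X' # B)"
  using assms
proof (induction T arbitrary: r)
  case Nil
  then show ?case using g by auto
next
  case (Cons C T)
  then consider r' where "g (reading T) = Some r'" "r = r' @ C"
    | C' where "g C = Some C'" "r = reading T @ C'"
    using g by (auto simp: fw_append ew_append split: if_splits)
  then show ?case
  proof cases
    case 1
    then obtain A X B X' where "T = A @ X # B" "g X = Some X'" "r' = reading (A @ X' # B)"
      using Cons.IH by blast
    then show ?thesis using 1 by (intro exI[of _ "C # A"] exI[of _ X] exI[of _ B] exI[of _ X']) simp
  next
    case 2
    then show ?thesis by (intro exI[of _ "[]"] exI[of _ C] exI[of _ T] exI[of _ C']) simp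
  qed
qed

text \<open>One column changes, and the row condition involves adjacent columns, so two pairs are to
  be rechecked. On each the operator acts as it does on the whole reading, by the factor
  lemmas.\<close>

lemma tab_op:
  assumes T: "tab T" and f: "g (reading T) = Some r"
  shows "\<exists>T'. tab T' \<and> reading T' = r \<and> map length T' = map length T"
proof -
  obtain A X B X' where S: "T = A @ X # B" "g X = Some X'" "r = reading (A @ X' # B)"
    using op_reading[OF f] by blast
  have factor: "g u = Some u'" if "g (a @ u @ b) = Some (a @ u' @ b)" "length u' = length u" for a u b u'
    using g that fw_factor ew_factor by blast
  have adm: "admissible n C" if "C \<in> set T" for C using T that by (simp add: tab_iff)
  have len: "length X' = length X" using op_length[OF S(2)] .
  have admX: "admissible n X" using adm S(1) by simp
  have left: "linked n C X'" if C: "A \<noteq> []" "C = last A" "linked n C X" for C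
  proof -
    have A: "A = butlast A @ [C]" using C by simp
    have "reading A = C @ reading (butlast A)" by (subst A) simp
    then have "g (reading B @ (X @ C) @ reading (butlast A)) = Some (reading B @ (X' @ C) @ reading (butlast A))"
      using f S by simp
    then have "g (X @ C) = Some (X' @ C)" by (rule factor) (simp add: len)
    moreover have "C \<in> set T" using S(1) C by simp
    ultimately show ?thesis using op_linked_right[OF adm admX C(3) S(2)] by blast
  qed
  have right: "linked n X' D" if D: "B \<noteq> []" "D = hd B" "linked n X D" for D
  proof -
    have B: "B = D # tl B" using D by simp
    have "reading B = reading (tl B) @ D" by (subst B) simp
    then have "g (reading (tl B) @ (D @ X) @ reading A) = Some (reading (tl B) @ (D @ X') @ reading A)"
      using f S by simp
    then have "g (D @ X) = Some (D @ X')" by (rule factor) (simp add: len)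
    moreover have "D \<in> set T" using S(1) D by simp
    ultimately show ?thesis using op_linked_left[OF admX adm D(3) S(2)] by blast
  qed
  have "tab (A @ X' # B)"
    using T op_admissible[OF admX S(2)] len left right
    by (auto simp: tab_iff S(1) successively_append_iff successively_Cons)
  then show ?thesis using S len by (intro exI[of _ "A @ X' # B"]) simp
qed

end

lemmas tab_fw = tab_op[OF disjI1[OF refl]] and tab_ew = tab_op[OF disjI2[OF refl]]

definition dominant :: "(nat \<Rightarrow> int) \<Rightarrow> bool" where
  "dominant d \<longleftrightarrow> (\<forall>i. 1 \<le> i \<and> i < n \<longrightarrow> d (Suc i) \<le> d i) \<and> 0 \<le> d n"

lemma dominant_mono:
  assumes "dominant d" "1 \<le> i" "i \<le> j" "j \<le> n"
  shows "d j \<le> d i"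
  using assms(3,4)
proof (induction rule: dec_induct)
  case (step k)
  then have "d (Suc k) \<le> d k" using assms(1,2) by (simp add: dominant_def)
  then show ?case using step by simp
qed simp

lemma dominant_nonneg: "dominant d \<Longrightarrow> 1 \<le> i \<Longrightarrow> i \<le> n \<Longrightarrow> 0 \<le> d i"
  using dominant_mono[of d i n] by (simp add: dominant_def)

lemma hw_dominant: "hw w \<Longrightarrow> dominant (wt w)"
  unfolding dominant_def
proof (intro conjI allI impI)
  assume h: "hw w"
  show "wt w (Suc i) \<le> wt w i" if "1 \<le> i \<and> i < n" for i
    using wt_phi_eps[of i w] h that by (simp add: hw_def)
  show "0 \<le> wt w n"
    using wt_phi_eps[of n w] h n_pos by (simp add: hw_def)
qed

text \<open>A violated colour would have \<open>eps\<close> 1 and \<open>phi\<close> 0 on the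
  extended word, hence a negative pairing of its weight with the simple coroot, against
  dominance.\<close>

lemma hw_snocI:
  assumes "hw u" "dominant (wt (u @ [x]))"
  shows "hw (u @ [x])"
  unfolding hw_snoc
proof (intro conjI allI assms(1))
  fix i
  show "ep i x \<le> phi i u"
  proof (rule ccontr)
    assume *: "\<not> ep i x \<le> phi i u"
    then have e: "ep i x = 1" "phi i u = 0" by (auto simp: ep_def split: if_splits)
    have E: "sp_e n i x \<noteq> None"
    proof
      assume "sp_e n i x = None"
      then show False using e(1) by (simp add: ep_def)
    qed
    then have i: "1 \<le> i" "i \<le> n" by (simp_all add: sp_e_def split: if_split_asm)
    have "sp_f n i x = None" using E F_E_None by blast
    then have "ph i x = 0" by (simp add: ph_def)
    then have "phi i (u @ [x]) = 0" "eps i (u @ [x]) = 1"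
      using e assms(1) by (simp_all add: phi_append eps_append hw_def)
    then have "wt (u @ [x]) i - (if i < n then wt (u @ [x]) (Suc i) else 0) < 0"
      using wt_phi_eps[OF i, of "u @ [x]"] by simp
    moreover have "i < n \<Longrightarrow> wt (u @ [x]) (Suc i) \<le> wt (u @ [x]) i" "0 \<le> wt (u @ [x]) n"
      using assms(2) i unfolding dominant_def by blast+
    ultimately show False using i by (cases "i < n") auto
  qed
qed

lemma hw_append_hw: "hw u \<Longrightarrow> hw v \<Longrightarrow> hw (u @ v)"
  by (simp add: hw_def eps_append)

lemma wt_std: "wt (std h) y = (if 1 \<le> y \<and> y \<le> h then 1 else 0)"
  by (induction h) (auto simp: std_Suc)

lemma hw_std: "hw (std h)"
proof (induction h)
  case (Suc h)
  show ?case
    unfolding std_Suc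
  proof (cases "Suc h \<le> n")
    case True
    then show "hw (std h @ [Unb (Suc h)])"
      by (intro hw_snocI Suc) (auto simp: dominant_def wt_std)
  next
    case False
    \<comment> \<open>A letter beyond \<open>n\<close> carries no sign.\<close>
    then show "hw (std h @ [Unb (Suc h)])" using Suc by (auto simp: hw_snoc ep_sp)
  qed
qed (simp add: hw_def)

lemma std_tab_hw: "\<forall>C \<in> set T. C = std (length C) \<Longrightarrow> hw (reading T)"
proof (induction T)
  case (Cons C T)
  then have "hw C" using hw_std[of "length C"] by simp
  then show ?case using Cons by (simp add: hw_append_hw)
qed (simp add: hw_def)

lemma std_tab_wt:
  "\<forall>C \<in> set T. C = std (length C) \<Longrightarrow> 1 \<le> y \<Longrightarrow> wt (reading T) y = int (length (filter (\<lambda>h. y \<le> h) (map length T)))"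
proof (induction T)
  case (Cons C T)
  then have "wt C y = (if y \<le> length C then 1 else 0)" using wt_std[of "length C" y] by simp
  then show ?case using Cons by simp
qed simp

lemma tab_heights:
  assumes "tab T"
  shows "sorted_wrt (\<ge>) (map length T)"
proof -
  have "successively (\<ge>) (map length T)"
    using assms by (auto simp: tab_iff successively_conv_nth linked_def)
  then show ?thesis by (simp add: successively_conv_sorted_wrt transp_on_def)
qed

text \<open>The columns to the right of \<open>X\<close> are read before \<open>X\<close> and are
  standard by induction. The letters of \<open>X\<close> are then identified from the top: the row
  condition fixes the first \<open>q\<close> of them, dominance of the prefixes and admissibility
  the rest.\<close>

lemma hw_tab:
  assumes "tab T" "hw (reading T)"
  shows "\<forall>C \<in> set T. C = std (length C)"
  using assms
proof (induction T)
  case (Cons X B)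
  have hB: "hw (reading B)" using Cons.prems(2) hw_append[of "reading B" X] by simp
  have IH: "\<forall>C \<in> set B. C = std (length C)" using Cons.IH[OF tab_Cons[OF Cons.prems(1)] hB] .
  define q where "q = (if B = [] then 0 else length (hd B))"
  have adm: "admissible n X" using Cons.prems(1) by (simp add: tab_iff)
  then have al: "set X \<subseteq> alphabet n" and so: "sorted_wrt (<) X" and ex: "\<And>m. m \<le> n \<Longrightarrow> excess X m \<le> 0"
    by (auto simp: admissible_iff)
  have "q \<le> n \<and> {1..q} \<subseteq> unb X"
  proof (cases "B = []")
    case True
    then show ?thesis by (simp add: q_def)
  next
    case B: False
    show ?thesis
    proof -
      have D: "hd B = std q" and l: "linked n X (hd B)" and a: "admissible n (hd B)"
        using B IH Cons.prems(1) by (cases B; auto simp: q_def tab_iff)+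
      have "unb (hd B) = {1..q}" by (simp add: D unb_std)
      moreover have "set (hd B) \<subseteq> alphabet n" using a by (simp add: admissible_def)
      ultimately have qn: "q \<le> n" using unb_bar_alphabet(1)[of "hd B" n q] by (cases q) auto
      \<comment> \<open>The standard column of height \<open>q\<close> has excess 0 at
        \<open>q\<close>, so the inequality at \<open>j = m = q\<close> forces \<open>q\<close>
        unbarred letters of \<open>X\<close> into \<open>{1..q}\<close>.\<close>
      have "excess (hd B) q \<le> slack X (hd B) q" using linkedD[OF l order_refl qn] by blast
      then have "q \<le> ct (unb X) q" by (simp add: D excess_def slack_def unb_std bar_std ct_interval)
      moreover have "{i \<in> unb X. i \<le> q} \<subseteq> {1..q}" using unb_bar_alphabet(1)[OF al] by auto
      ultimately have "{i \<in> unb X. i \<le> q} = {1..q}"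
        by (intro card_seteq) (auto simp: ct_def)
      then show ?thesis using qn by auto
    qed
  qed
  then have q: "q \<le> n" "{1..q} \<subseteq> unb X" by auto
  \<comment> \<open>The rows after \<open>q\<close> are still empty when \<open>X\<close> is read;
    once the rows up to \<open>k\<close> are filled, dominance admits a new box among them only in
    row \<open>Suc k\<close>.\<close>
  have wB: "wt (reading B) y = 0" if "q < y" for y
  proof -
    have "filter (\<lambda>h. y \<le> h) (map length B) = []"
    proof (cases B)
      case (Cons D B')
      then have "h \<le> q" if "h \<in> set (map length B)" for h
        using tab_heights[OF tab_Cons[OF Cons.prems(1)]] that by (auto simp: q_def)
      then show ?thesis using that by (fastforce simp: filter_empty_conv)
    qed simp
    then show ?thesis using std_tab_wt[OF IH, of y] that by simp
  qed
  have "take k X = std k" if "k \<le> length X" for k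
    using that
  proof (induction k)
    case (Suc k)
    then have tk: "take k X = std k" and kl: "k < length X" by auto
    define x where "x = X ! k"
    have tS: "take (Suc k) X = std k @ [x]" using tk kl by (simp add: take_Suc_conv_app_nth x_def)
    have xX: "x \<in> set X" using kl by (simp add: x_def)
    then have xal: "x \<in> alphabet n" using al by blast
    have sub: "set (std k) \<subseteq> set X" using tk set_take_subset by metis
    have gt: "Unb i < x" if "1 \<le> i" "i \<le> k" for i
    proof -
      have "X ! (i - 1) = Unb i"
        using arg_cong[OF tk, of "\<lambda>l. l ! (i - 1)"] that kl by (simp add: std_def del: upt_Suc)
      then show ?thesis using sorted_wrt_nth_less[OF so, of "i - 1" k] that kl by (simp add: x_def)
    qed
    have "hw ((reading B @ take (Suc k) X) @ drop (Suc k) X)" using Cons.prems(2) by simp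
    then have "hw (reading B @ take (Suc k) X)" by (rule hw_append)
    then have dom: "dominant (wt (reading B @ std k @ [x]))" using hw_dominant tS by simp
    have "x = Unb (Suc k)"
    proof (cases "k < q")
      case True
      then have "Suc k \<in> unb X" using subsetD[OF q(2), of "Suc k"] by simp
      then have "Unb (Suc k) \<in> set X" by (simp add: unb_def)
      then obtain j where j: "j < length X" "X ! j = Unb (Suc k)" by (auto simp: in_set_conv_nth)
      have "\<not> j < k"
      proof
        assume "j < k"
        then have "Unb (Suc k) \<in> set (take k X)" using j by (auto simp: in_set_conv_nth)
        then show False unfolding tk by (auto simp: std_def)
      qed
      then have "x \<le> Unb (Suc k)"
        using sorted_wrt_nth_less[OF so, of k j] j by (cases "j = k") (auto simp: x_def)
      moreover have "Unb k < x" if "1 \<le> k" using gt[of k] that by simp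
      ultimately show ?thesis using xal by (cases x; cases "k = 0") (auto simp: alphabet_def)
    next
      case False
      show ?thesis
        using xal
      proof (cases rule: alphabet_cases)
        case (1 y)
        have "k < y" using gt[of y] 1 by (cases "y \<le> k") auto
        show ?thesis
        proof (rule ccontr)
          assume "x \<noteq> Unb (Suc k)"
          then have y: "Suc k < y" using 1 \<open>k < y\<close> by (cases "y = Suc k") auto
          then have "wt (reading B @ std k @ [x]) y = 1" "wt (reading B @ std k @ [x]) (y - 1) = 0"
            using False wB[of y] wB[of "y - 1"] 1 by (auto simp: wt_std)
          moreover have "wt (reading B @ std k @ [x]) y \<le> wt (reading B @ std k @ [x]) (y - 1)"
            using 1 y by (intro dominant_mono[OF dom]) auto
          ultimately show False by linarith
        qed
      next
        case (2 y)
        show ?thesis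
        proof (cases "y \<le> k")
          case True
          \<comment> \<open>\<open>X\<close> would contain \<open>1, ..., y\<close> and
            \<open>Bar y\<close>, which is \<open>y + 1\<close> letters of index at most
            \<open>y\<close>, against admissibility.\<close>
          have "{1..y} \<subseteq> {i \<in> unb X. i \<le> y}"
            using sub True unb_std[of k] by (auto simp: unb_def)
          moreover have "finite {i \<in> unb X. i \<le> y}" by simp
          ultimately have "card {1..y} \<le> ct (unb X) y" unfolding ct_def by (intro card_mono)
          moreover have "ct (bar X) y \<ge> 1"
          proof -
            have "{y} \<subseteq> {i \<in> bar X. i \<le> y}" using xX 2 by (auto simp: bar_def)
            moreover have "finite {i \<in> bar X. i \<le> y}" by simp
            ultimately have "card {y} \<le> ct (bar X) y" unfolding ct_def by (intro card_mono)
            then show ?thesis by simp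
          qed
          ultimately show ?thesis using ex[of y] 2 by (simp add: excess_def)
        next
          case F: False
          then have "wt (reading B @ std k @ [x]) y = - 1"
            using False wB[of y] 2 by (auto simp: wt_std)
          then show ?thesis using dominant_nonneg[OF dom, of y] 2 by simp
        qed
      qed
    qed
    then show ?case using tS by (simp add: std_Suc)
  qed simp
  from this[of "length X"] show ?case using IH by simp
qed simp

end

section \<open>The correspondence\<close>

context sp_words
begin

text \<open>Rows of a diagram count from 0, coordinates of a weight from 1. Negative coordinates
  give empty rows.\<close>

definition diagram :: "(nat \<Rightarrow> int) \<Rightarrow> (nat \<times> nat) set" where
  "diagram d = {(i, j). i < n \<and> int j < d (Suc i)}"

lemma shape_std_tab:
  assumes "tab T" "\<forall>C \<in> set T. C = std (length C)"
  shows "shape T = diagram (wt (reading T))"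
proof -
  have "i < n" if "j < length T" "i < length (T ! j)" for i j
  proof -
    have "T ! j \<in> set T" using that by simp
    then have "T ! j = std (length (T ! j))" "set (T ! j) \<subseteq> alphabet n"
      using assms by (auto simp: tab_iff admissible_def)
    then have "Unb (length (T ! j)) \<in> alphabet n" using that set_std[of "length (T ! j)"] by auto
    then show ?thesis using that by (auto simp: alphabet_def)
  qed
  moreover have "int j < wt (reading T) (Suc i) \<longleftrightarrow> j < length T \<and> i < length (T ! j)" for i j
    using std_tab_wt[OF assms(2), of "Suc i"] length_filter_decreasing[OF tab_heights[OF assms(1)], of j "Suc i"]
    by (auto simp: Suc_le_eq)
  ultimately show ?thesis by (auto simp: shape_def diagram_def)
qed

lemma diagram_eq_iff:
  assumes "dominant d" "dominant d'" "diagram d = diagram d'" "1 \<le> i" "i \<le> n"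
  shows "d i = d' i"
proof -
  have "int j < d i \<longleftrightarrow> int j < d' i" for j
  proof -
    have "(i - 1, j) \<in> diagram d \<longleftrightarrow> (i - 1, j) \<in> diagram d'" using assms by simp
    moreover have "i - 1 < n" using assms(4,5) by linarith
    ultimately show ?thesis using assms(4) by (simp add: diagram_def)
  qed
  moreover have "d i = int (nat (d i))" "d' i = int (nat (d' i))"
    using dominant_nonneg assms by simp_all
  ultimately show ?thesis by (metis linorder_neqE_nat less_irrefl of_nat_less_iff)
qed

text \<open>The heights \<open>h j\<close> form the partition conjugate to
  \<open>d 1, ..., d n\<close>, and \<open>d 1\<close> is the number of columns.\<close>

lemma ex_std_tab:
  assumes "dominant d"
  shows "\<exists>T. tab T \<and> (\<forall>C \<in> set T. C = std (length C)) \<and> (\<forall>y. 1 \<le> y \<and> y \<le> n \<longrightarrow> wt (reading T) y = d y)"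
proof -
  define h where "h j = card {i \<in> {1..n}. int j < d i}" for j :: nat
  define T where "T = map (\<lambda>j. std (h j)) [0..<nat (d 1)]"
  have hI: "{i \<in> {1..n}. int j < d i} = {1..h j}" for j
  proof -
    let ?S = "{i \<in> {1..n}. int j < d i}"
    have "{1..m} \<subseteq> ?S" if "m \<in> ?S" for m
      using that dominant_mono[OF assms, of _ m] by fastforce
    note down = this
    show ?thesis
    proof (cases "?S = {}")
      case True
      then show ?thesis by (simp only: h_def) simp
    next
      case False
      then have "{1..Max ?S} \<subseteq> ?S" by (intro down Max_in) simp_all
      moreover have "?S \<subseteq> {1..Max ?S}"
      proof
        fix x assume x: "x \<in> ?S"
        then have "x \<le> Max ?S" by (intro Max_ge) simp_all
        then show "x \<in> {1..Max ?S}" using x by simp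
      qed
      ultimately have S: "?S = {1..Max ?S}" by (rule equalityI[rotated])
      then have "h j = Max ?S" unfolding h_def by (metis card_atLeastAtMost diff_Suc_1)
      then show ?thesis using S by simp
    qed
  qed
  have hy: "y \<le> h j \<longleftrightarrow> int j < d y" if "1 \<le> y" "y \<le> n" for y j
    using hI[of j] that by (auto simp: set_eq_iff)
  have hn: "h j \<le> n" for j
  proof -
    have "h j \<le> card {1..n}" unfolding h_def by (intro card_mono) auto
    then show ?thesis by simp
  qed
  have hdec: "h j' \<le> h j" if "j \<le> j'" for j j'
    unfolding h_def using that by (intro card_mono) auto
  have h1: "h j \<noteq> 0" if "j < nat (d 1)" for j
  proof -
    have "1 \<le> h j" using hy[of 1 j] n_pos that by simp
    then show ?thesis by simp
  qed
  have std: "\<forall>C \<in> set T. C = std (length C)" by (auto simp: T_def)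
  have "tab T"
    unfolding tab_iff
  proof (intro conjI ballI)
    show "[] \<notin> set T" using h1 by (force simp: T_def std_def simp del: upt_Suc)
    show "admissible n C" if "C \<in> set T" for C using that hn admissible_std by (auto simp: T_def)
    show "successively (linked n) T"
      by (auto simp: successively_conv_nth T_def intro!: linked_std hdec)
  qed
  moreover have "wt (reading T) y = d y" if y: "1 \<le> y" "y \<le> n" for y
  proof -
    have "filter (\<lambda>h. y \<le> h) (map length T) = map h (filter (\<lambda>j. y \<le> h j) [0..<nat (d 1)])"
      by (simp add: T_def filter_map comp_def)
    moreover have "filter (\<lambda>j. y \<le> h j) [0..<nat (d 1)] = [0..<nat (d y)]"
    proof -
      have "d y \<le> d 1" using dominant_mono[OF assms, of 1 y] y by simp
      then have "[0..<nat (d 1)] = [0..<nat (d y)] @ [nat (d y)..<nat (d 1)]"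
        using upt_add_eq_append[of 0 "nat (d y)" "nat (d 1) - nat (d y)"] by simp
      moreover have "y \<le> h j \<longleftrightarrow> j < nat (d y)" for j using hy[OF y, of j] by linarith
      then have "filter (\<lambda>j. y \<le> h j) [0..<nat (d y)] = [0..<nat (d y)]"
        "filter (\<lambda>j. y \<le> h j) [nat (d y)..<nat (d 1)] = []"
        by (simp_all add: filter_id_conv filter_empty_conv)
      ultimately show ?thesis by simp
    qed
    ultimately show ?thesis
      using std_tab_wt[OF std y(1)] dominant_nonneg[OF assms y] by simp
  qed
  ultimately show ?thesis using std by blast
qed

section \<open>Existence and uniqueness of the tableau of a word\<close>

lemma pos_fw:
  assumes "fw i w = Some w'" "set w \<subseteq> alphabet n"
  shows "sum_list (map pos w') = Suc (sum_list (map pos w))"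
proof -
  have "pos y = Suc (pos x)" if "sp_f n i x = Some y" "x \<in> alphabet n" for x y
    using that by (auto simp: sp_f_def f_letter_def pos_def alphabet_def split: if_splits)
  then show ?thesis
    using assms by (induction w arbitrary: w') (auto simp: ph_def split: if_splits)
qed

text \<open>Since \<open>fw\<close> raises the sum of the ranks by one, \<open>ew\<close> lowers it.
  Properties are proved at highest weight and carried back along the operators.\<close>

lemma hw_induct [consumes 1, case_names hw ew]:
  assumes "set w \<subseteq> alphabet n"
    and "\<And>w. set w \<subseteq> alphabet n \<Longrightarrow> hw w \<Longrightarrow> Q w"
    and "\<And>w i w'. set w \<subseteq> alphabet n \<Longrightarrow> set w' \<subseteq> alphabet n \<Longrightarrow> ew i w = Some w' \<Longrightarrow> Q w' \<Longrightarrow> Q w"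
  shows "Q w"
  using assms(1)
proof (induction "sum_list (map pos w)" arbitrary: w rule: less_induct)
  case less
  show ?case
  proof (cases "hw w")
    case False
    then obtain i where "ew i w \<noteq> None" by (auto simp: hw_def ew_None_iff)
    then obtain w' where e: "ew i w = Some w'" by blast
    have w': "set w' \<subseteq> alphabet n" using ew_alphabet[OF e less.prems] .
    then have "Q w'" using less.hyps pos_fw[of i w' w] e fw_ew by simp
    then show ?thesis using assms(3)[OF less.prems w' e] by blast
  qed (use assms(2) less.prems in blast)
qed

lemma ex_tab:
  assumes "set w \<subseteq> alphabet n"
  shows "\<exists>T. tab T \<and> crystal_eq w (reading T)"
  using assms
proof (induction rule: hw_induct)
  case (hw w)
  obtain T where T: "tab T" "\<forall>C \<in> set T. C = std (length C)"
    "\<forall>y. 1 \<le> y \<and> y \<le> n \<longrightarrow> wt (reading T) y = wt w y"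
    using ex_std_tab[OF hw_dominant[OF hw(2)]] by blast
  then have "crystal_eq w (reading T)"
    using hw by (intro hw_same_weight std_tab_hw reading_alphabet) auto
  then show ?case using T by blast
next
  case (ew w i w')
  then obtain T where T: "tab T" "crystal_eq w' (reading T)" by blast
  obtain r where r: "fw i (reading T) = Some r" "crystal_eq w r"
    using crystal_eq_fw[OF T(2)] ew(3) fw_ew by blast
  then show ?case using tab_fw[OF T(1) r(1)] by blast
qed

text \<open>\<open>phi - eps\<close> gives the last coordinate at colour \<open>n\<close> and
  consecutive differences at the other colours, so the coordinates are recovered from
  \<open>n\<close> downwards.\<close>

lemma crystal_eq_wt:
  assumes "crystal_eq u v" "1 \<le> i" "i \<le> n"
  shows "wt u i = wt v i"
proof -
  have "wt u (n - k) = wt v (n - k)" if "k < n" for k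
    using that
  proof (induction k)
    case 0
    then show ?case
      using wt_phi_eps[of n u] wt_phi_eps[of n v] crystal_eq_eps[OF assms(1)] crystal_eq_phi[OF assms(1)] n_pos
      by simp
  next
    case (Suc k)
    then have "Suc (n - Suc k) = n - k" "n - Suc k < n" "1 \<le> n - Suc k" by auto
    then show ?case
      using wt_phi_eps[of "n - Suc k" u] wt_phi_eps[of "n - Suc k" v] Suc
        crystal_eq_eps[OF assms(1)] crystal_eq_phi[OF assms(1)]
      by simp
  qed
  from this[of "n - i"] show ?thesis using assms by simp
qed

lemma crystal_eq_hw: "crystal_eq u v \<Longrightarrow> hw u \<Longrightarrow> hw v"
  using crystal_eq_eps by (simp add: hw_def)

lemma hw_tab_unique:
  assumes "tab T" "tab T'" "hw (reading T)" "hw (reading T')" "shape T = shape T'"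
  shows "T = T'"
proof -
  have "map length T = map length T'" using shape_inj[OF assms(5)] assms(1,2) by (simp add: tab_iff)
  moreover have "\<forall>C \<in> set S. C = std (length C) \<Longrightarrow> S = map std (map length S)" for S
    by (induction S) auto
  then have "T = map std (map length T)" "T' = map std (map length T')"
    using hw_tab[OF assms(1,3)] hw_tab[OF assms(2,4)] by blast+
  ultimately show ?thesis by metis
qed

lemma tab_of_heights_unique:
  assumes "map length T = map length T'" "reading T = reading T'"
  shows "T = T'"
proof -
  have "map length (rev T) = map length (rev T')" using assms(1) by (simp add: rev_map[symmetric])
  moreover have "concat (rev T) = concat (rev T')" using assms(2) by (simp add: reading_def)
  moreover have "map length xs = map length ys \<Longrightarrow> concat xs = concat ys \<Longrightarrow> xs = ys" for xs ys :: tableau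
  proof (induction xs arbitrary: ys)
    case (Cons x xs)
    then show ?case by (cases ys) auto
  qed simp
  ultimately show ?thesis by (metis rev_rev_ident)
qed

text \<open>Both tableaux are moved by the same raising operators until they coincide. Operators
  keep the heights and are invertible, so the original readings and heights agree.\<close>

lemma tab_unique:
  assumes "tab T" "tab T'" "crystal_eq (reading T) (reading T')"
  shows "T = T' "
proof -
  have "tab T \<Longrightarrow> tab T' \<Longrightarrow> r = reading T \<Longrightarrow> crystal_eq r (reading T') \<Longrightarrow> T = T'"
    if "set r \<subseteq> alphabet n" for r
    using that
  proof (induction arbitrary: T T' rule: hw_induct)
    case (hw r)
    then have h: "hw (reading T)" "hw (reading T')" using crystal_eq_hw by auto
    have "shape T = diagram (wt (reading T))" "shape T' = diagram (wt (reading T'))"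
      using shape_std_tab hw_tab h hw by blast+
    moreover have "diagram (wt (reading T)) = diagram (wt (reading T'))"
      using crystal_eq_wt[OF hw(6)] hw(5) by (auto simp: diagram_def)
    ultimately show ?case using hw_tab_unique[OF hw(3,4) h] by simp
  next
    case (ew r i r1)
    then obtain r1' where r1': "ew i (reading T') = Some r1'" "crystal_eq r1 r1'"
      using crystal_eq_ew by metis
    obtain S where S: "tab S" "reading S = r1" "map length S = map length T"
      using tab_ew[OF ew(5), of i r1] ew by blast
    obtain S' where S': "tab S'" "reading S' = r1'" "map length S' = map length T'"
      using tab_ew[OF ew(6) r1'(1)] by blast
    have "S = S'" using ew(4)[OF S(1) S'(1)] S(2) S'(2) r1'(2) by simp
    then have "reading T = reading T'" "map length T = map length T'"
      using S S' r1'(1) ew(3,7) fw_ew by (metis option.inject)+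
    then show ?case using tab_of_heights_unique by blast
  qed
  then show ?thesis using reading_alphabet assms by blast
qed

lemma P_tableau_eqI:
  assumes "tab T" "crystal_eq w (reading T)"
  shows "P_tableau n w = T"
  unfolding P_tableau_def crystal_equiv_iff
  using assms tab_unique crystal_eq_sym crystal_eq_trans by (intro the_equality) blast+

lemma P_tableau:
  assumes "set w \<subseteq> alphabet n"
  shows "tab (P_tableau n w)" "crystal_eq w (reading (P_tableau n w))"
  using ex_tab[OF assms] P_tableau_eqI by auto

lemma shape_P_hw:
  assumes "set w \<subseteq> alphabet n" "hw w"
  shows "shape (P_tableau n w) = diagram (wt w)"
proof -
  note P = P_tableau[OF assms(1)]
  have "hw (reading (P_tableau n w))" using crystal_eq_hw[OF P(2) assms(2)] .
  then have "shape (P_tableau n w) = diagram (wt (reading (P_tableau n w)))"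
    using shape_std_tab[OF P(1)] hw_tab[OF P(1)] by blast
  then show ?thesis using crystal_eq_wt[OF P(2)] by (auto simp: diagram_def)
qed

lemma shape_P_ew:
  assumes "set w \<subseteq> alphabet n" "ew i w = Some w'"
  shows "shape (P_tableau n w') = shape (P_tableau n w)"
proof -
  note P = P_tableau[OF assms(1)]
  obtain r where r: "ew i (reading (P_tableau n w)) = Some r" "crystal_eq w' r"
    using crystal_eq_ew[OF P(2) assms(2)] by blast
  then obtain T where T: "tab T" "reading T = r" "map length T = map length (P_tableau n w)"
    using tab_ew[OF P(1)] by blast
  then have "P_tableau n w' = T" using P_tableau_eqI r by simp
  then show ?thesis using shape_cong T by blast
qed

section \<open>The recording sequence\<close>

lemma ew_prefix:
  assumes "ew i (a @ b) = Some (a' @ b')" "length a = length a'"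
  shows "a' = a \<or> ew i a = Some a'"
proof (cases "phi i a < eps i b")
  case True
  then show ?thesis using assms by (auto simp: ew_append)
next
  case False
  then obtain z where z: "ew i a = Some z" "z @ b = a' @ b'" using assms(1) by (auto simp: ew_append)
  then show ?thesis using length_ew[OF z(1)] assms(2) by simp
qed

lemma Q_tableau_ew:
  assumes "set w \<subseteq> alphabet n" "ew i w = Some w'"
  shows "Q_tableau n w' = Q_tableau n w"
proof -
  have l: "length w' = length w" using length_ew[OF assms(2)] .
  have "shape (P_tableau n (take k w')) = shape (P_tableau n (take k w))" for k
  proof -
    have "ew i (take k w @ drop k w) = Some (take k w' @ drop k w')" using assms(2) by simp
    moreover have "length (take k w) = length (take k w')" using l by simp
    ultimately have "take k w' = take k w \<or> ew i (take k w) = Some (take k w')"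
      by (rule ew_prefix)
    moreover have "set (take k w) \<subseteq> alphabet n" using assms(1) set_take_subset by fastforce
    ultimately show ?thesis using shape_P_ew by metis
  qed
  then show ?thesis by (simp add: Q_tableau_def l)
qed

lemma length_Q_tableau [simp]: "length (Q_tableau n w) = length w"
  by (simp add: Q_tableau_def del: upt_Suc)

lemma nth_Q_tableau: "k < length w \<Longrightarrow> Q_tableau n w ! k = shape (P_tableau n (take (Suc k) w))"
  unfolding Q_tableau_def by (simp del: upt_Suc)

lemma nth_Q_tableau_hw:
  assumes "set w \<subseteq> alphabet n" "hw w" "k < length w"
  shows "Q_tableau n w ! k = diagram (wt (take (Suc k) w))"
proof -
  have "set (take (Suc k) w) \<subseteq> alphabet n" using assms(1) set_take_subset by fastforce
  moreover have "hw (take (Suc k) w)" using hw_append[of "take (Suc k) w" "drop (Suc k) w"] assms(2) by simp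
  ultimately show ?thesis using nth_Q_tableau[OF assms(3)] shape_P_hw by simp
qed

lemma last_Q_tableau:
  assumes "w \<noteq> []"
  shows "last (Q_tableau n w) = shape (P_tableau n w)"
proof -
  obtain m where m: "length w = Suc m" using assms by (cases w) auto
  then have "Q_tableau n w \<noteq> []" using length_Q_tableau[of w] by force
  then have "last (Q_tableau n w) = Q_tableau n w ! m" by (simp add: last_conv_nth m)
  then show ?thesis using nth_Q_tableau[of m w] m by simp
qed

lemma young_diagram_diagram:
  assumes "dominant d"
  shows "young_diagram (diagram d)" "column_height (diagram d) j \<le> n"
proof -
  have "diagram d \<subseteq> {..<n} \<times> {..<nat (d 1)}"
  proof
    fix b assume "b \<in> diagram d"
    then obtain i j where b: "b = (i, j)" "i < n" "int j < d (Suc i)" by (auto simp: diagram_def)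
    moreover have "d (Suc i) \<le> d 1" using b(2) by (intro dominant_mono[OF assms]) auto
    ultimately show "b \<in> {..<n} \<times> {..<nat (d 1)}" by auto
  qed
  then have "finite (diagram d)" by (rule finite_subset) simp
  moreover have "(i', j') \<in> diagram d" if "(i, j) \<in> diagram d" "i' \<le> i" "j' \<le> j" for i j i' j'
    using that dominant_mono[OF assms, of "Suc i'" "Suc i"] by (auto simp: diagram_def)
  ultimately show "young_diagram (diagram d)" unfolding young_diagram_def by blast
  have "{i. (i, j) \<in> diagram d} \<subseteq> {..<n}" by (auto simp: diagram_def)
  then show "column_height (diagram d) j \<le> n"
    using card_mono[of "{..<n}" "{i. (i, j) \<in> diagram d}"] by (simp add: column_height_def)
qed

text \<open>Coordinate \<open>y\<close> is row \<open>y - 1\<close> of the diagram, and as columns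
  count from 0 its first free box is in column \<open>d y\<close>.\<close>

lemma diagram_Suc:
  assumes "1 \<le> y" "y \<le> n" "0 \<le> d y" "d' y = d y + 1" "\<And>z. z \<noteq> y \<Longrightarrow> d' z = d z"
  shows "diagram d' = insert (y - 1, nat (d y)) (diagram d)" "(y - 1, nat (d y)) \<notin> diagram d"
proof -
  have "(i, j) \<in> diagram d' \<longleftrightarrow> (i, j) \<in> insert (y - 1, nat (d y)) (diagram d)" for i j
    using assms(1-4) assms(5)[of "Suc i"] by (cases "Suc i = y") (auto simp: diagram_def)
  then show "diagram d' = insert (y - 1, nat (d y)) (diagram d)" by auto
  show "(y - 1, nat (d y)) \<notin> diagram d" using assms by (auto simp: diagram_def)
qed

lemma diagram_wt_snoc:
  assumes "x \<in> alphabet n" "dominant (wt u)" "dominant (wt (u @ [x]))"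
  shows "adds_box (diagram (wt u)) (diagram (wt (u @ [x]))) \<or> adds_box (diagram (wt (u @ [x]))) (diagram (wt u))"
  using assms(1)
proof (cases rule: alphabet_cases)
  case (1 y)
  have "diagram (wt (u @ [x])) = insert (y - 1, nat (wt u y)) (diagram (wt u))"
    "(y - 1, nat (wt u y)) \<notin> diagram (wt u)"
    by (rule diagram_Suc[where d = "wt u" and d' = "wt (u @ [x])"];
        use 1 dominant_nonneg[OF assms(2), of y] in simp)+
  then show ?thesis unfolding adds_box_def by blast
next
  case (2 y)
  have "diagram (wt u) = insert (y - 1, nat (wt (u @ [x]) y)) (diagram (wt (u @ [x])))"
    "(y - 1, nat (wt (u @ [x]) y)) \<notin> diagram (wt (u @ [x]))"
    by (rule diagram_Suc[where d = "wt (u @ [x])" and d' = "wt u"];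
        use 2 dominant_nonneg[OF assms(3), of y] in simp)+
  then show ?thesis unfolding adds_box_def by blast
qed

lemma hw_take: "hw w \<Longrightarrow> hw (take k w)"
  using hw_append[of "take k w" "drop k w"] by simp

lemma hw_letter:
  assumes "x \<in> alphabet n" "hw [x]"
  shows "x = Unb 1"
proof -
  have d: "dominant (wt [x])" using hw_dominant assms by blast
  show ?thesis
    using assms(1)
  proof (cases rule: alphabet_cases)
    case (1 y)
    have "wt [x] y \<le> wt [x] 1" using 1 by (intro dominant_mono[OF d]) auto
    then show ?thesis using 1 by (auto split: if_splits)
  next
    case (2 y)
    then show ?thesis using dominant_nonneg[OF d, of y] by simp
  qed
qed

lemma oscillating_Q:
  assumes "set w \<subseteq> alphabet n" "w \<noteq> []"
  shows "oscillating_tableau n (length w) (Q_tableau n w)"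
  using assms
proof (induction rule: hw_induct)
  case (hw w)
  note Q = nth_Q_tableau_hw[OF hw(1,2)]
  have dom: "dominant (wt (take k w))" for k using hw_dominant hw_take hw(2) by blast
  have "young_diagram D \<and> (\<forall>j. column_height D j \<le> n)" if "D \<in> set (Q_tableau n w)" for D
  proof -
    obtain k where "k < length w" "D = Q_tableau n w ! k" using \<open>D \<in> _\<close> by (auto simp: in_set_conv_nth)
    then show ?thesis using Q young_diagram_diagram[OF dom] by simp
  qed
  moreover have "Q_tableau n w ! 0 = {(0, 0)}"
  proof -
    obtain x v where w: "w = x # v" using hw(3) by (cases w) auto
    then have "hw [x]" using hw_take[OF hw(2), of 1] by simp
    then have "x = Unb 1" using hw_letter hw(1) w by simp
    then show ?thesis using Q[of 0] w n_pos by (auto simp: diagram_def split: if_splits)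
  qed
  moreover have "adds_box (Q_tableau n w ! k) (Q_tableau n w ! Suc k) \<or> adds_box (Q_tableau n w ! Suc k) (Q_tableau n w ! k)"
    if "Suc k < length w" for k
  proof -
    have t: "take (Suc (Suc k)) w = take (Suc k) w @ [w ! Suc k]" using that by (simp add: take_Suc_conv_app_nth)
    have "w ! Suc k \<in> alphabet n" using that hw(1) nth_mem by blast
    then show ?thesis
      using diagram_wt_snoc[of "w ! Suc k" "take (Suc k) w"] dom[of "Suc k"] dom[of "Suc (Suc k)"] that
      by (simp only: Q Suc_lessD t)
  qed
  ultimately show ?case using hw(3) by (simp add: oscillating_tableau_def Suc_le_eq)
next
  case (ew w i w')
  then show ?case using Q_tableau_ew length_ew by (metis length_0_conv)
qed

section \<open>Injectivity and surjectivity\<close>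

lemma Psi_inj:
  assumes "set w \<subseteq> alphabet n" "set w' \<subseteq> alphabet n" "crystal_eq w w'" "Q_tableau n w = Q_tableau n w'"
  shows "w = w'"
  using assms
proof (induction arbitrary: w' rule: hw_induct)
  case (hw w)
  have h': "hw w'" using crystal_eq_hw hw by blast
  have len: "length w = length w'" using hw(5) length_Q_tableau by metis
  have dom: "dominant (wt (take k w))" "dominant (wt (take k w'))" for k
    using hw_dominant hw_take hw(2) h' by blast+
  have wt: "wt (take k w) i = wt (take k w') i" if "k \<le> length w" "1 \<le> i" "i \<le> n" for k i
  proof (cases k)
    case (Suc m)
    then have "diagram (wt (take k w)) = diagram (wt (take k w'))"
      using nth_Q_tableau_hw[OF hw(1,2), of m] nth_Q_tableau_hw[OF hw(3) h', of m] hw(5) that len by simp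
    then show ?thesis using diagram_eq_iff[OF dom] that by blast
  qed simp
  show ?case
  proof (rule nth_equalityI[OF len])
    fix k assume k: "k < length w"
    have x: "w ! k \<in> alphabet n" "w' ! k \<in> alphabet n" using hw(1,3) k len nth_mem by (metis subsetD)+
    \<comment> \<open>The weights of consecutive prefixes differ by the weight of one letter, and
      distinct letters of the alphabet have distinct weights.\<close>
    have "wt [w ! k] i = wt [w' ! k] i" if "1 \<le> i" "i \<le> n" for i
      using wt[of k i] wt[of "Suc k" i] k len that by (simp add: take_Suc_conv_app_nth)
    then show "w ! k = w' ! k"
      using x by (auto elim!: alphabet_cases split: if_splits) (force split: if_splits)+
  qed
next
  case (ew w i v)
  obtain v' where v': "ew i w' = Some v'" "crystal_eq v v'" using crystal_eq_ew[OF ew(6,3)] by blast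
  have "set v' \<subseteq> alphabet n" using ew_alphabet v' ew by blast
  then have "v = v'" using ew(4) v' Q_tableau_ew ew by metis
  then show ?case using ew(3) v'(1) fw_ew by (metis option.inject)
qed

text \<open>The diagram does not distinguish a negative coordinate from 0, hence the separate
  hypothesis of nonnegativity.\<close>

lemma diagram_dominant:
  assumes "young_diagram (diagram d)" "\<And>i. 1 \<le> i \<Longrightarrow> i \<le> n \<Longrightarrow> 0 \<le> d i"
  shows "dominant d"
  unfolding dominant_def
proof (intro conjI allI impI)
  fix i assume i: "1 \<le> i \<and> i < n"
  show "d (Suc i) \<le> d i"
  proof (rule ccontr)
    assume "\<not> d (Suc i) \<le> d i"
    then have "(i, nat (d i)) \<in> diagram d" using i assms(2)[of i] by (auto simp: diagram_def)
    then have "(i - 1, nat (d i)) \<in> diagram d"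
      using assms(1) unfolding young_diagram_def by (meson diff_le_self order_refl)
    then show False using i assms(2)[of i] by (auto simp: diagram_def)
  qed
qed (use assms(2) n_pos in auto)

lemma column_height_row:
  assumes "young_diagram E" "column_height E j \<le> n" "(i, j) \<in> E"
  shows "i < n"
proof -
  have sub: "{..i} \<subseteq> {i'. (i', j) \<in> E}" using assms(1,3) unfolding young_diagram_def by blast
  have "{i'. (i', j) \<in> E} \<subseteq> fst ` E" by force
  then have "finite {i'. (i', j) \<in> E}" using assms(1) finite_subset unfolding young_diagram_def by blast
  then have "card {..i} \<le> column_height E j" using sub unfolding column_height_def by (intro card_mono)
  then show ?thesis using assms(2) by simp
qed

text \<open>A box in row \<open>i\<close>, counted from 0, is added by \<open>Unb (Suc i)\<close>
  and removed by \<open>Bar (Suc i)\<close>. That it sits at the end of its row follows from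
  \<open>E\<close> being a Young diagram; the new weight is then dominant and the extended word of
  highest weight.\<close>

lemma ex_letter:
  assumes u: "set u \<subseteq> alphabet n" "hw u"
    and E: "young_diagram E" "\<And>j. column_height E j \<le> n"
    and step: "adds_box (diagram (wt u)) E \<or> adds_box E (diagram (wt u))"
  shows "\<exists>x \<in> alphabet n. hw (u @ [x]) \<and> diagram (wt (u @ [x])) = E"
proof -
  note du = hw_dominant[OF u(2)]
  have yD: "young_diagram (diagram (wt u))" using young_diagram_diagram[OF du] by blast
  have fin: ?thesis if "x \<in> alphabet n" "diagram (wt (u @ [x])) = E"
    "\<And>i. 1 \<le> i \<Longrightarrow> i \<le> n \<Longrightarrow> 0 \<le> wt (u @ [x]) i" for x
    using that hw_snocI[OF u(2)] diagram_dominant E(1) by blast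
  from step show ?thesis
  proof
    assume "adds_box (diagram (wt u)) E"
    then obtain i j where b: "(i, j) \<notin> diagram (wt u)" "E = insert (i, j) (diagram (wt u))"
      unfolding adds_box_def by auto
    have i: "i < n" using column_height_row[OF E(1) E(2)] b(2) by blast
    have nn: "0 \<le> wt u (Suc i)" using dominant_nonneg[OF du] i by simp
    have "j = nat (wt u (Suc i))"
    proof (rule ccontr)
      assume ne: "j \<noteq> nat (wt u (Suc i))"
      have "nat (wt u (Suc i)) < j" using b(1) i ne by (auto simp: diagram_def)
      then have "(i, nat (wt u (Suc i))) \<in> E"
        using E(1) b(2) unfolding young_diagram_def by (meson insertI1 less_imp_le order_refl)
      then show False using b(2) ne nn by (auto simp: diagram_def)
    qed
    moreover have "diagram (wt (u @ [Unb (Suc i)])) = insert (Suc i - 1, nat (wt u (Suc i))) (diagram (wt u))"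
      by (rule diagram_Suc(1)) (use i nn in auto)
    ultimately have "diagram (wt (u @ [Unb (Suc i)])) = E" using b(2) by simp
    then show ?thesis
      using dominant_nonneg[OF du] i by (intro fin[of "Unb (Suc i)"]) (auto simp: alphabet_def)
  next
    assume "adds_box E (diagram (wt u))"
    then obtain i j where b: "(i, j) \<notin> E" "diagram (wt u) = insert (i, j) E"
      unfolding adds_box_def by auto
    have "(i, j) \<in> diagram (wt u)" using b(2) by blast
    then have i: "i < n" "int j < wt u (Suc i)" by (auto simp: diagram_def)
    let ?x = "Bar (Suc i)"
    have w: "wt (u @ [?x]) (Suc i) = wt u (Suc i) - 1" "\<And>z. z \<noteq> Suc i \<Longrightarrow> wt (u @ [?x]) z = wt u z" by auto
    have "j = nat (wt u (Suc i) - 1)"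
    proof (rule ccontr)
      assume ne: "j \<noteq> nat (wt u (Suc i) - 1)"
      then have "(i, nat (wt u (Suc i) - 1)) \<in> diagram (wt u)" "j \<le> nat (wt u (Suc i) - 1)"
        using i by (auto simp: diagram_def)
      then have "(i, nat (wt u (Suc i) - 1)) \<in> E" using b(2) ne by auto
      then have "(i, j) \<in> E"
        using E(1) \<open>j \<le> _\<close> unfolding young_diagram_def by (meson order_refl)
      then show False using b(1) by blast
    qed
    moreover have "diagram (wt u) = insert (Suc i - 1, nat (wt (u @ [?x]) (Suc i))) (diagram (wt (u @ [?x])))"
      "(Suc i - 1, nat (wt (u @ [?x]) (Suc i))) \<notin> diagram (wt (u @ [?x]))"
      by (rule diagram_Suc[where d = "wt (u @ [?x])" and d' = "wt u"]; use i w in auto)+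
    ultimately have "insert (i, j) (diagram (wt (u @ [?x]))) = insert (i, j) E" "(i, j) \<notin> diagram (wt (u @ [?x]))"
      using b(2) w(1) by simp_all
    then have "diagram (wt (u @ [?x])) = E" using b(1) by (simp add: insert_ident)
    moreover have "0 \<le> wt (u @ [?x]) z" if "1 \<le> z" "z \<le> n" for z
      using dominant_nonneg[OF du that] w(2)[of z] i w(1) by (cases "z = Suc i") auto
    ultimately show ?thesis using i by (intro fin[of ?x]) (auto simp: alphabet_def)
  qed
qed

lemma ex_hw_of_Q:
  assumes "oscillating_tableau n l Q"
  shows "\<exists>w. set w \<subseteq> alphabet n \<and> length w = l \<and> hw w \<and> Q_tableau n w = Q"
proof -
  have Q: "length Q = l" "1 \<le> l" "Q ! 0 = {(0, 0)}"
    "\<And>k. k < l \<Longrightarrow> young_diagram (Q ! k) \<and> (\<forall>j. column_height (Q ! k) j \<le> n)"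
    "\<And>k. Suc k < l \<Longrightarrow> adds_box (Q ! k) (Q ! Suc k) \<or> adds_box (Q ! Suc k) (Q ! k)"
    using assms nth_mem by (auto simp: oscillating_tableau_def)
  have "\<exists>w. set w \<subseteq> alphabet n \<and> length w = k \<and> hw w \<and> (\<forall>j < k. diagram (wt (take (Suc j) w)) = Q ! j)"
    if "k \<le> l" for k
    using that
  proof (induction k)
    case 0
    then show ?case by (auto simp: hw_def)
  next
    case (Suc k)
    then obtain u where u: "set u \<subseteq> alphabet n" "length u = k" "hw u"
      "\<And>j. j < k \<Longrightarrow> diagram (wt (take (Suc j) u)) = Q ! j" by auto
    have "adds_box (diagram (wt u)) (Q ! k) \<or> adds_box (Q ! k) (diagram (wt u))"
    proof (cases k)
      case 0
      \<comment> \<open>The first diagram of the sequence arises from the empty one by adding its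
        single box.\<close>
      then have "diagram (wt u) = {}" using u by (auto simp: diagram_def)
      then show ?thesis using Q(3) 0 by (auto simp: adds_box_def)
    next
      case (Suc m)
      then have "diagram (wt u) = Q ! m" using u(4)[of m] u(2) by simp
      then show ?thesis using Q(5)[of m] Suc Suc.prems by simp
    qed
    then obtain x where x: "x \<in> alphabet n" "hw (u @ [x])" "diagram (wt (u @ [x])) = Q ! k"
      using ex_letter[OF u(1,3), of "Q ! k"] Q(4)[of k] Suc.prems by auto
    have "diagram (wt (take (Suc j) (u @ [x]))) = Q ! j" if "j < Suc k" for j
    proof (cases "j = k")
      case True
      then have "take (Suc j) (u @ [x]) = u @ [x]" using u(2) by simp
      then show ?thesis using x(3) True by simp
    next
      case False
      then have "j < k" "take (Suc j) (u @ [x]) = take (Suc j) u" using that u(2) by auto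
      then show ?thesis using u(4) by simp
    qed
    moreover have "set (u @ [x]) \<subseteq> alphabet n" "length (u @ [x]) = Suc k" using u x by auto
    ultimately show ?case using x(2) by blast
  qed
  then obtain w where w: "set w \<subseteq> alphabet n" "length w = l" "hw w"
    "\<And>j. j < l \<Longrightarrow> diagram (wt (take (Suc j) w)) = Q ! j" by blast
  have "Q_tableau n w = Q"
    by (rule nth_equalityI) (use w Q(1) nth_Q_tableau_hw[OF w(1,3)] in auto)
  then show ?thesis using w by blast
qed

text \<open>\<open>u\<close> supplies the recording sequence. When the reading has highest weight,
  the shape forces \<open>P_tableau n u = T\<close>; otherwise a word found for the raised tableau
  is lowered by the same operator, which keeps its recording sequence.\<close>

lemma ex_word_of_pair:
  assumes "tab T" "set u \<subseteq> alphabet n" "hw u" "shape (P_tableau n u) = shape T"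
  shows "\<exists>w. set w \<subseteq> alphabet n \<and> crystal_eq w (reading T) \<and> Q_tableau n w = Q_tableau n u"
proof -
  have "\<exists>w. set w \<subseteq> alphabet n \<and> crystal_eq w r \<and> Q_tableau n w = Q_tableau n u"
    if "set r \<subseteq> alphabet n" "tab T" "r = reading T" "shape (P_tableau n u) = shape T" for r T
    using that
  proof (induction arbitrary: T rule: hw_induct)
    case (hw r)
    note P = P_tableau[OF assms(2)]
    have "P_tableau n u = T"
      using hw_tab_unique[OF P(1) hw(3)] crystal_eq_hw[OF P(2) assms(3)] hw by simp
    then show ?case using P(2) hw(4) assms(2) by blast
  next
    case (ew r i r')
    obtain T' where T': "tab T'" "reading T' = r'" "map length T' = map length T"
      using tab_ew[OF ew(5)] ew(3,6) by blast
    have "shape (P_tableau n u) = shape T'" using shape_cong[OF T'(3)] ew(7) by simp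
    then obtain v where v: "set v \<subseteq> alphabet n" "crystal_eq v r'" "Q_tableau n v = Q_tableau n u"
      using ew(4)[OF T'(1)] T'(2) by blast
    have "fw i r' = Some r" using ew(3) fw_ew by blast
    then obtain w where w: "fw i v = Some w" "crystal_eq r w"
      using crystal_eq_fw[OF crystal_eq_sym[OF v(2)]] by blast
    have "set w \<subseteq> alphabet n" using fw_alphabet[OF w(1) v(1)] .
    moreover have "Q_tableau n v = Q_tableau n w" using Q_tableau_ew calculation w(1) fw_ew by blast
    ultimately show ?case using v(3) crystal_eq_sym[OF w(2)] by metis
  qed
  then show ?thesis using assms reading_alphabet by blast
qed

theorem Psi_bij_betw:
  assumes "1 \<le> l"
  shows "bij_betw (Psi n) (words_of_length n l) (tableau_pairs n l)"
  unfolding bij_betw_def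
proof
  show "inj_on (Psi n) (words_of_length n l)"
  proof (rule inj_onI)
    fix w w' assume w: "w \<in> words_of_length n l" "w' \<in> words_of_length n l" "Psi n w = Psi n w'"
    then have al: "set w \<subseteq> alphabet n" "set w' \<subseteq> alphabet n" by (auto simp: words_of_length_def)
    have "P_tableau n w = P_tableau n w'" "Q_tableau n w = Q_tableau n w'" using w(3) by (auto simp: Psi_def)
    then show "w = w'"
      using Psi_inj[OF al] P_tableau(2)[OF al(1)] P_tableau(2)[OF al(2)] crystal_eq_sym crystal_eq_trans by metis
  qed
  show "Psi n ` words_of_length n l = tableau_pairs n l"
  proof
    show "Psi n ` words_of_length n l \<subseteq> tableau_pairs n l"
    proof
      fix p assume "p \<in> Psi n ` words_of_length n l"
      then obtain w where w: "set w \<subseteq> alphabet n" "length w = l" "p = Psi n w" by (auto simp: words_of_length_def)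
      then have "w \<noteq> []" using assms by auto
      then show "p \<in> tableau_pairs n l"
        using oscillating_Q[OF w(1)] last_Q_tableau P_tableau(1)[OF w(1)] w by (auto simp: tableau_pairs_def Psi_def)
    qed
    show "tableau_pairs n l \<subseteq> Psi n ` words_of_length n l"
    proof
      fix p assume "p \<in> tableau_pairs n l"
      then obtain T Q where p: "p = (T, Q)" "tab T" "oscillating_tableau n l Q" "shape T = last Q"
        by (auto simp: tableau_pairs_def)
      obtain u where u: "set u \<subseteq> alphabet n" "length u = l" "hw u" "Q_tableau n u = Q"
        using ex_hw_of_Q[OF p(3)] by blast
      have "shape (P_tableau n u) = shape T" using last_Q_tableau[of u] u p(4) assms by force
      then obtain w where w: "set w \<subseteq> alphabet n" "crystal_eq w (reading T)" "Q_tableau n w = Q_tableau n u"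
        using ex_word_of_pair[OF p(2) u(1,3)] by blast
      have "length w = l" using w(3) u(2) length_Q_tableau by metis
      then show "p \<in> Psi n ` words_of_length n l"
        using w u P_tableau_eqI[OF p(2) w(2)] p(1) by (auto simp: words_of_length_def Psi_def image_iff intro!: exI[of _ w])
    qed
  qed
qed

end

theorem theorem5p5:
  fixes n l :: nat
  assumes "n \<ge> 1" and "l \<ge> 1"
  shows "bij_betw (Psi n) (words_of_length n l) (tableau_pairs n l)"
proof -
  interpret sp_words n by unfold_locales (rule assms(1))
  show ?thesis by (rule Psi_bij_betw[OF assms(2)])
qed

end
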